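(* Let $\omega=B(0,1)\subset\mathbb R^2$. Assume that $\hat\nu$ satisfies (N1), (N2), (N3), that $\mathcal J$ satisfies (J), and that $u^{(2)}_0|_{\Omega^d}\in C^{1,\beta}(\Omega^d)$ for some $\beta>0$ and $p^{(2)}_0|_{\Omega^d}\in C^{1,\tilde\beta}(\Omega^d)$ for some $\tilde\beta>0$ (all as in the context). Then the matrix $\mathcal M^{(2)}=\mathcal M^{(2)}(\omega,\mathrm DT(U_0^{(2)}))$ appearing in the topological derivative $$G^{air\to f}(x_0)=(U_0^{(2)})^\top\mathcal M^{(2)}P_0^{(2)}+\int_\omega S_{U_0^{(2)}}(\nabla H^{(2)})\cdot(P_0^{(2)}+\nabla K^{(2)})\,dx+\delta_J$$ is $$\mathcal M^{(2)}=2|\omega|\nu_0\,R\begin{pmatrix}\frac{\lambda_1-\nu_0}{\lambda_2+\nu_0}&0\\0&\frac{\lambda_1-\nu_0}{\lambda_1+\nu_0}\end{pmatrix}R^\top ,$$ where $\lambda_1=\hat\nu(|U_0^{(2)}|)$, $\lambda_2=\hat\nu(|U_0^{(2)}|)+\hat\nu'(|U_0^{(2)}|)|U_0^{(2)}|$, and $R$ is the rotation matrix with $U_0^{(2)}=R(|U_0^{(2)}|,0)^\top$.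
   Context: **Material law.** $\nu_0>0$ is a constant and $\hat\nu:[0,\infty)\to[0,\infty)$. (N1) $\hat\nu$ is $C^1$ and there is $\underline\nu>0$ with $\underline\nu\le\hat\nu(s)\le\nu_0$ and $\underline\nu\le(\hat\nu(s)s)'\le\nu_0$ for all $s\ge0$. (N2) $\hat\nu\in C^3([0,\infty))$; there is $\tilde c>0$ with $|\hat\nu'(s)|/s\le\tilde c$ for all $s\ge0$ (at $s=0$ in the sense of limits); and there are nonnegative constants $\tilde c_4,\tilde c_5,\tilde c',\tilde c''$ with $|(\hat\nu(s)s)''|\le\tilde c_4$, $|(\hat\nu(s)s)'''|\le\tilde c_5$, $|\hat\nu'(s)|\le\tilde c'$, $|\hat\nu''(s)|\le\tilde c''$ for all $s\ge0$. (N3) $\delta_{\hat\nu}:=\inf_{s>0}\hat\nu'(s)s/\hat\nu(s)$ satisfies $\delta_{\hat\nu}>\max\{-\tfrac13,\,-\tfrac{(1+k_1)^2}{(1+k_1)^2+2}\}$ with $k_1=(\underline\nu-\nu_0)/\nu_0$. **Operators.** For $V,W\in\mathbb R^2$: $T(W)=\hat\nu(|W|)W$, with Jacobian $\mathrm DT(W)=\hat\nu(|W|)I+\frac{\hat\nu'(|W|)}{|W|}W\otimes W$ for $W\ne0$ and $\mathrm DT(0)=\hat\nu(0)I$; $S_W(V)=T(W+V)-T(W)-\mathrm DT(W)V$. **Setting (ferromagnetic inclusion in air).** $D\subset\mathbb R^2$ is a bounded domain, $F\in H^{-1}(D)$ with $\mathrm{supp}(F)\subset\subset D$, $\Omega^d$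 is open with $\Omega^d\subset\subset D\setminus\mathrm{supp}(F)$, $x_0\in\Omega^d$, $\omega_\varepsilon=x_0+\varepsilon\omega$. Unperturbed state $u_0^{(2)}\in H_0^1(D)$: $\int_D\nu_0\nabla u_0^{(2)}\cdot\nabla\eta=\langle F,\eta\rangle$ for all $\eta\in H_0^1(D)$. For $\varepsilon>0$, $T^{(2)}_\varepsilon(x,W)=\chi_{\omega_\varepsilon}(x)T(W)+\chi_{D\setminus\omega_\varepsilon}(x)\nu_0W$, and $u_\varepsilon^{(2)}\in H_0^1(D)$ solves $\int_DT^{(2)}_\varepsilon(x,\nabla u^{(2)}_\varepsilon)\cdot\nabla\eta=\langle F,\eta\rangle$ for all $\eta\in H_0^1(D)$. (J) $\mathcal J:H_0^1(D)\to\mathbb R$ is such that, for $\varepsilon\ge0$ small enough, $\mathcal J(u^{(2)}_\varepsilon)=\mathcal J(u^{(2)}_0)+\langle\tilde G,u^{(2)}_\varepsilon-u^{(2)}_0\rangle+\delta_J\varepsilon^2+R(\varepsilon)$, where $\tilde G$ is a bounded linear form on $H_0^1(D)$, $\delta_J\in\mathbb R$, and $R(\varepsilon)=O\big(\int_{D\setminus B(x_0,\hat\alpha\varepsilon^{\tilde r})}|\nabla(u^{(2)}_\varepsilon-u^{(2)}_0)|^2\big)$ for some given $\hat\alpha>0$, $\tilde r\in(0,1)$. Unperturbed adjoint state $p_0^{(2)}\in H_0^1(D)$: $\int_D\nu_0\nabla p_0^{(2)}\cdot\nabla\eta=-\langle\tilde G,\eta\rangle$ for all $\eta\in H_0^1(D)$.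 $U_0^{(2)}=\nabla u_0^{(2)}(x_0)$, $P_0^{(2)}=\nabla p_0^{(2)}(x_0)$. $G^{air\to f}(x_0)$ is the number with $\mathcal J(u^{(2)}_\varepsilon)-\mathcal J(u^{(2)}_0)=\varepsilon^2G^{air\to f}(x_0)+o(\varepsilon^2)$. **Weighted space.** With $w(x)=\frac1{(1+|x|^2)^{1/2}\log(2+|x|)}$, let $\mathcal H^w(\mathbb R^2)=\{u\in\mathcal D'(\mathbb R^2): wu\in L^2,\nabla u\in L^2\}$ with its natural Hilbert norm, and $\mathcal H(\mathbb R^2)=\mathcal H^w(\mathbb R^2)/\mathbb R$ (quotient by constants). **Problems at scale 1.** $H^{(2)}\in\mathcal H(\mathbb R^2)$ solves, for all $\eta\in\mathcal H(\mathbb R^2)$, $\int_{\mathbb R^2\setminus\omega}\nu_0\nabla H^{(2)}\cdot\nabla\eta+\int_\omega(T(U_0^{(2)}+\nabla H^{(2)})-T(U_0^{(2)}))\cdot\nabla\eta=\int_\omega(\nu_0-\hat\nu(|U_0^{(2)}|))U_0^{(2)}\cdot\nabla\eta$. For $P\in\mathbb R^2$, $K_P^{(2)}\in\mathcal H(\mathbb R^2)$ solves, for all $\eta\in\mathcal H(\mathbb R^2)$, $\int_{\mathbb R^2\setminus\omega}\nu_0\nabla K_P^{(2)}\cdot\nabla\eta+\int_\omega\mathrm DT(U_0^{(2)})\nabla K_P^{(2)}\cdot\nabla\eta=\int_\omega(\nu_0I-\mathrm DT(U_0^{(2)}))P\cdot\nabla\eta$; $K^{(2)}=K^{(2)}_{P_0^{(2)}}$.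 **The matrix.** $\mathcal M^{(2)}\in\mathbb R^{2\times2}$ is the matrix of the linear map $\mathbb R^2\ni P\mapsto(\hat\nu(|U_0^{(2)}|)-\nu_0)\int_\omega(P+\nabla K^{(2)}_P)\,dx\in\mathbb R^2$. *)

theory Defs
  imports "HOL-Analysis.Analysis" "HOL-Library.Landau_Symbols"
begin

section \<open>Material law\<close>

text \<open>A function on \<open>[0,\<infinity>)\<close> is a function on the reals whose values at negative
  arguments are irrelevant; derivatives at \<open>0\<close> are one-sided.\<close>

definition deriv_hl :: "(real \<Rightarrow> real) \<Rightarrow> real \<Rightarrow> real" where
  "deriv_hl f s = vector_derivative f (at s within {0..})"

definition Ck_hl :: "nat \<Rightarrow> (real \<Rightarrow> real) \<Rightarrow> bool" where
  "Ck_hl k f \<longleftrightarrow> (\<forall>j<k. ((deriv_hl ^^ j) f) differentiable_on {0..})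
     \<and> continuous_on {0..} ((deriv_hl ^^ k) f)"

definition cond_N1 :: "real \<Rightarrow> real \<Rightarrow> (real \<Rightarrow> real) \<Rightarrow> bool" where
  "cond_N1 nu0 nulow nu \<longleftrightarrow> Ck_hl 1 nu \<and> nulow > 0 \<and>
     (\<forall>s\<ge>0. nulow \<le> nu s \<and> nu s \<le> nu0 \<and>
        nulow \<le> deriv_hl (\<lambda>s. nu s * s) s \<and> deriv_hl (\<lambda>s. nu s * s) s \<le> nu0)"

definition cond_N2 :: "(real \<Rightarrow> real) \<Rightarrow> bool" where
  "cond_N2 nu \<longleftrightarrow> Ck_hl 3 nu \<and>
     (\<exists>c>0. (\<forall>s>0. \<bar>deriv_hl nu s\<bar> / s \<le> c) \<and>
        (\<exists>l\<le>c. ((\<lambda>s. \<bar>deriv_hl nu s\<bar> / s) \<longlongrightarrow> l) (at_right 0))) \<and>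
     (\<exists>c4\<ge>0. \<exists>c5\<ge>0. \<exists>c'\<ge>0. \<exists>c''\<ge>0. \<forall>s\<ge>0.
        \<bar>(deriv_hl ^^ 2) (\<lambda>s. nu s * s) s\<bar> \<le> c4 \<and>
        \<bar>(deriv_hl ^^ 3) (\<lambda>s. nu s * s) s\<bar> \<le> c5 \<and>
        \<bar>deriv_hl nu s\<bar> \<le> c' \<and> \<bar>(deriv_hl ^^ 2) nu s\<bar> \<le> c'')"

text \<open>Under \<open>cond_N1\<close> the set below is bounded from below by \<open>nulow / nu0 - 1\<close>, so that
  the real-valued infimum is the true one.\<close>

definition delta_nu :: "(real \<Rightarrow> real) \<Rightarrow> real" where
  "delta_nu nu = (INF s\<in>{0<..}. deriv_hl nu s * s / nu s)"

definition cond_N3 :: "real \<Rightarrow> real \<Rightarrow> (real \<Rightarrow> real) \<Rightarrow> bool" where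
  "cond_N3 nu0 nulow nu \<longleftrightarrow>
     (let k1 = (nulow - nu0) / nu0
      in delta_nu nu > max (- 1 / 3) (- ((1 + k1)\<^sup>2 / ((1 + k1)\<^sup>2 + 2))))"

definition T_op :: "(real \<Rightarrow> real) \<Rightarrow> real^2 \<Rightarrow> real^2" where
  "T_op nu W = nu (norm W) *\<^sub>R W"

definition outer :: "real^2 \<Rightarrow> real^2 \<Rightarrow> real^2^2" where
  "outer V W = (\<chi> i j. V $ i * W $ j)"

definition DT_op :: "(real \<Rightarrow> real) \<Rightarrow> real^2 \<Rightarrow> real^2^2" where
  "DT_op nu W = (if W = 0 then nu 0 *\<^sub>R mat 1
     else nu (norm W) *\<^sub>R mat 1 + (deriv_hl nu (norm W) / norm W) *\<^sub>R outer W W)"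

definition S_op :: "(real \<Rightarrow> real) \<Rightarrow> real^2 \<Rightarrow> real^2 \<Rightarrow> real^2" where
  "S_op nu W V = T_op nu (W + V) - T_op nu W - DT_op nu W *v V"


section \<open>Function spaces\<close>

text \<open>Elements of Lebesgue and Sobolev spaces on \<open>\<Omega>\<close> are represented by Borel functions on
  the whole plane; the values outside \<open>\<Omega>\<close> are irrelevant.\<close>

definition partial :: "2 \<Rightarrow> (real^2 \<Rightarrow> real) \<Rightarrow> real^2 \<Rightarrow> real" where
  "partial i f x = frechet_derivative f (at x) (axis i 1)"

definition grad :: "(real^2 \<Rightarrow> real) \<Rightarrow> real^2 \<Rightarrow> real^2" where
  "grad f x = (\<chi> i. partial i f x)"

definition smooth :: "(real^2 \<Rightarrow> real) \<Rightarrow> bool" where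
  "smooth f \<longleftrightarrow> (\<forall>is x. (foldr partial is f) differentiable (at x))"

definition test_fun :: "(real^2) set \<Rightarrow> (real^2 \<Rightarrow> real) set" where
  "test_fun \<Omega> = {\<phi>. smooth \<phi> \<and> compact (closure {x. \<phi> x \<noteq> 0}) \<and> closure {x. \<phi> x \<noteq> 0} \<subseteq> \<Omega>}"

definition L2 :: "(real^2) set \<Rightarrow> (real^2 \<Rightarrow> 'b::real_normed_vector) \<Rightarrow> bool" where
  "L2 \<Omega> f \<longleftrightarrow> set_borel_measurable lborel \<Omega> f \<and> set_integrable lborel \<Omega> (\<lambda>x. (norm (f x))\<^sup>2)"

definition loc_integrable ::
    "(real^2) set \<Rightarrow> (real^2 \<Rightarrow> 'b::{banach, second_countable_topology}) \<Rightarrow> bool" where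
  "loc_integrable \<Omega> f \<longleftrightarrow> (\<forall>C. compact C \<and> C \<subseteq> \<Omega> \<longrightarrow> set_integrable lborel C f)"

definition has_weak_gradient ::
    "(real^2) set \<Rightarrow> (real^2 \<Rightarrow> real) \<Rightarrow> (real^2 \<Rightarrow> real^2) \<Rightarrow> bool" where
  "has_weak_gradient \<Omega> u g \<longleftrightarrow> loc_integrable \<Omega> u \<and> loc_integrable \<Omega> g \<and>
     (\<forall>\<phi>\<in>test_fun \<Omega>. \<forall>i.
        (LINT x:\<Omega>|lborel. u x * partial i \<phi> x) = - (LINT x:\<Omega>|lborel. g x $ i * \<phi> x))"

text \<open>A weak gradient is unique almost everywhere on \<open>\<Omega>\<close>; it is only used under integrals
  over subsets of \<open>\<Omega>\<close>.\<close>

definition wgrad :: "(real^2) set \<Rightarrow> (real^2 \<Rightarrow> real) \<Rightarrow> real^2 \<Rightarrow> real^2" where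
  "wgrad \<Omega> u = (SOME g. has_weak_gradient \<Omega> u g)"

definition H1 :: "(real^2) set \<Rightarrow> (real^2 \<Rightarrow> real) set" where
  "H1 \<Omega> = {u. L2 \<Omega> u \<and> (\<exists>g. has_weak_gradient \<Omega> u g \<and> L2 \<Omega> g)}"

definition H1_norm :: "(real^2) set \<Rightarrow> (real^2 \<Rightarrow> real) \<Rightarrow> real" where
  "H1_norm \<Omega> u =
     sqrt ((LINT x:\<Omega>|lborel. (u x)\<^sup>2) + (LINT x:\<Omega>|lborel. (norm (wgrad \<Omega> u x))\<^sup>2))"

definition H10 :: "(real^2) set \<Rightarrow> (real^2 \<Rightarrow> real) set" where
  "H10 \<Omega> = {u \<in> H1 \<Omega>. \<exists>\<phi>. (\<forall>n. \<phi> n \<in> test_fun \<Omega>) \<and>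
     (\<lambda>n. H1_norm \<Omega> (\<lambda>x. \<phi> n x - u x)) \<longlonglongrightarrow> 0}"

definition bounded_form_H10 :: "(real^2) set \<Rightarrow> ((real^2 \<Rightarrow> real) \<Rightarrow> real) \<Rightarrow> bool" where
  "bounded_form_H10 \<Omega> F \<longleftrightarrow>
     (\<forall>u\<in>H10 \<Omega>. \<forall>v\<in>H10 \<Omega>. F (\<lambda>x. u x + v x) = F u + F v) \<and>
     (\<forall>c. \<forall>u\<in>H10 \<Omega>. F (\<lambda>x. c * u x) = c * F u) \<and>
     (\<exists>C. \<forall>u\<in>H10 \<Omega>. \<bar>F u\<bar> \<le> C * H1_norm \<Omega> u)"

definition dist_support :: "(real^2) set \<Rightarrow> ((real^2 \<Rightarrow> real) \<Rightarrow> real) \<Rightarrow> (real^2) set" where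
  "dist_support \<Omega> F = \<Omega> - \<Union>{U. open U \<and> U \<subseteq> \<Omega> \<and> (\<forall>\<phi>\<in>test_fun U. F \<phi> = 0)}"

definition compactly_in :: "(real^2) set \<Rightarrow> (real^2) set \<Rightarrow> bool" where
  "compactly_in A B \<longleftrightarrow> compact (closure A) \<and> closure A \<subseteq> B"

definition C1_holder :: "(real^2) set \<Rightarrow> real \<Rightarrow> (real^2 \<Rightarrow> real) \<Rightarrow> bool" where
  "C1_holder \<Omega> \<beta> f \<longleftrightarrow> (\<forall>x\<in>\<Omega>. f differentiable (at x)) \<and>
     bounded (f ` \<Omega>) \<and> bounded (grad f ` \<Omega>) \<and>
     (\<exists>C. \<forall>x\<in>\<Omega>. \<forall>y\<in>\<Omega>. norm (grad f x - grad f y) \<le> C * dist x y powr \<beta>)"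

definition weight :: "real^2 \<Rightarrow> real" where
  "weight x = 1 / (sqrt (1 + (norm x)\<^sup>2) * ln (2 + norm x))"

definition Hw :: "(real^2 \<Rightarrow> real) set" where
  "Hw = {u. L2 UNIV (\<lambda>x. weight x * u x) \<and> (\<exists>g. has_weak_gradient UNIV u g \<and> L2 UNIV g)}"

definition mod_const :: "((real^2 \<Rightarrow> real) \<times> (real^2 \<Rightarrow> real)) set" where
  "mod_const = {(u, v). u \<in> Hw \<and> v \<in> Hw \<and> (\<exists>c. AE x in lborel. u x - v x = c)}"

definition Hq :: "(real^2 \<Rightarrow> real) set set" where
  "Hq = Hw // mod_const"

text \<open>All representatives of a class have the same weak gradient almost everywhere.\<close>

definition qgrad :: "(real^2 \<Rightarrow> real) set \<Rightarrow> real^2 \<Rightarrow> real^2" where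
  "qgrad X = wgrad UNIV (SOME u. u \<in> X)"


section \<open>State, adjoint state and functional on the bounded domain\<close>

definition solves_linear ::
    "(real^2) set \<Rightarrow> real \<Rightarrow> ((real^2 \<Rightarrow> real) \<Rightarrow> real) \<Rightarrow> (real^2 \<Rightarrow> real) \<Rightarrow> bool" where
  "solves_linear D nu0 F u \<longleftrightarrow> u \<in> H10 D \<and>
     (\<forall>\<eta>\<in>H10 D. (LINT x:D|lborel. nu0 * (wgrad D u x \<bullet> wgrad D \<eta> x)) = F \<eta>)"

definition scaled :: "real^2 \<Rightarrow> (real^2) set \<Rightarrow> real \<Rightarrow> (real^2) set" where
  "scaled x0 \<omega> \<epsilon> = (\<lambda>y. x0 + \<epsilon> *\<^sub>R y) ` \<omega>"

definition T_eps ::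
    "(real^2) set \<Rightarrow> real \<Rightarrow> (real \<Rightarrow> real) \<Rightarrow> (real^2) set \<Rightarrow> real^2 \<Rightarrow> real^2 \<Rightarrow> real^2" where
  "T_eps D nu0 nu \<omega>\<epsilon> x W =
     indicator \<omega>\<epsilon> x *\<^sub>R T_op nu W + indicator (D - \<omega>\<epsilon>) x *\<^sub>R (nu0 *\<^sub>R W)"

definition solves_perturbed ::
    "(real^2) set \<Rightarrow> real \<Rightarrow> (real \<Rightarrow> real) \<Rightarrow> ((real^2 \<Rightarrow> real) \<Rightarrow> real) \<Rightarrow> (real^2) set \<Rightarrow>
     (real^2 \<Rightarrow> real) \<Rightarrow> bool" where
  "solves_perturbed D nu0 nu F \<omega>\<epsilon> u \<longleftrightarrow> u \<in> H10 D \<and>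
     (\<forall>\<eta>\<in>H10 D. (LINT x:D|lborel. T_eps D nu0 nu \<omega>\<epsilon> x (wgrad D u x) \<bullet> wgrad D \<eta> x) = F \<eta>)"

text \<open>The first conjunct says that \<open>J\<close> is a function on \<open>H10 D\<close> modulo equality almost
  everywhere.\<close>

definition cond_J ::
    "(real^2) set \<Rightarrow> real^2 \<Rightarrow> ((real^2 \<Rightarrow> real) \<Rightarrow> real) \<Rightarrow> (real \<Rightarrow> real^2 \<Rightarrow> real) \<Rightarrow>
     ((real^2 \<Rightarrow> real) \<Rightarrow> real) \<Rightarrow> real \<Rightarrow> real \<Rightarrow> real \<Rightarrow> bool" where
  "cond_J D x0 J u G \<delta>J \<alpha> r \<longleftrightarrow>
     (\<forall>v\<in>H10 D. \<forall>w\<in>H10 D. (AE x in lborel. x \<in> D \<longrightarrow> v x = w x) \<longrightarrow> J v = J w) \<and>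
     bounded_form_H10 D G \<and> \<alpha> > 0 \<and> 0 < r \<and> r < 1 \<and>
     (\<exists>R \<epsilon>0. \<epsilon>0 > 0 \<and>
        (\<forall>\<epsilon>\<in>{0..<\<epsilon>0}. J (u \<epsilon>) = J (u 0) + G (\<lambda>x. u \<epsilon> x - u 0 x) + \<delta>J * \<epsilon>\<^sup>2 + R \<epsilon>) \<and>
        R \<in> O[at_right 0](\<lambda>\<epsilon>. LINT x:(D - ball x0 (\<alpha> * \<epsilon> powr r))|lborel.
               (norm (wgrad D (\<lambda>x. u \<epsilon> x - u 0 x) x))\<^sup>2))"

definition has_topological_derivative ::
    "((real^2 \<Rightarrow> real) \<Rightarrow> real) \<Rightarrow> (real \<Rightarrow> real^2 \<Rightarrow> real) \<Rightarrow> real \<Rightarrow> bool" where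
  "has_topological_derivative J u g \<longleftrightarrow>
     (\<lambda>\<epsilon>. J (u \<epsilon>) - J (u 0) - \<epsilon>\<^sup>2 * g) \<in> o[at_right 0](\<lambda>\<epsilon>. \<epsilon>\<^sup>2)"


section \<open>Problems at scale 1\<close>

definition solves_H ::
    "real \<Rightarrow> (real \<Rightarrow> real) \<Rightarrow> (real^2) set \<Rightarrow> real^2 \<Rightarrow> (real^2 \<Rightarrow> real) set \<Rightarrow> bool" where
  "solves_H nu0 nu \<omega> U H \<longleftrightarrow> H \<in> Hq \<and>
     (\<forall>\<eta>\<in>Hq.
        (LINT x:(- \<omega>)|lborel. nu0 * (qgrad H x \<bullet> qgrad \<eta> x))
        + (LINT x:\<omega>|lborel. (T_op nu (U + qgrad H x) - T_op nu U) \<bullet> qgrad \<eta> x)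
        = (LINT x:\<omega>|lborel. ((nu0 - nu (norm U)) *\<^sub>R U) \<bullet> qgrad \<eta> x))"

definition solves_K ::
    "real \<Rightarrow> (real \<Rightarrow> real) \<Rightarrow> (real^2) set \<Rightarrow> real^2 \<Rightarrow> real^2 \<Rightarrow> (real^2 \<Rightarrow> real) set \<Rightarrow> bool" where
  "solves_K nu0 nu \<omega> U P K \<longleftrightarrow> K \<in> Hq \<and>
     (\<forall>\<eta>\<in>Hq.
        (LINT x:(- \<omega>)|lborel. nu0 * (qgrad K x \<bullet> qgrad \<eta> x))
        + (LINT x:\<omega>|lborel. (DT_op nu U *v qgrad K x) \<bullet> qgrad \<eta> x)
        = (LINT x:\<omega>|lborel. ((nu0 *\<^sub>R mat 1 - DT_op nu U) *v P) \<bullet> qgrad \<eta> x))"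

definition M_map ::
    "real \<Rightarrow> (real \<Rightarrow> real) \<Rightarrow> (real^2) set \<Rightarrow> real^2 \<Rightarrow> (real^2 \<Rightarrow> (real^2 \<Rightarrow> real) set) \<Rightarrow>
     real^2 \<Rightarrow> real^2" where
  "M_map nu0 nu \<omega> U K P =
     (nu (norm U) - nu0) *\<^sub>R (LINT x:\<omega>|lborel. P + qgrad (K P) x)"

end

theory Submission
  imports Defs "HOL-Probability.Sinc_Integral"
begin

text \<open>On the unit disc both problems at scale one have explicit solutions, and this makes the theorem
elementary. The vector field that equals a constant \<open>a\<close> inside the disc and the dipole
\<open>a / |z|^2 - 2 (a \<bullet> z) z / |z|^4\<close> outside is the gradient of \<open>(a \<bullet> z) min(1, 1/|z|^2)\<close>. If its
inner value is replaced by \<open>-a\<close>, the result is a quarter turn of another such gradient, hence a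
curl, hence orthogonal to all gradients. So a transmission problem with conductivity \<open>\<nu>0\<close>
outside the disc and a law \<open>A\<close> with source \<open>B\<close> inside is solved by the dipole field as
soon as \<open>A a - B = - \<nu>0 a\<close>, and strong monotonicity of \<open>A\<close> makes the interior gradient
unique (\<open>transmission_solution_in_disc\<close>).

For the linearised problem this says that \<open>P + \<nabla>K_P\<close> is, in the disc, the constant \<open>w\<close> with
\<open>(DT + \<nu>0) w = 2 \<nu>0 P\<close>. The symmetric matrix \<open>DT\<close> has the eigenvalue \<open>\<lambda>2\<close> along \<open>U0\<close> and
\<open>\<lambda>1\<close> across it; integrating \<open>w\<close> over the disc gives the formula for \<open>M\<close>. For the nonlinear
problem \<open>U0 + \<nabla>H\<close> is, in the disc, the constant \<open>b\<close> with \<open>T(b) + \<nu>0 b = 2 \<nu>0 U0\<close>, a multiple of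
\<open>U0\<close> that exists by the intermediate value theorem (\<open>exists_interior_field\<close>).

In the expansion of \<open>J\<close> the adjoint
equation turns \<open>G(u \<epsilon> - u 0)\<close> into the integral of \<open>(T - \<nu>0)(\<nabla>u \<epsilon>) \<bullet> \<nabla>p0\<close> over the inclusion,
of area of order \<open>\<epsilon>^2\<close> (\<open>adjoint_representation\<close>). It therefore suffices that
\<open>\<nabla>(u \<epsilon> - u 0)\<close> differs from the rescaled dipole field by \<open>o(\<epsilon>)\<close> in the mean square norm
(\<open>err_energy_tendsto\<close>). This is a quasi-optimality argument: by monotonicity the error is bounded
by the oscillation of \<open>\<nabla>u 0\<close> on the inclusion and by the distance from the dipole field to the
gradients of admissible functions, and after rescaling the dipole potential is a limit of
smooth functions with compact support, which are admissible once \<open>\<epsilon>\<close> is small. The integral then has the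
limit \<open>|\<omega>| (T(b) - \<nu>0 b) \<bullet> P0\<close>, the same estimate shows that the remainder of \<open>J\<close> is
\<open>o(\<epsilon>^2)\<close>, and the symmetry of \<open>DT\<close> identifies the limit with the expression in the theorem.

Test functions are smooth in the sense that all iterated partial derivatives exist. They are
supplied by an algebra of explicit functions that is closed under partial derivatives and
contains functions with compact support; it yields both the uniqueness of weak gradients
(\<open>weak_gradient_unique\<close>) and the approximation of the dipole potential
(\<open>L2_grad_dipole_approx_tendsto\<close>).\<close>

section \<open>An algebra of smooth functions\<close>

text \<open>The factor \<open>t^(-n)\<close> closes the family of multiples of \<open>exp (-1/t)\<close> under differentiation.\<close>

definition flat_exp :: "nat \<Rightarrow> real \<Rightarrow> real" where
  "flat_exp n t = (if 0 < t then exp (- 1 / t) * (1 / t) ^ n else 0)"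

lemma flat_exp_nonneg: "0 \<le> flat_exp n t"
  by (simp add: flat_exp_def)

lemma flat_exp_tendsto_0: "(flat_exp n \<longlongrightarrow> 0) (at 0)"
proof (rule filterlim_split_at)
  show "(flat_exp n \<longlongrightarrow> 0) (at_left 0)"
    by (rule tendsto_eventually) (auto simp: flat_exp_def eventually_at_filter)
  have "((\<lambda>t. (1 / t) ^ n / exp (1 / t)) \<longlongrightarrow> 0) (at_right (0::real))"
    using filterlim_compose[OF tendsto_power_div_exp_0 filterlim_inverse_at_top_right, of n]
    by (simp add: inverse_eq_divide)
  then show "(flat_exp n \<longlongrightarrow> 0) (at_right 0)"
    by (rule Lim_transform_eventually)
      (auto simp: flat_exp_def eventually_at_filter exp_minus field_simps)
qed

text \<open>At \<open>0\<close> the difference quotient of the function with index \<open>n\<close> is the function with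
index \<open>n + 1\<close>, which tends to \<open>0\<close>.\<close>

lemma flat_exp_has_derivative:
  "(flat_exp n has_real_derivative flat_exp (n + 2) t - real n * flat_exp (n + 1) t) (at t)"
proof (cases t "0::real" rule: linorder_cases)
  case less
  have "((\<lambda>_. 0) has_real_derivative 0) (at t)" by simp
  then have "(flat_exp n has_real_derivative 0) (at t)"
    by (rule has_field_derivative_transform_within_open[where S = "{..<0}"])
      (use less in \<open>auto simp: flat_exp_def\<close>)
  then show ?thesis using less by (simp add: flat_exp_def)
next
  case equal
  have "(flat_exp n h - flat_exp n 0) / h = flat_exp (n + 1) h" for h
    by (simp add: flat_exp_def)
  then have "((\<lambda>h. (flat_exp n h - flat_exp n 0) / h) \<longlongrightarrow> 0) (at 0)"
    using flat_exp_tendsto_0[of "n + 1"] by simp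
  then show ?thesis using equal by (simp add: DERIV_def flat_exp_def)
next
  case greater
  have e: "((\<lambda>t. exp (- 1 / t)) has_real_derivative exp (- 1 / t) * (1 / t) ^ 2) (at t)"
    using greater by (auto intro!: derivative_eq_intros simp: power2_eq_square)
  have q: "((\<lambda>t. (1 / t) ^ n) has_real_derivative - real n * (1 / t) ^ (n + 1)) (at t)"
  proof -
    have i: "((\<lambda>t. 1 / t) has_real_derivative - ((1 / t)\<^sup>2)) (at t)"
      using greater by (auto intro!: derivative_eq_intros simp: power2_eq_square)
    show ?thesis
      by (rule DERIV_cong[OF DERIV_power[OF i]]) (cases n; simp add: power2_eq_square algebra_simps add_divide_distrib diff_divide_distrib)
  qed
  have "((\<lambda>t. exp (- 1 / t) * (1 / t) ^ n) has_real_derivative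
      flat_exp (n + 2) t - real n * flat_exp (n + 1) t) (at t)"
    by (rule DERIV_cong[OF DERIV_mult[OF e q]])
      (use greater in \<open>simp add: flat_exp_def algebra_simps power_add power2_eq_square\<close>)
  then show ?thesis
    by (rule has_field_derivative_transform_within_open[where S = "{0<..}"])
      (use greater in \<open>auto simp: flat_exp_def\<close>)
qed

lemma partial_eqI: "(f has_derivative f') (at x) \<Longrightarrow> partial i f x = f' (axis i 1)"
  unfolding partial_def using frechet_derivative_at by metis

lemma has_derivative_partial:
  fixes f :: "real^2 \<Rightarrow> real"
  assumes "f differentiable at x"
  shows "(f has_derivative (\<lambda>h. grad f x \<bullet> h)) (at x)"
proof -
  have d: "(f has_derivative frechet_derivative f (at x)) (at x)"
    using assms frechet_derivative_works by blast
  have l: "linear (frechet_derivative f (at x))" using d has_derivative_linear by blast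
  have "frechet_derivative f (at x) h = grad f x \<bullet> h" for h
  proof -
    have "frechet_derivative f (at x) h = frechet_derivative f (at x) (\<Sum>i\<in>UNIV. h $ i *\<^sub>R axis i 1)"
      using basis_expansion[of h] by (simp add: scalar_mult_eq_scaleR)
    also have "\<dots> = (\<Sum>i\<in>UNIV. h $ i * partial i f x)"
      using l by (simp add: linear_sum linear_scale partial_def)
    finally show ?thesis by (simp add: grad_def inner_vec_def mult.commute)
  qed
  then have "frechet_derivative f (at x) = (\<lambda>h. grad f x \<bullet> h)" by blast
  with d show ?thesis by simp
qed

lemma partial_const: "partial i (\<lambda>x. c) = (\<lambda>x. 0)"
  by (rule ext, subst partial_eqI[OF has_derivative_const]) simp

lemma partial_coord: "partial i (\<lambda>x. x $ j) = (\<lambda>x. axis i 1 $ j)"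
  by (rule ext, subst partial_eqI[OF bounded_linear.has_derivative[OF bounded_linear_vec_nth has_derivative_ident]]) simp

lemma partial_add:
  assumes "\<And>x. f differentiable at x" "\<And>x. g differentiable at x"
  shows "partial i (\<lambda>x. f x + g x) = (\<lambda>x. partial i f x + partial i g x)"
  by (rule ext, subst partial_eqI[OF has_derivative_add[OF has_derivative_partial[OF assms(1)] has_derivative_partial[OF assms(2)]]])
    (simp add: inner_axis grad_def)

lemma partial_mult_at:
  assumes "f differentiable at x" "g differentiable at x"
  shows "partial i (\<lambda>x. f x * g x) x = partial i f x * g x + f x * partial i g x"
  by (subst partial_eqI[OF has_derivative_mult[OF has_derivative_partial[OF assms(1)] has_derivative_partial[OF assms(2)]]])
    (simp add: inner_axis grad_def)

lemma partial_mult: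
  assumes "\<And>x. f differentiable at x" "\<And>x. g differentiable at x"
  shows "partial i (\<lambda>x. f x * g x) = (\<lambda>x. partial i f x * g x + f x * partial i g x)"
  using partial_mult_at assms by blast

lemma partial_comp:
  assumes "\<And>x. f differentiable at x" "\<And>x. (h has_real_derivative h' (f x)) (at (f x))"
  shows "partial i (\<lambda>x. h (f x)) = (\<lambda>x. h' (f x) * partial i f x)"
proof
  fix x
  have "(h has_derivative (*) (h' (f x))) (at (f x))"
    using assms(2) by (simp add: has_field_derivative_def)
  from partial_eqI[OF has_derivative_compose[OF has_derivative_partial[OF assms(1)] this], of i]
  show "partial i (\<lambda>x. h (f x)) x = h' (f x) * partial i f x"
    by (simp add: inner_axis grad_def)
qed

lemma differentiable_comp_real:
  assumes "f differentiable at x" "(h has_real_derivative h') (at (f x))"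
  shows "(\<lambda>x. h (f x)) differentiable at (x :: 'a :: real_normed_vector)"
  using assms differentiable_chain_at[of f x h] real_differentiable_def
  by (auto simp: o_def differentiable_def has_field_derivative_def)

text \<open>Partial derivatives of members are members, so that members are smooth. The composition with
\<open>flat_exp 0\<close> produces compact supports; real powers are needed for the regularised
reciprocal below.\<close>

inductive_set elementary :: "(real^2 \<Rightarrow> real) set" where
  const: "(\<lambda>x. c) \<in> elementary"
| coord: "(\<lambda>x. x $ i) \<in> elementary"
| add: "f \<in> elementary \<Longrightarrow> g \<in> elementary \<Longrightarrow> (\<lambda>x. f x + g x) \<in> elementary"
| mult: "f \<in> elementary \<Longrightarrow> g \<in> elementary \<Longrightarrow> (\<lambda>x. f x * g x) \<in> elementary"
| flat_exp: "f \<in> elementary \<Longrightarrow> (\<lambda>x. flat_exp n (f x)) \<in> elementary"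
| powr: "f \<in> elementary \<Longrightarrow> (\<And>x. 0 < f x) \<Longrightarrow> (\<lambda>x. f x powr r) \<in> elementary"

lemma powr_has_derivative: "0 < t \<Longrightarrow> ((\<lambda>t. t powr r) has_real_derivative r * t powr (r - 1)) (at t)"
  by (rule has_real_derivative_powr)

lemma elementary_differentiable: "f \<in> elementary \<Longrightarrow> f differentiable at x"
proof (induction rule: elementary.induct)
  case (flat_exp f n)
  then show ?case by (blast intro: differentiable_comp_real flat_exp_has_derivative)
next
  case (powr f r)
  then show ?case
    by (blast intro: differentiable_comp_real[where h = "\<lambda>t. t powr r"] powr_has_derivative)
next
  case (coord i)
  then show ?case 
    using bounded_linear.has_derivative[OF bounded_linear_vec_nth has_derivative_ident]
    unfolding differentiable_def by blast
qed auto

lemma partial_flat_exp: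
  assumes "\<And>x. f differentiable at x"
  shows "partial i (\<lambda>x. flat_exp n (f x)) =
    (\<lambda>x. (flat_exp (n + 2) (f x) + (- real n) * flat_exp (n + 1) (f x)) * partial i f x)"
  using partial_comp[of f "flat_exp n" "\<lambda>t. flat_exp (n + 2) t - real n * flat_exp (n + 1) t", OF assms flat_exp_has_derivative]
  by simp

lemma partial_powr:
  assumes "\<And>x. f differentiable at x" "\<And>x. 0 < f x"
  shows "partial i (\<lambda>x. f x powr r) = (\<lambda>x. (r * f x powr (r - 1)) * partial i f x)"
  using partial_comp[of f "\<lambda>t. t powr r" "\<lambda>t. r * t powr (r - 1)", OF assms(1) powr_has_derivative[OF assms(2)]]
  by simp

lemma elementary_partial: "f \<in> elementary \<Longrightarrow> partial i f \<in> elementary"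
proof (induction rule: elementary.induct)
  case (const c) show ?case by (simp add: partial_const elementary.const)
next
  case (coord j) show ?case by (simp add: partial_coord elementary.const)
next
  case (add f g) then show ?case
    by (simp add: partial_add elementary_differentiable elementary.add)
next
  case (mult f g) then show ?case
    by (simp add: partial_mult elementary_differentiable elementary.add elementary.mult)
next
  case (flat_exp f n) then show ?case
    unfolding partial_flat_exp[OF elementary_differentiable[OF flat_exp.hyps]]
    by (intro elementary.intros)
next
  case (powr f r) then show ?case
    unfolding partial_powr[OF elementary_differentiable[OF powr.hyps(1)] powr.hyps(2)]
    by (intro elementary.intros)
qed

text \<open>Equality of mixed derivatives is what makes the quarter turn of a gradient divergence free. By
structural induction it reduces to the product rule and the chain rule.\<close>

lemma elementary_partial_commute: "f \<in> elementary \<Longrightarrow> partial i (partial j f) = partial j (partial i f)"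
proof (induction rule: elementary.induct)
  case (const c) show ?case by (simp add: partial_const)
next
  case (coord j) show ?case by (simp add: partial_coord partial_const)
next
  case (add f g) then show ?case
    by (simp add: partial_add elementary_differentiable elementary_partial)
next
  case (mult f g) 
  then show ?case
    by (simp add: partial_add partial_mult elementary_differentiable elementary_partial elementary.mult ac_simps)
next
  case (flat_exp f n)
  let ?h = "\<lambda>x. flat_exp (n + 2) (f x) + (- real n) * flat_exp (n + 1) (f x)"
  have h: "?h \<in> elementary" using flat_exp.hyps by (intro elementary.intros)
  have *: "partial k (\<lambda>x. flat_exp n (f x)) = (\<lambda>x. ?h x * partial k f x)" for k
    using partial_flat_exp[OF elementary_differentiable[OF flat_exp.hyps]] by blast
  have h': "partial k ?h = (\<lambda>x. ((flat_exp (n + 4) (f x) - real (n + 2) * flat_exp (n + 3) (f x))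
      + (- real n) * (flat_exp (n + 3) (f x) - real (n + 1) * flat_exp (n + 2) (f x))) * partial k f x)" for k
    by (subst partial_comp[where f = f and h = "\<lambda>t. flat_exp (n + 2) t + (- real n) * flat_exp (n + 1) t"
          and h' = "\<lambda>t. (flat_exp (n + 4) t - real (n + 2) * flat_exp (n + 3) t)
      + (- real n) * (flat_exp (n + 3) t - real (n + 1) * flat_exp (n + 2) t)"])
     (use flat_exp_has_derivative[of "n+2"] flat_exp_has_derivative[of "n+1"] in \<open>auto intro!: derivative_eq_intros elementary_differentiable flat_exp.hyps simp: eval_nat_numeral\<close>)
  show ?case unfolding *
    unfolding partial_mult[OF elementary_differentiable[OF h] elementary_differentiable[OF elementary_partial[OF flat_exp.hyps]]] h'
    by (rule ext) (simp add: flat_exp.IH ac_simps)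
next
  case (powr f r)
  let ?h = "\<lambda>x. r * f x powr (r - 1)"
  have h: "?h \<in> elementary" using powr.hyps by (intro elementary.intros)
  have g: "(\<lambda>x. f x powr (r - 1)) \<in> elementary" using powr.hyps by (intro elementary.intros)
  have *: "partial k (\<lambda>x. f x powr r) = (\<lambda>x. ?h x * partial k f x)" for k
    using partial_powr[OF elementary_differentiable[OF powr.hyps(1)] powr.hyps(2)] by blast
  have h': "partial k ?h = (\<lambda>x. r * ((r - 1) * f x powr (r - 1 - 1) * partial k f x))" for k
    by (subst partial_mult)
      (auto intro: elementary_differentiable[OF g] simp: partial_const partial_powr[OF elementary_differentiable[OF powr.hyps(1)] powr.hyps(2)])
  show ?case unfolding *
    unfolding partial_mult[OF elementary_differentiable[OF h] elementary_differentiable[OF elementary_partial[OF powr.hyps(1)]]] h' 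
    by (rule ext) (simp add: powr.IH ac_simps)
qed

lemma elementary_foldr_partial: "f \<in> elementary \<Longrightarrow> foldr partial is f \<in> elementary"
  by (induction "is") (auto intro: elementary_partial)

lemma elementary_smooth: "f \<in> elementary \<Longrightarrow> smooth f"
  unfolding smooth_def using elementary_foldr_partial elementary_differentiable by blast

lemma elementary_uminus: "f \<in> elementary \<Longrightarrow> (\<lambda>x. - f x) \<in> elementary"
  using elementary.mult[OF elementary.const[of "-1"], of f] by simp

lemma elementary_diff: "f \<in> elementary \<Longrightarrow> g \<in> elementary \<Longrightarrow> (\<lambda>x. f x - g x) \<in> elementary"
  using elementary.add[OF _ elementary_uminus, of f g] by simp

lemma elementary_power: "f \<in> elementary \<Longrightarrow> (\<lambda>x. f x ^ n) \<in> elementary"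
  by (induction n) (auto intro: elementary.intros)

section \<open>Weak gradients of differentiable functions\<close>

lemma lborel_integral_translate:
  fixes f :: "'a::euclidean_space \<Rightarrow> real"
  assumes [measurable]: "f \<in> borel_measurable borel"
  shows "(LINT x|lborel. f (x + h)) = (LINT x|lborel. f x)"
proof -
  have "(LINT x|lborel. f x) = (LINT x|distr lborel borel ((+) h). f x)"
    by (simp add: lborel_distr_plus)
  also have "\<dots> = (LINT x|lborel. f (h + x))"
    by (rule integral_distr) auto
  finally show ?thesis by (simp add: add.commute)
qed

lemma partial_has_line_derivative:
  assumes "f differentiable at (x + t *\<^sub>R axis i 1)"
  shows "((\<lambda>t. f (x + t *\<^sub>R axis i 1)) has_real_derivative
    partial i f (x + t *\<^sub>R axis i 1)) (at t)"
proof -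
  have "((\<lambda>t. x + t *\<^sub>R axis i 1) has_derivative (\<lambda>h. h *\<^sub>R axis i 1)) (at t)"
    by (auto intro!: derivative_eq_intros)
  from has_derivative_compose[OF this has_derivative_partial[OF assms]]
  show ?thesis
    by (simp add: has_field_derivative_def grad_def inner_axis mult.commute[of _ "partial i f _"] fun_eq_iff)
qed

text \<open>A partial derivative is a bounded limit of difference quotients with supports in a fixed compact
set, and a difference quotient has integral zero by translation invariance.\<close>

lemma integral_partial_zero:
  fixes f :: "real^2 \<Rightarrow> real"
  assumes diff: "\<And>x. f differentiable at x" and B: "\<And>x. \<bar>partial i f x\<bar> \<le> B"
    and K: "compact K" "\<And>x. x \<notin> K \<Longrightarrow> f x = 0"
  shows "integrable lborel (partial i f)" "(LINT x|lborel. partial i f x) = 0"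
proof -
  let ?e = "axis i 1 :: real^2"
  obtain R where R: "\<And>x. x \<in> K \<Longrightarrow> norm x \<le> R"
    using compact_imp_bounded[OF K(1)] by (auto simp: bounded_iff)
  have cont: "continuous_on A f" for A
    using diff differentiable_imp_continuous_on differentiable_at_imp_differentiable_on by blast
  then have [measurable]: "f \<in> borel_measurable borel"
    by (intro borel_measurable_continuous_onI)
  have int_f: "integrable lborel f"
  proof -
    have "integrable lborel (\<lambda>x. indicator K x *\<^sub>R f x)"
      by (rule borel_integrable_compact[OF K(1) cont])
    also have "(\<lambda>x. indicator K x *\<^sub>R f x) = f" using K(2) by (auto simp: indicator_def fun_eq_iff)
    finally show ?thesis .
  qed
  have int_fh: "integrable lborel (\<lambda>x. f (x + h))" for h
  proof -
    have "integrable (distr lborel borel ((+) h)) f" using int_f by (simp add: lborel_distr_plus)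
    then have "integrable lborel (\<lambda>x. f (h + x))" by (subst (asm) integrable_distr_eq) auto
    then show ?thesis by (simp add: add.commute)
  qed
  have lip: "\<bar>f (x + t *\<^sub>R ?e) - f x\<bar> \<le> B * t" if "t > 0" for x t
  proof -
    have "\<exists>z>0. z < t \<and> f (x + t *\<^sub>R ?e) - f (x + 0 *\<^sub>R ?e) = (t - 0) * partial i f (x + z *\<^sub>R ?e)"
      by (rule MVT2[OF that, of "\<lambda>t. f (x + t *\<^sub>R ?e)" "\<lambda>t. partial i f (x + t *\<^sub>R ?e)"])
        (rule partial_has_line_derivative[OF diff])
    then obtain z where "f (x + t *\<^sub>R ?e) - f (x + 0 *\<^sub>R ?e) = (t - 0) * partial i f (x + z *\<^sub>R ?e)"
      by blast
    then show ?thesis using B[of "x + z *\<^sub>R ?e"] that by (simp add: abs_mult)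
  qed
  define s where "s n x = real (Suc n) * (f (x + (1 / real (Suc n)) *\<^sub>R ?e) - f x)" for n x
  have [measurable]: "s n \<in> borel_measurable lborel" for n unfolding s_def by measurable
  have lim: "(\<lambda>n. s n x) \<longlonglongrightarrow> partial i f x" for x
  proof -
    have "((\<lambda>t. f (x + t *\<^sub>R ?e)) has_real_derivative partial i f x) (at 0)"
      using partial_has_line_derivative[of f x 0 i] diff by simp
    then have "((\<lambda>h. (f (x + h *\<^sub>R ?e) - f x) / h) \<longlongrightarrow> partial i f x) (at 0)"
      by (simp add: DERIV_def)
    moreover have "filterlim (\<lambda>n. 1 / real (Suc n)) (at 0) sequentially"
      using LIMSEQ_Suc[OF lim_1_over_n[where 'a = real]] by (simp add: filterlim_at)
    ultimately have "(\<lambda>n. (f (x + (1 / real (Suc n)) *\<^sub>R ?e) - f x) / (1 / real (Suc n))) \<longlonglongrightarrow> partial i f x"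
      by (rule filterlim_compose)
    then show ?thesis by (simp add: s_def mult.commute)
  qed
  then have [measurable]: "partial i f \<in> borel_measurable lborel"
    by (rule borel_measurable_LIMSEQ_real) auto
  have w: "integrable lborel (\<lambda>x. indicator (cball (0::real^2) (R + 1)) x *\<^sub>R B)"
    by (rule borel_integrable_compact) auto
  have bound: "norm (s n x) \<le> indicator (cball (0::real^2) (R + 1)) x *\<^sub>R B" for n x
  proof (cases "x \<in> cball 0 (R + 1)")
    case True
    have "norm (s n x) \<le> real (Suc n) * (B * (1 / real (Suc n)))"
      unfolding s_def real_norm_def abs_mult using lip[of "1 / real (Suc n)" x]
      by (intro mult_mono) auto
    then show ?thesis using True by simp
  next
    case False
    have h1: "norm ((1 / real (Suc n)) *\<^sub>R ?e) \<le> 1" by (simp add: divide_le_eq)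
    have "norm x \<le> norm (x + (1 / real (Suc n)) *\<^sub>R ?e) + norm ((1 / real (Suc n)) *\<^sub>R ?e)"
      using norm_triangle_ineq4[of "x + (1 / real (Suc n)) *\<^sub>R ?e" "(1 / real (Suc n)) *\<^sub>R ?e"] by simp
    then have "norm (x + (1 / real (Suc n)) *\<^sub>R ?e) > R" "norm x > R"
      using False h1 by (auto simp del: norm_scaleR)
    then have "x + (1 / real (Suc n)) *\<^sub>R ?e \<notin> K" "x \<notin> K" using R by (meson not_less)+
    then have "s n x = 0" using K(2) unfolding s_def by simp
    then show ?thesis using False by simp
  qed
  show int: "integrable lborel (partial i f)"
    by (rule integrable_dominated_convergence[where s = s, OF _ _ w]) (use lim bound in auto)
  have "(\<lambda>n. LINT x|lborel. s n x) \<longlonglongrightarrow> (LINT x|lborel. partial i f x)"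
    by (rule integral_dominated_convergence[OF _ _ w]) (use lim bound in auto)
  moreover have "(LINT x|lborel. s n x) = 0" for n
    unfolding s_def using int_f int_fh lborel_integral_translate[of f] by simp
  ultimately show "(LINT x|lborel. partial i f x) = 0"
    by (simp add: LIMSEQ_const_iff)
qed

lemma test_fun_differentiable: "\<phi> \<in> test_fun \<Omega> \<Longrightarrow> \<phi> differentiable at x"
  
  using foldr.simps(1)[of partial] unfolding test_fun_def smooth_def by (simp, metis foldr.simps(1) id_apply)

lemma differentiable_continuous: 
  "(\<And>x. f differentiable at x) \<Longrightarrow> continuous_on A (f :: 'a::real_normed_vector \<Rightarrow> 'b::real_normed_vector)"
  using differentiable_imp_continuous_on differentiable_at_imp_differentiable_on by blast

lemma partial_outside_support:
  assumes "x \<notin> closure {x. f x \<noteq> 0}"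
  shows "partial i f x = 0"
proof -
  have "((\<lambda>x. 0) has_derivative (\<lambda>x. 0)) (at x)" by simp
  then have "(f has_derivative (\<lambda>x. 0)) (at x)"
    by (rule has_derivative_transform_within_open[where s = "- closure {x. f x \<noteq> 0}"])
      (use assms closure_subset[of "{x. f x \<noteq> 0}"] in auto)
  then show ?thesis by (rule partial_eqI)
qed

lemma partial_test_fun:
  assumes "\<phi> \<in> test_fun \<Omega>"
  shows "partial i \<phi> \<in> test_fun \<Omega>"
proof -
  have s: "closure {x. partial i \<phi> x \<noteq> 0} \<subseteq> closure {x. \<phi> x \<noteq> 0}"
    by (rule closure_minimal) (use partial_outside_support in blast)+
  have "foldr partial is (partial i \<phi>) = foldr partial (is @ [i]) \<phi>" for "is" by simp
  moreover have "smooth \<phi>" using assms by (simp add: test_fun_def)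
  ultimately have "smooth (partial i \<phi>)" unfolding smooth_def by metis
  moreover have "compact (closure {x. partial i \<phi> x \<noteq> 0})"
    using compact_Int_closed[of "closure {x. \<phi> x \<noteq> 0}" "closure {x. partial i \<phi> x \<noteq> 0}"] s assms
    by (simp add: test_fun_def Int_absorb1)
  ultimately show ?thesis using s assms by (auto simp: test_fun_def)
qed

lemma test_fun_continuous: "\<phi> \<in> test_fun \<Omega> \<Longrightarrow> continuous_on A \<phi>"
  by (intro differentiable_continuous test_fun_differentiable)

lemma test_fun_support:
  assumes "\<phi> \<in> test_fun \<Omega>"
  shows "\<exists>K. compact K \<and> K \<subseteq> \<Omega> \<and> (\<forall>x. x \<notin> K \<longrightarrow> \<phi> x = 0) \<and> (\<forall>i x. x \<notin> K \<longrightarrow> partial i \<phi> x = 0)"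
proof (intro exI conjI allI impI)
  show "\<phi> x = 0" if "x \<notin> closure {x. \<phi> x \<noteq> 0}" for x
    using that closure_subset[of "{x. \<phi> x \<noteq> 0}"] by auto
  show "partial i \<phi> x = 0" if "x \<notin> closure {x. \<phi> x \<noteq> 0}" for i x
    using that by (rule partial_outside_support)
qed (use assms in \<open>simp_all add: test_fun_def\<close>)

lemma test_fun_mono: "\<phi> \<in> test_fun A \<Longrightarrow> A \<subseteq> B \<Longrightarrow> \<phi> \<in> test_fun B"
  by (auto simp: test_fun_def)

lemma compact_support_bounded:
  fixes f :: "'a::metric_space \<Rightarrow> real"
  assumes "compact K" "continuous_on K f" "\<And>x. x \<notin> K \<Longrightarrow> f x = 0"
  obtains B where "\<And>x. \<bar>f x\<bar> \<le> B" "B \<ge> 0"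
proof -
  obtain B where B: "\<And>x. x \<in> K \<Longrightarrow> \<bar>f x\<bar> \<le> B"
    using compact_imp_bounded[OF compact_continuous_image[OF assms(2,1)]] by (auto simp: bounded_iff)
  have "\<bar>f x\<bar> \<le> max B 0" for x using B[of x] assms(3)[of x] by (cases "x \<in> K") auto
  then show ?thesis by (rule that) auto
qed

lemma test_fun_bounded:
  assumes "\<phi> \<in> test_fun \<Omega>"
  obtains B where "\<And>x. \<bar>\<phi> x\<bar> \<le> B" "B \<ge> 0"
proof -
  obtain K where K: "compact K" "\<And>x. x \<notin> K \<Longrightarrow> \<phi> x = 0"
    using test_fun_support[OF assms] by blast
  show ?thesis
    using compact_support_bounded[OF K(1) test_fun_continuous[OF assms] K(2)] that by blast
qed

lemma test_fun_measurable [measurable]: "\<phi> \<in> test_fun \<Omega> \<Longrightarrow> \<phi> \<in> borel_measurable borel"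
  by (intro borel_measurable_continuous_onI test_fun_continuous)

lemma continuous_loc_integrable:
  fixes f :: "real^2 \<Rightarrow> 'b::euclidean_space"
  assumes "continuous_on \<Omega> f"
  shows "loc_integrable \<Omega> f"
  unfolding loc_integrable_def set_integrable_def
  using borel_integrable_compact[OF _ continuous_on_subset[OF assms]] by blast

text \<open>Integration by parts: the product of \<open>u\<close> with a test function extends by zero to a
differentiable function on the plane, and the integrals of its partial derivatives vanish.\<close>

lemma has_weak_gradient_C1:
  assumes "open \<Omega>" and d: "\<And>x. x \<in> \<Omega> \<Longrightarrow> u differentiable at x" and c: "continuous_on \<Omega> (grad u)"
  shows "has_weak_gradient \<Omega> u (grad u)"
  unfolding has_weak_gradient_def
proof (intro conjI ballI allI)
  have cu: "continuous_on \<Omega> u"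
    using d differentiable_imp_continuous_on differentiable_at_imp_differentiable_on by blast
  show "loc_integrable \<Omega> u" "loc_integrable \<Omega> (grad u)"
    using cu c continuous_loc_integrable by auto
  fix \<phi> i assume \<phi>: "\<phi> \<in> test_fun \<Omega>"
  obtain K where K: "compact K" "K \<subseteq> \<Omega>" "\<And>x. x \<notin> K \<Longrightarrow> \<phi> x = 0" "\<And>i x. x \<notin> K \<Longrightarrow> partial i \<phi> x = 0"
    using test_fun_support[OF \<phi>] by blast
  define F where "F x = u x * \<phi> x" for x
  define p where "p x = grad u x $ i * \<phi> x" for x
  define q where "q x = u x * partial i \<phi> x" for x
  have cp: "continuous_on K p"
    unfolding p_def
    by (intro continuous_on_mult continuous_on_component continuous_on_subset[OF c K(2)] test_fun_continuous[OF \<phi>])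
  have cq: "continuous_on K q"
    unfolding q_def
    by (intro continuous_on_mult continuous_on_subset[OF cu K(2)] test_fun_continuous[OF partial_test_fun[OF \<phi>]])
  have F: "F differentiable at x \<and> partial i F x = p x + q x" for x
  proof (cases "x \<in> K")
    case True
    then have x: "x \<in> \<Omega>" using K by auto
    show ?thesis using partial_mult_at[OF d[OF x] test_fun_differentiable[OF \<phi>], of i] d[OF x] test_fun_differentiable[OF \<phi>]
      unfolding F_def[abs_def] p_def q_def grad_def by auto
  next
    case False
    have "((\<lambda>x. 0) has_derivative (\<lambda>x. 0)) (at x)" by simp
    then have *: "(F has_derivative (\<lambda>x. 0)) (at x)"
      by (rule has_derivative_transform_within_open[where s = "- K"])
        (use False K compact_imp_closed[OF K(1)] in \<open>auto simp: F_def\<close>)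
    then show ?thesis using partial_eqI[OF *] K(3,4)[OF False] 
      by (auto simp: differentiable_def p_def q_def)
  qed
  have "p x + q x = 0" if "x \<notin> K" for x using K(3,4)[OF that] by (simp add: p_def q_def)
  then obtain B where B: "\<And>x. \<bar>p x + q x\<bar> \<le> B"
    using compact_support_bounded[OF K(1) continuous_on_add[OF cp cq]] by blast
  have z: "(LINT x|lborel. partial i F x) = 0"
    by (rule integral_partial_zero(2)[where K = K]) (use F B K in \<open>auto simp: F_def\<close>)
  have pz: "(\<lambda>x. indicator K x *\<^sub>R p x) = p" "(\<lambda>x. indicator K x *\<^sub>R q x) = q"
    using K by (auto simp: fun_eq_iff indicator_def p_def q_def)
  have ip: "integrable lborel p" and iq: "integrable lborel q"
    using borel_integrable_compact[OF K(1) cp] borel_integrable_compact[OF K(1) cq] pz by auto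
  have "(LINT x|lborel. p x) + (LINT x|lborel. q x) = 0"
  proof -
    have "partial i F = (\<lambda>x. p x + q x)" using F by blast
    then show ?thesis using z Bochner_Integration.integral_add[OF ip iq] by simp
  qed
  moreover have "(\<lambda>x. indicator \<Omega> x *\<^sub>R p x) = p" "(\<lambda>x. indicator \<Omega> x *\<^sub>R q x) = q"
    using K by (auto simp: fun_eq_iff indicator_def p_def q_def)
  ultimately show "(LINT x:\<Omega>|lborel. u x * partial i \<phi> x) = - (LINT x:\<Omega>|lborel. grad u x $ i * \<phi> x)"
    unfolding set_lebesgue_integral_def p_def[symmetric] q_def[symmetric] by simp
qed

lemma test_fun_has_weak_gradient:
  assumes "\<phi> \<in> test_fun \<Omega>'" "open \<Omega>"
  shows "has_weak_gradient \<Omega> \<phi> (grad \<phi>)"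
proof (rule has_weak_gradient_C1[OF assms(2) test_fun_differentiable[OF assms(1)]])
  show "continuous_on \<Omega> (grad \<phi>)"
    unfolding grad_def
    by (intro continuous_on_vec_lambda test_fun_continuous[OF partial_test_fun[OF assms(1)]])
qed

section \<open>Uniqueness of weak gradients\<close>

text \<open>If \<open>a\<close> is below \<open>b\<close> in both coordinates, this is positive exactly on the open box.\<close>

definition bump :: "real^2 \<Rightarrow> real^2 \<Rightarrow> real^2 \<Rightarrow> real" where
  "bump a b x = flat_exp 0 ((x $ 1 - a $ 1) * (b $ 1 - x $ 1)) * flat_exp 0 ((x $ 2 - a $ 2) * (b $ 2 - x $ 2))"

lemma bump_elementary: "bump a b \<in> elementary"
  unfolding bump_def[abs_def] by (intro elementary.intros elementary_diff)

lemma bump_bounds: "0 \<le> bump a b x" "bump a b x \<le> 1"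
proof -
  have "flat_exp 0 t \<le> 1" for t by (simp add: flat_exp_def)
  then show "bump a b x \<le> 1" "0 \<le> bump a b x"
    unfolding bump_def by (auto intro!: mult_le_one flat_exp_nonneg mult_nonneg_nonneg)
qed

lemma bump_pos: "x \<in> box a b \<Longrightarrow> 0 < bump a b x"
  by (auto simp: bump_def flat_exp_def mem_box_cart forall_2)

lemma bump_zero:
  assumes "a $ 1 < b $ 1" "a $ 2 < b $ 2" "x \<notin> box a b"
  shows "bump a b x = 0"
proof -
  have "\<not> 0 < (s - l) * (u - s)" if "l < u" "\<not> (l < s \<and> s < u)" for s l u :: real
    using that by (auto simp: zero_less_mult_iff)
  then show ?thesis using assms by (auto simp: bump_def flat_exp_def mem_box_cart forall_2)
qed

text \<open>As \<open>k\<close> grows this increases to the indicator function of the open box.\<close>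

definition box_approx :: "nat \<Rightarrow> real^2 \<Rightarrow> real^2 \<Rightarrow> real^2 \<Rightarrow> real" where
  "box_approx k a b x = 1 - (1 - bump a b x) ^ k"

lemma box_approx_test_fun:
  assumes "a $ 1 < b $ 1" "a $ 2 < b $ 2" "cbox a b \<subseteq> \<Omega>"
  shows "box_approx k a b \<in> test_fun \<Omega>"
proof -
  have "box_approx k a b \<in> elementary"
    unfolding box_approx_def[abs_def] by (intro elementary_diff elementary_power bump_elementary elementary.intros)
  moreover have "{x. box_approx k a b x \<noteq> 0} \<subseteq> cbox a b"
    using bump_zero[OF assms(1,2)] box_subset_cbox by (fastforce simp: box_approx_def)
  then have s: "closure {x. box_approx k a b x \<noteq> 0} \<subseteq> cbox a b"
    by (rule closure_minimal) auto
  moreover have "compact (closure {x. box_approx k a b x \<noteq> 0})"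
    using compact_Int_closed[OF compact_cbox closed_closure] s by (metis Int_absorb1)
  ultimately show ?thesis using assms(3) by (auto simp: test_fun_def intro: elementary_smooth)
qed

lemma box_approx_bounds: "0 \<le> box_approx k a b x" "box_approx k a b x \<le> 1"
  using bump_bounds[of a b x] by (auto simp: box_approx_def power_le_one)

lemma box_approx_tendsto:
  assumes "a $ 1 < b $ 1" "a $ 2 < b $ 2"
  shows "(\<lambda>k. box_approx k a b x) \<longlonglongrightarrow> indicator (box a b) x"
proof (cases "x \<in> box a b")
  case True
  have "(\<lambda>k. (1 - bump a b x) ^ k) \<longlonglongrightarrow> 0"
    by (rule LIMSEQ_power_zero) (use bump_pos[OF True] bump_bounds[of a b x] in auto)
  from tendsto_diff[OF tendsto_const this, of 1] show ?thesis using True by (simp add: box_approx_def)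
next
  case False
  then show ?thesis using bump_zero[OF assms] by (simp add: box_approx_def)
qed

lemma loc_integrable_mult_compact_support:
  fixes f :: "real^2 \<Rightarrow> real"
  assumes f: "loc_integrable \<Omega> f" and K: "compact K" "K \<subseteq> \<Omega>"
    and h: "continuous_on UNIV h" "\<And>x. x \<notin> K \<Longrightarrow> h x = 0"
  shows "set_integrable lborel \<Omega> (\<lambda>x. f x * h x)"
    "(LINT x:\<Omega>|lborel. f x * h x) = (LINT x:K|lborel. f x * h x)"
proof -
  have eq: "indicator \<Omega> x *\<^sub>R (f x * h x) = indicator K x *\<^sub>R (f x * h x)" for x
    using K h(2)[of x] by (auto simp: indicator_def)
  obtain B where B: "\<And>x. \<bar>h x\<bar> \<le> B" "B \<ge> 0"
    using compact_support_bounded[OF K(1) continuous_on_subset[OF h(1)]] h(2) by (metis subset_UNIV)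
  have fK: "integrable lborel (\<lambda>x. indicator K x *\<^sub>R f x)"
    using f K by (auto simp: loc_integrable_def set_integrable_def)
  then have [measurable]: "(\<lambda>x. indicator K x *\<^sub>R f x) \<in> borel_measurable lborel" by simp
  have [measurable]: "h \<in> borel_measurable lborel"
    using borel_measurable_continuous_onI[OF h(1)] by simp
  have "integrable lborel (\<lambda>x. (indicator K x *\<^sub>R f x) * h x)"
  proof (rule Bochner_Integration.integrable_bound[OF integrable_mult_right[OF fK, of B]])
    show "AE x in lborel. norm (indicator K x *\<^sub>R f x * h x) \<le> norm (B * (indicator K x *\<^sub>R f x))"
      using B by (auto simp: abs_mult mult.commute[of B] intro!: mult_left_mono)
  qed measurable
  then show "set_integrable lborel \<Omega> (\<lambda>x. f x * h x)"
    unfolding set_integrable_def eq by (simp add: mult.assoc)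
  show "(LINT x:\<Omega>|lborel. f x * h x) = (LINT x:K|lborel. f x * h x)"
    unfolding set_lebesgue_integral_def eq ..
qed

lemma loc_integrable_mult_test:
  fixes f :: "real^2 \<Rightarrow> real"
  assumes f: "loc_integrable \<Omega> f" and \<phi>: "\<phi> \<in> test_fun \<Omega>"
  shows "set_integrable lborel \<Omega> (\<lambda>x. f x * \<phi> x)"
proof -
  obtain K where K: "compact K" "K \<subseteq> \<Omega>" "\<And>x. x \<notin> K \<Longrightarrow> \<phi> x = 0"
    using test_fun_support[OF \<phi>] by blast
  show ?thesis
    by (rule loc_integrable_mult_compact_support(1)[OF f K(1,2) test_fun_continuous[OF \<phi>] K(3)])
qed

text \<open>Dominated convergence in the identity for the test functions \<open>box_approx k a b\<close>.\<close>

lemma box_integral_zero: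
  fixes g :: "real^2 \<Rightarrow> real"
  assumes g: "loc_integrable \<Omega> g"
    and z: "\<And>\<phi>. \<phi> \<in> test_fun \<Omega> \<Longrightarrow> (LINT x:\<Omega>|lborel. g x * \<phi> x) = 0"
    and sub: "cbox a b \<subseteq> \<Omega>"
  shows "(LINT x:box a b|lborel. g x) = 0"
proof (cases "a $ 1 < b $ 1 \<and> a $ 2 < b $ 2")
  case False
  then have "box a b = {}" by (auto simp: set_eq_iff mem_box_cart forall_2)
  then show ?thesis by (simp add: set_lebesgue_integral_def)
next
  case True
  then have ab: "a $ 1 < b $ 1" "a $ 2 < b $ 2" by auto
  have gi: "integrable lborel (\<lambda>x. indicator (cbox a b) x *\<^sub>R g x)"
    using g sub by (auto simp: loc_integrable_def set_integrable_def)
  then have [measurable]: "(\<lambda>x. indicator (cbox a b) x *\<^sub>R g x) \<in> borel_measurable lborel" by simp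
  have outside: "box_approx k a b x = 0" if "x \<notin> cbox a b" for k x
  proof -
    have "x \<notin> box a b" using that box_subset_cbox[of a b] by blast
    then show ?thesis using bump_zero[OF ab] by (simp add: box_approx_def)
  qed
  have [measurable]: "box_approx k a b \<in> borel_measurable lborel" for k
    using test_fun_measurable[OF box_approx_test_fun[OF ab sub]] by simp
  let ?s = "\<lambda>k x. (indicator (cbox a b) x *\<^sub>R g x) * box_approx k a b x"
  have "(\<lambda>k. LINT x|lborel. ?s k x) \<longlonglongrightarrow> (LINT x|lborel. (indicator (cbox a b) x *\<^sub>R g x) * indicator (box a b) x)"
  proof (rule integral_dominated_convergence[where w = "\<lambda>x. norm (indicator (cbox a b) x *\<^sub>R g x)"])
    show "integrable lborel (\<lambda>x. norm (indicator (cbox a b) x *\<^sub>R g x))" using gi by (rule integrable_norm)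
    show "AE x in lborel. (\<lambda>k. ?s k x) \<longlonglongrightarrow> (indicator (cbox a b) x *\<^sub>R g x) * indicator (box a b) x"
      by (intro AE_I2 tendsto_intros box_approx_tendsto ab)
    show "AE x in lborel. norm (?s k x) \<le> norm (indicator (cbox a b) x *\<^sub>R g x)" for k
      using box_approx_bounds[of k a b] by (auto simp: abs_mult intro!: mult_left_le)
  qed measurable
  moreover have "(LINT x|lborel. ?s k x) = (LINT x:\<Omega>|lborel. g x * box_approx k a b x)" for k
    unfolding set_lebesgue_integral_def
    by (rule Bochner_Integration.integral_cong) (use outside sub in \<open>auto simp: indicator_def\<close>)
  moreover have "(LINT x|lborel. (indicator (cbox a b) x *\<^sub>R g x) * indicator (box a b) x) = (LINT x:box a b|lborel. g x)"
    unfolding set_lebesgue_integral_def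
    by (rule Bochner_Integration.integral_cong) (use box_subset_cbox[of a b] in \<open>auto simp: indicator_def\<close>)
  ultimately show ?thesis
    using z[OF box_approx_test_fun[OF ab sub]] by (simp add: LIMSEQ_const_iff)
qed

lemma box_Int_box_cart:
  fixes a b c d :: "real^2"
  shows "box a b \<inter> box c d = box (\<chi> i. max (a $ i) (c $ i)) (\<chi> i. min (b $ i) (d $ i))"
  by (auto simp: mem_box_cart)

text \<open>Open boxes are stable under intersection and generate the Borel sets, so that all integrals of
\<open>f\<close> over Borel sets vanish.\<close>

lemma integrable_zero_of_boxes:
  fixes f :: "real^2 \<Rightarrow> real"
  assumes f: "integrable lborel f" and total: "(LINT x|lborel. f x) = 0"
    and z: "\<And>a b. (LINT x:box a b|lborel. f x) = 0"
  shows "AE x in lborel. f x = 0"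
proof (rule sigma_finite_measure.density_zero[OF sigma_finite_lborel f])
  fix A :: "(real^2) set" assume "A \<in> sets lborel"
  let ?G = "range (\<lambda>(a, b). box a b) :: (real^2) set set"
  have fi: "set_integrable lborel B f" if "B \<in> sets lborel" for B
    using set_integrable_subset[of lborel UNIV f B] f that by (simp add: set_integrable_def)
  have A: "A \<in> sigma_sets UNIV ?G"
    using \<open>A \<in> sets lborel\<close> by (simp add: borel_eq_box)
  have G: "Int_stable ?G"
  proof (rule Int_stableI)
    fix A B assume "A \<in> ?G" "B \<in> ?G"
    then obtain a b c d where "A = box a b" "B = box c d" by auto
    then show "A \<inter> B \<in> ?G" using box_Int_box_cart[of a b c d] by auto
  qed
  have "?G \<subseteq> Pow UNIV" by simp
  from G this A show "set_lebesgue_integral lborel A f = 0"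
  proof (induction rule: sigma_sets_induct_disjoint)
    case (basic A) then show ?case using z by auto
  next
    case empty show ?case by (simp add: set_lebesgue_integral_def)
  next
    case (compl A)
    then have mA: "A \<in> sets borel" by (simp add: borel_eq_box)
    have "(LINT x:A \<union> (UNIV - A)|lborel. f x) = (LINT x:A|lborel. f x) + (LINT x:(UNIV - A)|lborel. f x)"
      by (intro set_integral_Un fi) (use mA in auto)
    moreover have "A \<union> (UNIV - A) = UNIV" by auto
    ultimately show ?case using compl total by (simp add: set_lebesgue_integral_def)
  next
    case (union A)
    then have mA: "A i \<in> sets borel" for i by (auto simp: borel_eq_box)
    have "(LINT x:(\<Union>i. A i)|lborel. f x) = (\<Sum>i. (LINT x:(A i)|lborel. f x))"
      by (rule lebesgue_integral_countable_add) (use union mA in \<open>auto simp: disjoint_family_on_def intro!: fi\<close>)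
    then show ?case using union by simp
  qed
qed

text \<open>By the Lindelof property countably many open boxes with closure in \<open>\<Omega>\<close> cover \<open>\<Omega>\<close>; on each
of them all integrals over smaller boxes vanish.\<close>

lemma fundamental_lemma:
  fixes g :: "real^2 \<Rightarrow> real"
  assumes "open \<Omega>" and g: "loc_integrable \<Omega> g"
    and z: "\<And>\<phi>. \<phi> \<in> test_fun \<Omega> \<Longrightarrow> (LINT x:\<Omega>|lborel. g x * \<phi> x) = 0"
  shows "AE x in lborel. x \<in> \<Omega> \<longrightarrow> g x = 0"
proof -
  have loc: "AE x in lborel. x \<in> box c d \<longrightarrow> g x = 0" if "cbox c d \<subseteq> \<Omega>" for c d
  proof -
    define f where "f x = indicator (box c d) x *\<^sub>R g x" for x
    have "integrable lborel (\<lambda>x. indicator (cbox c d) x *\<^sub>R g x)"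
      using g that by (auto simp: loc_integrable_def set_integrable_def)
    then have "integrable lborel (\<lambda>x. indicator (box c d) x *\<^sub>R (indicator (cbox c d) x *\<^sub>R g x))"
      by (rule integrable_mult_indicator[rotated]) simp
    moreover have "(\<lambda>x. indicator (box c d) x *\<^sub>R (indicator (cbox c d) x *\<^sub>R g x)) = f"
      using box_subset_cbox[of c d] by (auto simp: f_def indicator_def fun_eq_iff)
    ultimately have f: "integrable lborel f" by (simp only:)
    have "(LINT x:box a b|lborel. f x) = 0" for a b
    proof -
      let ?a = "(\<chi> i. max (a $ i) (c $ i)) :: real^2" and ?b = "(\<chi> i. min (b $ i) (d $ i)) :: real^2"
      have "(LINT x:box a b|lborel. f x) = (LINT x:box ?a ?b|lborel. g x)"
        unfolding set_lebesgue_integral_def f_def box_Int_box_cart[symmetric]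
        by (rule Bochner_Integration.integral_cong) (auto simp: indicator_def)
      also have "\<dots> = 0"
      proof (rule box_integral_zero[OF g z])
        have "cbox ?a ?b \<subseteq> cbox c d" by (auto simp: mem_box_cart)
        with that show "cbox ?a ?b \<subseteq> \<Omega>" by blast
      qed
      finally show ?thesis .
    qed
    moreover have "(LINT x|lborel. f x) = 0"
      using box_integral_zero[OF g z that] by (simp add: f_def set_lebesgue_integral_def)
    ultimately have "AE x in lborel. f x = 0" using integrable_zero_of_boxes[OF f] by blast
    then show ?thesis by eventually_elim (auto simp: f_def)
  qed
  define \<F> where "\<F> = {box c d | c d. cbox c d \<subseteq> \<Omega>}"
  obtain \<F>' where F': "\<F>' \<subseteq> \<F>" "countable \<F>'" "\<Union>\<F>' = \<Union>\<F>"
    using Lindelof[of \<F>] by (auto simp: \<F>_def)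
  have "AE x in lborel. \<forall>B\<in>\<F>'. x \<in> B \<longrightarrow> g x = 0"
    using F'(1) loc by (subst AE_ball_countable[OF F'(2)]) (auto simp: \<F>_def)
  then show ?thesis
  proof eventually_elim
    case (elim x)
    show ?case
    proof
      assume "x \<in> \<Omega>"
      then obtain c d where "cbox c d \<subseteq> \<Omega>" "x \<in> box c d"
        using open_contains_cbox[OF assms(1), of x] by metis
      then have "x \<in> \<Union>\<F>" by (auto simp: \<F>_def)
      then show "g x = 0" using elim F'(3) by auto
    qed
  qed
qed

lemma loc_integrable_nth: "loc_integrable \<Omega> g \<Longrightarrow> loc_integrable \<Omega> (\<lambda>x. g x $ i)" for g :: "real^2 \<Rightarrow> real^2"
  unfolding loc_integrable_def set_integrable_def
  using integrable_bounded_linear[OF bounded_linear_vec_nth, of lborel _ i] by fastforce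

lemma loc_integrable_lincomb:
  fixes f g :: "real^2 \<Rightarrow> 'b::{banach, second_countable_topology}"
  assumes "loc_integrable \<Omega> f" "loc_integrable \<Omega> g"
  shows "loc_integrable \<Omega> (\<lambda>x. a *\<^sub>R f x + b *\<^sub>R g x)"
  using assms unfolding loc_integrable_def
  by (intro allI impI set_integral_add set_integrable_scaleR_right) auto

lemma has_weak_gradient_lincomb:
  assumes u: "has_weak_gradient \<Omega> u g" and v: "has_weak_gradient \<Omega> v h"
  shows "has_weak_gradient \<Omega> (\<lambda>x. a * u x + b * v x) (\<lambda>x. a *\<^sub>R g x + b *\<^sub>R h x)"
  unfolding has_weak_gradient_def
proof (intro conjI ballI allI)
  have li: "loc_integrable \<Omega> u" "loc_integrable \<Omega> v" "loc_integrable \<Omega> g" "loc_integrable \<Omega> h"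
    using u v by (auto simp: has_weak_gradient_def)
  show "loc_integrable \<Omega> (\<lambda>x. a * u x + b * v x)" "loc_integrable \<Omega> (\<lambda>x. a *\<^sub>R g x + b *\<^sub>R h x)"
    using loc_integrable_lincomb[OF li(1,2)] loc_integrable_lincomb[OF li(3,4)] by auto
  fix \<phi> i assume \<phi>: "\<phi> \<in> test_fun \<Omega>"
  note * = loc_integrable_mult_test[OF _ partial_test_fun[OF \<phi>], of _ i] loc_integrable_mult_test[OF _ \<phi>]
  have "(LINT x:\<Omega>|lborel. (a * u x + b * v x) * partial i \<phi> x)
    = (LINT x:\<Omega>|lborel. a * (u x * partial i \<phi> x) + b * (v x * partial i \<phi> x))"
    by (simp add: algebra_simps)
  also have "\<dots> = a * (LINT x:\<Omega>|lborel. u x * partial i \<phi> x) + b * (LINT x:\<Omega>|lborel. v x * partial i \<phi> x)"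
    using *(1)[OF li(1)] *(1)[OF li(2)] by (subst set_integral_add) auto
  also have "\<dots> = - (a * (LINT x:\<Omega>|lborel. g x $ i * \<phi> x) + b * (LINT x:\<Omega>|lborel. h x $ i * \<phi> x))"
    using u v \<phi> by (simp add: has_weak_gradient_def)
  also have "\<dots> = - (LINT x:\<Omega>|lborel. a * (g x $ i * \<phi> x) + b * (h x $ i * \<phi> x))"
    using *(2)[OF loc_integrable_nth[OF li(3)]] *(2)[OF loc_integrable_nth[OF li(4)]] by (subst set_integral_add) auto
  also have "\<dots> = - (LINT x:\<Omega>|lborel. (a *\<^sub>R g x + b *\<^sub>R h x) $ i * \<phi> x)"
    by (simp add: algebra_simps)
  finally show "(LINT x:\<Omega>|lborel. (a * u x + b * v x) * partial i \<phi> x)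
    = - (LINT x:\<Omega>|lborel. (a *\<^sub>R g x + b *\<^sub>R h x) $ i * \<phi> x)" .
qed

lemma has_weak_gradient_diff:
  assumes "has_weak_gradient \<Omega> u g" "has_weak_gradient \<Omega> v h"
  shows "has_weak_gradient \<Omega> (\<lambda>x. u x - v x) (\<lambda>x. g x - h x)"
  using has_weak_gradient_lincomb[OF assms, of 1 "-1"] by simp

text \<open>Two functions that differ by a constant are admitted because this covers at once the
representatives of one function and those of a class modulo constants.\<close>

lemma weak_gradient_unique:
  assumes "open \<Omega>" and u: "has_weak_gradient \<Omega> u g" and v: "has_weak_gradient \<Omega> v h"
    and c: "AE x in lborel. x \<in> \<Omega> \<longrightarrow> u x - v x = c"
  shows "AE x in lborel. x \<in> \<Omega> \<longrightarrow> g x = h x"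
proof -
  have d: "has_weak_gradient \<Omega> (\<lambda>x. u x - v x) (\<lambda>x. g x - h x)"
    by (rule has_weak_gradient_diff[OF u v])
  have "AE x in lborel. x \<in> \<Omega> \<longrightarrow> (g x - h x) $ i = 0" for i
  proof (rule fundamental_lemma[OF assms(1)])
    show "loc_integrable \<Omega> (\<lambda>x. (g x - h x) $ i)"
      using d loc_integrable_nth[of \<Omega> "\<lambda>x. g x - h x" i] by (simp add: has_weak_gradient_def)
    fix \<phi> assume \<phi>: "\<phi> \<in> test_fun \<Omega>"
    obtain K where K: "compact K" "K \<subseteq> \<Omega>" "\<And>x. x \<notin> K \<Longrightarrow> \<phi> x = 0" "\<And>x. x \<notin> K \<Longrightarrow> partial i \<phi> x = 0"
      using test_fun_support[OF \<phi>] by blast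
    obtain B where B: "\<And>x. \<bar>partial i \<phi> x\<bar> \<le> B" using test_fun_bounded[OF partial_test_fun[OF \<phi>]] by blast
    have li: "loc_integrable \<Omega> (\<lambda>x. u x - v x)" using d by (simp add: has_weak_gradient_def)
    have int: "set_integrable lborel \<Omega> (\<lambda>x. (u x - v x) * partial i \<phi> x)"
      by (rule loc_integrable_mult_test[OF li partial_test_fun[OF \<phi>]])
    have [measurable]: "partial i \<phi> \<in> borel_measurable borel"
      by (rule test_fun_measurable[OF partial_test_fun[OF \<phi>]])
    have "(LINT x:\<Omega>|lborel. (u x - v x) * partial i \<phi> x) = (LINT x|lborel. c * partial i \<phi> x)"
      unfolding set_lebesgue_integral_def
    proof (rule integral_cong_AE)
      show "AE x in lborel. indicator \<Omega> x *\<^sub>R ((u x - v x) * partial i \<phi> x) = c * partial i \<phi> x"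
        using c by eventually_elim (use K in \<open>auto simp: indicator_def\<close>)
    qed (use int in \<open>simp_all add: set_integrable_def\<close>)
    also have "\<dots> = 0"
      using integral_partial_zero(2)[OF test_fun_differentiable[OF \<phi>] B K(1,3)] by simp
    finally show "(LINT x:\<Omega>|lborel. (g x - h x) $ i * \<phi> x) = 0"
      using d \<phi> by (simp add: has_weak_gradient_def)
  qed
  then have "AE x in lborel. \<forall>i\<in>UNIV. x \<in> \<Omega> \<longrightarrow> (g x - h x) $ i = 0"
    by (intro AE_finite_allI) auto
  then show ?thesis by eventually_elim (simp add: vec_eq_iff)
qed

section \<open>Square integrable fields\<close>

lemma L2_D1: "L2 A f \<Longrightarrow> (\<lambda>x. indicator A x *\<^sub>R f x) \<in> borel_measurable lborel"
  by (simp add: L2_def set_borel_measurable_def)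

lemma L2_D2: "L2 A f \<Longrightarrow> set_integrable lborel A (\<lambda>x. (norm (f x))\<^sup>2)"
  by (simp add: L2_def)

lemma set_borel_measurable_lincomb:
  fixes f g :: "'a \<Rightarrow> 'b::{second_countable_topology, real_normed_vector}"
  assumes "set_borel_measurable M A f" "set_borel_measurable M A g"
  shows "set_borel_measurable M A (\<lambda>x. a *\<^sub>R f x + b *\<^sub>R g x)"
proof -
  have [measurable]: "(\<lambda>x. indicator A x *\<^sub>R f x) \<in> borel_measurable M"
    "(\<lambda>x. indicator A x *\<^sub>R g x) \<in> borel_measurable M"
    using assms by (auto simp: set_borel_measurable_def)
  have "(\<lambda>x. a *\<^sub>R (indicator A x *\<^sub>R f x) + b *\<^sub>R (indicator A x *\<^sub>R g x)) \<in> borel_measurable M"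
    by measurable
  then show ?thesis by (simp add: set_borel_measurable_def algebra_simps scaleR_add_right)
qed

text \<open>Membership by comparison; most closure properties of \<open>L2\<close> below are instances.\<close>

lemma L2_bound:
  fixes f :: "real^2 \<Rightarrow> 'b::real_normed_vector" and g :: "real^2 \<Rightarrow> 'c::{second_countable_topology, real_normed_vector}"
  assumes "L2 A f" "set_borel_measurable lborel A g"
    and "AE x in lborel. x \<in> A \<longrightarrow> norm (g x) \<le> C * norm (f x)"
  shows "L2 A g"
  unfolding L2_def
proof (intro conjI assms(2))
  have [measurable]: "(\<lambda>x. indicator A x *\<^sub>R g x) \<in> borel_measurable lborel"
    using assms(2) by (simp add: set_borel_measurable_def)
  have "(\<lambda>x. (norm (indicator A x *\<^sub>R g x))\<^sup>2) \<in> borel_measurable lborel" by measurable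
  also have "(\<lambda>x. (norm (indicator A x *\<^sub>R g x))\<^sup>2) = (\<lambda>x. indicator A x *\<^sub>R (norm (g x))\<^sup>2)"
    by (auto simp: indicator_def fun_eq_iff)
  finally have m: "set_borel_measurable lborel A (\<lambda>x. (norm (g x))\<^sup>2)"
    by (simp add: set_borel_measurable_def)
  have i: "set_integrable lborel A (\<lambda>x. C\<^sup>2 * (norm (f x))\<^sup>2)"
    using L2_D2[OF assms(1)] by simp
  show "set_integrable lborel A (\<lambda>x. (norm (g x))\<^sup>2)"
  proof (rule set_integrable_bound[OF i m])
    show "AE x in lborel. x \<in> A \<longrightarrow> norm ((norm (g x))\<^sup>2) \<le> norm (C\<^sup>2 * (norm (f x))\<^sup>2)"
      using assms(3)
    proof eventually_elim
      case (elim x)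
      show ?case
      proof
        assume "x \<in> A"
        then have "(norm (g x))\<^sup>2 \<le> (C * norm (f x))\<^sup>2" using elim by (intro power_mono) auto
        then show "norm ((norm (g x))\<^sup>2) \<le> norm (C\<^sup>2 * (norm (f x))\<^sup>2)"
          by (simp add: power_mult_distrib)
      qed
    qed
  qed
qed

lemma L2_cong_AE:
  fixes g :: "real^2 \<Rightarrow> 'b::{second_countable_topology, real_normed_vector}"
  assumes "L2 A f" "set_borel_measurable lborel A g" "AE x in lborel. x \<in> A \<longrightarrow> f x = g x"
  shows "L2 A g"
  by (rule L2_bound[OF assms(1,2), of 1]) (use assms(3) in auto)

lemma L2_lincomb:
  fixes f g :: "real^2 \<Rightarrow> 'b::{second_countable_topology, real_normed_vector}"
  assumes f: "L2 A f" and g: "L2 A g"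
  shows "L2 A (\<lambda>x. a *\<^sub>R f x + b *\<^sub>R g x)"
proof -
  have m: "set_borel_measurable lborel A (\<lambda>x. a *\<^sub>R f x + b *\<^sub>R g x)"
    using f g by (intro set_borel_measurable_lincomb) (auto simp: L2_def)
  have "set_integrable lborel A (\<lambda>x. (norm (f x))\<^sup>2 + (norm (g x))\<^sup>2)"
    by (intro set_integral_add L2_D2 f g)
  moreover have "(\<lambda>x. (norm (f x))\<^sup>2 + (norm (g x))\<^sup>2) = (\<lambda>x. (norm (sqrt ((norm (f x))\<^sup>2 + (norm (g x))\<^sup>2)))\<^sup>2)"
    by simp
  moreover have "set_borel_measurable lborel A (\<lambda>x. sqrt ((norm (f x))\<^sup>2 + (norm (g x))\<^sup>2))"
  proof -
    have [measurable]: "(\<lambda>x. indicator A x *\<^sub>R f x) \<in> borel_measurable lborel"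
      "(\<lambda>x. indicator A x *\<^sub>R g x) \<in> borel_measurable lborel"
      using L2_D1[OF f] L2_D1[OF g] by auto
    have "(\<lambda>x. sqrt ((norm (indicator A x *\<^sub>R f x))\<^sup>2 + (norm (indicator A x *\<^sub>R g x))\<^sup>2)) \<in> borel_measurable lborel"
      by measurable
    also have "(\<lambda>x. sqrt ((norm (indicator A x *\<^sub>R f x))\<^sup>2 + (norm (indicator A x *\<^sub>R g x))\<^sup>2))
      = (\<lambda>x. indicator A x *\<^sub>R sqrt ((norm (f x))\<^sup>2 + (norm (g x))\<^sup>2))"
      by (auto simp: indicator_def fun_eq_iff)
    finally show ?thesis by (simp add: set_borel_measurable_def)
  qed
  ultimately have s: "L2 A (\<lambda>x. sqrt ((norm (f x))\<^sup>2 + (norm (g x))\<^sup>2))"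
    unfolding L2_def by metis
  show ?thesis
  proof (rule L2_bound[OF s m, of "\<bar>a\<bar> + \<bar>b\<bar>"], rule AE_I2, rule impI)
    fix x
    let ?s = "sqrt ((norm (f x))\<^sup>2 + (norm (g x))\<^sup>2)"
    have "norm (f x) \<le> ?s" "norm (g x) \<le> ?s" by (auto intro!: real_le_rsqrt)
    then have "\<bar>a\<bar> * norm (f x) + \<bar>b\<bar> * norm (g x) \<le> \<bar>a\<bar> * ?s + \<bar>b\<bar> * ?s"
      by (intro add_mono mult_left_mono) auto
    then have "norm (a *\<^sub>R f x + b *\<^sub>R g x) \<le> (\<bar>a\<bar> + \<bar>b\<bar>) * ?s"
      using norm_triangle_ineq[of "a *\<^sub>R f x" "b *\<^sub>R g x"] by (simp add: algebra_simps)
    then show "norm (a *\<^sub>R f x + b *\<^sub>R g x) \<le> (\<bar>a\<bar> + \<bar>b\<bar>) * norm ?s" by simp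
  qed
qed

lemma L2_add: "L2 A f \<Longrightarrow> L2 A g \<Longrightarrow> L2 A (\<lambda>x. f x + g x :: 'b::{second_countable_topology, real_normed_vector})"
  using L2_lincomb[of A f g 1 1] by simp

lemma L2_diff: "L2 A f \<Longrightarrow> L2 A g \<Longrightarrow> L2 A (\<lambda>x. f x - g x :: 'b::{second_countable_topology, real_normed_vector})"
  using L2_lincomb[of A f g 1 "-1"] by simp

lemma L2_scaleR: "L2 A f \<Longrightarrow> L2 A (\<lambda>x. a *\<^sub>R f x :: 'b::{second_countable_topology, real_normed_vector})"
  using L2_lincomb[of A f f a 0] by simp

lemma L2_subset:
  fixes f :: "real^2 \<Rightarrow> 'b::{second_countable_topology, real_normed_vector}"
  assumes "L2 A f" "B \<in> sets borel" "B \<subseteq> A"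
  shows "L2 B f"
proof -
  have [measurable]: "(\<lambda>x. indicator A x *\<^sub>R f x) \<in> borel_measurable lborel" "B \<in> sets borel"
    using L2_D1[OF assms(1)] assms(2) by auto
  have "(\<lambda>x. indicator B x *\<^sub>R (indicator A x *\<^sub>R f x)) \<in> borel_measurable lborel" by measurable
  also have "(\<lambda>x. indicator B x *\<^sub>R (indicator A x *\<^sub>R f x)) = (\<lambda>x. indicator B x *\<^sub>R f x)"
    using assms(3) by (auto simp: indicator_def fun_eq_iff)
  finally show ?thesis
    using set_integrable_subset[OF L2_D2[OF assms(1)]] assms(2,3)
    by (auto simp: L2_def set_borel_measurable_def)
qed

lemma L2_linear:
  fixes f :: "real^2 \<Rightarrow> real^2"
  assumes "L2 A f" "linear T"
  shows "L2 A (\<lambda>x. T (f x) :: real^2)"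
proof -
  obtain C where C: "\<And>x. norm (T x) \<le> C * norm x"
    using linear_bounded[OF assms(2)] by (auto simp: mult.commute)
  have [measurable]: "(\<lambda>x. indicator A x *\<^sub>R f x) \<in> borel_measurable lborel"
    using assms(1) by (rule L2_D1)
  have [measurable]: "T \<in> borel_measurable borel"
    by (intro borel_measurable_continuous_onI linear_continuous_on linear_conv_bounded_linear[THEN iffD1] assms)
  have "(\<lambda>x. T (indicator A x *\<^sub>R f x)) \<in> borel_measurable lborel" by measurable
  then have "set_borel_measurable lborel A (\<lambda>x. T (f x))"
    using assms(2) by (simp add: set_borel_measurable_def linear_scale)
  then show ?thesis by (rule L2_bound[OF assms(1), where C = C]) (use C in auto)
qed

lemma L2_inner:
  fixes f g :: "real^2 \<Rightarrow> 'b::euclidean_space"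
  assumes f: "L2 A f" and g: "L2 A g"
  shows "set_integrable lborel A (\<lambda>x. f x \<bullet> g x)"
proof -
  have i: "set_integrable lborel A (\<lambda>x. (norm (f x))\<^sup>2 + (norm (g x))\<^sup>2)"
    by (intro set_integral_add L2_D2 f g)
  have [measurable]: "(\<lambda>x. indicator A x *\<^sub>R f x) \<in> borel_measurable lborel"
    "(\<lambda>x. indicator A x *\<^sub>R g x) \<in> borel_measurable lborel"
    using L2_D1[OF f] L2_D1[OF g] by auto
  have "(\<lambda>x. (indicator A x *\<^sub>R f x) \<bullet> (indicator A x *\<^sub>R g x)) \<in> borel_measurable lborel" by measurable
  also have "(\<lambda>x. (indicator A x *\<^sub>R f x) \<bullet> (indicator A x *\<^sub>R g x)) = (\<lambda>x. indicator A x *\<^sub>R (f x \<bullet> g x))"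
    by (auto simp: indicator_def fun_eq_iff)
  finally have m: "set_borel_measurable lborel A (\<lambda>x. f x \<bullet> g x)" by (simp add: set_borel_measurable_def)
  show ?thesis
  proof (rule set_integrable_bound[OF i m], rule AE_I2, rule impI)
    fix x
    have "0 \<le> (norm (f x) - norm (g x))\<^sup>2" by simp
    then have "2 * (norm (f x) * norm (g x)) \<le> (norm (f x))\<^sup>2 + (norm (g x))\<^sup>2"
      by (simp add: power2_diff)
    moreover have "0 \<le> norm (f x) * norm (g x)" by simp
    ultimately show "norm (f x \<bullet> g x) \<le> norm ((norm (f x))\<^sup>2 + (norm (g x))\<^sup>2)"
      using Cauchy_Schwarz_ineq2[of "f x" "g x"] by simp
  qed
qed

text \<open>The integral of \<open>|t f + g|^2\<close> is a nonnegative quadratic polynomial in \<open>t\<close>.\<close>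

lemma L2_Cauchy_Schwarz:
  fixes f g :: "real^2 \<Rightarrow> 'b::euclidean_space"
  assumes f: "L2 A f" and g: "L2 A g"
  shows "(LINT x:A|lborel. f x \<bullet> g x)\<^sup>2 \<le> (LINT x:A|lborel. (norm (f x))\<^sup>2) * (LINT x:A|lborel. (norm (g x))\<^sup>2)"
    (is "?I\<^sup>2 \<le> ?F * ?G")
proof -
  have q: "0 \<le> t\<^sup>2 * ?F + 2 * t * ?I + ?G" for t
  proof -
    have "0 \<le> (LINT x:A|lborel. (norm (t *\<^sub>R f x + g x))\<^sup>2)"
      unfolding set_lebesgue_integral_def by (rule Bochner_Integration.integral_nonneg) simp
    also have "(\<lambda>x. (norm (t *\<^sub>R f x + g x))\<^sup>2) = (\<lambda>x. t\<^sup>2 * (norm (f x))\<^sup>2 + (2 * t * (f x \<bullet> g x) + (norm (g x))\<^sup>2))"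
      unfolding power2_norm_eq_inner
      by (simp add: inner_add_left inner_add_right inner_commute algebra_simps power2_eq_square)
    also have "(LINT x:A|lborel. t\<^sup>2 * (norm (f x))\<^sup>2 + (2 * t * (f x \<bullet> g x) + (norm (g x))\<^sup>2)) = t\<^sup>2 * ?F + (2 * t * ?I + ?G)"
      using L2_D2[OF f] L2_D2[OF g] L2_inner[OF f g] by (simp add: set_integral_add)
    finally show ?thesis by simp
  qed
  have F: "0 \<le> ?F"
    unfolding set_lebesgue_integral_def by (rule Bochner_Integration.integral_nonneg) simp
  show ?thesis
  proof (cases "?F = 0")
    case False
    then have "0 < ?F" using F by simp
    \<comment> \<open>The minimum of the quadratic polynomial is attained at \<open>t = - I / F\<close>.\<close>
    with q[of "- ?I / ?F"] show ?thesis by (simp add: field_simps power2_eq_square)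
  next
    case True
    have "?I = 0"
    proof (rule ccontr)
      assume "?I \<noteq> 0"
      \<comment> \<open>A linear polynomial that is nowhere negative is constant; here it takes the value \<open>-1\<close>.\<close>
      with q[of "- (?G + 1) / (2 * ?I)"] True show False by (simp add: field_simps)
    qed
    then show ?thesis using True by simp
  qed
qed

lemma L2_limit_inner:
  fixes f :: "nat \<Rightarrow> real^2 \<Rightarrow> 'b::euclidean_space"
  assumes f: "\<And>n. L2 A (f n)" "L2 A h" and g: "L2 A g"
    and lim: "(\<lambda>n. LINT x:A|lborel. (norm (f n x - h x))\<^sup>2) \<longlonglongrightarrow> 0"
  shows "(\<lambda>n. LINT x:A|lborel. f n x \<bullet> g x) \<longlonglongrightarrow> (LINT x:A|lborel. h x \<bullet> g x)"
proof -
  let ?G = "LINT x:A|lborel. (norm (g x))\<^sup>2"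
  have "(\<lambda>n. (LINT x:A|lborel. (f n x - h x) \<bullet> g x)\<^sup>2) \<longlonglongrightarrow> 0"
  proof (rule Lim_null_comparison)
    show "(\<lambda>n. (LINT x:A|lborel. (norm (f n x - h x))\<^sup>2) * ?G) \<longlonglongrightarrow> 0"
      using tendsto_mult_right[OF lim, of ?G] by simp
    show "\<forall>\<^sub>F n in sequentially. norm ((LINT x:A|lborel. (f n x - h x) \<bullet> g x)\<^sup>2)
        \<le> (LINT x:A|lborel. (norm (f n x - h x))\<^sup>2) * ?G"
      using L2_Cauchy_Schwarz[OF L2_diff[OF f] g] by simp
  qed
  then have "(\<lambda>n. LINT x:A|lborel. (f n x - h x) \<bullet> g x) \<longlonglongrightarrow> 0"
    using tendsto_real_sqrt[of _ 0] tendsto_rabs_zero_iff by (fastforce simp: real_sqrt_abs)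
  moreover have "(LINT x:A|lborel. (f n x - h x) \<bullet> g x) = (LINT x:A|lborel. f n x \<bullet> g x) - (LINT x:A|lborel. h x \<bullet> g x)" for n
    using L2_inner[OF f(1) g] L2_inner[OF f(2) g] by (simp add: inner_diff_left set_integral_diff)
  ultimately show ?thesis by (simp add: LIM_zero_iff)
qed

text \<open>An open set is a countable union of compact boxes, on each of which \<open>f\<close> is integrable.\<close>

lemma loc_integrable_measurable:
  fixes f :: "real^2 \<Rightarrow> 'b::{banach, second_countable_topology}"
  assumes "open \<Omega>" "loc_integrable \<Omega> f"
  shows "set_borel_measurable lborel \<Omega> f"
proof -
  obtain \<D> where D: "countable \<D>" "\<D> \<subseteq> Pow \<Omega>" "\<And>X. X \<in> \<D> \<Longrightarrow> \<exists>a b. X = cbox a b" "\<Union>\<D> = \<Omega>"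
    using open_countable_Union_open_cbox[OF assms(1)] by metis
  let ?h = "\<lambda>x. indicator \<Omega> x *\<^sub>R f x"
  have "?h \<in> borel_measurable lborel"
  proof (rule measurable_piecewise_restrict[of "insert (- \<Omega>) \<D>"])
    show "countable (insert (- \<Omega>) \<D>)" using D(1) by simp
    show "space lborel \<subseteq> \<Union> (insert (- \<Omega>) \<D>)" using D(4) by auto
    fix B assume B: "B \<in> insert (- \<Omega>) \<D>"
    then show mB: "B \<inter> space lborel \<in> sets lborel" using assms(1) D(3)[of B] by (auto simp: borel_open)
    have "(\<lambda>x. indicator B x *\<^sub>R ?h x) \<in> borel_measurable lborel"
    proof (cases "B = - \<Omega>")
      case True
      then have "(\<lambda>x. indicator B x *\<^sub>R ?h x) = (\<lambda>x. 0)" by (auto simp: indicator_def fun_eq_iff)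
      then show ?thesis by simp
    next
      case False
      then obtain a b where ab: "B = cbox a b" "B \<subseteq> \<Omega>" using B D(2,3) by blast
      then have "(\<lambda>x. indicator B x *\<^sub>R ?h x) = (\<lambda>x. indicator B x *\<^sub>R f x)"
        by (auto simp: indicator_def fun_eq_iff)
      moreover have "integrable lborel (\<lambda>x. indicator B x *\<^sub>R f x)"
        using assms(2) ab by (auto simp: loc_integrable_def set_integrable_def)
      ultimately show ?thesis using borel_measurable_integrable by metis
    qed
    then show "?h \<in> borel_measurable (restrict_space lborel B)"
      using borel_measurable_restrict_space_iff[OF mB, of ?h] by simp
  qed
  then show ?thesis by (simp add: set_borel_measurable_def)
qed

lemma wgrad_works: "has_weak_gradient \<Omega> u g \<Longrightarrow> has_weak_gradient \<Omega> u (wgrad \<Omega> u)"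
  unfolding wgrad_def by (rule someI[of _ g])

lemma wgrad_AE:
  assumes "open \<Omega>" "has_weak_gradient \<Omega> u g"
  shows "AE x in lborel. x \<in> \<Omega> \<longrightarrow> wgrad \<Omega> u x = g x"
  using weak_gradient_unique[OF assms(1) wgrad_works[OF assms(2)] assms(2), of 0] by simp

lemma wgrad_L2:
  assumes "open \<Omega>" "has_weak_gradient \<Omega> u g" "L2 \<Omega> g"
  shows "L2 \<Omega> (wgrad \<Omega> u)"
proof (rule L2_cong_AE[OF assms(3)])
  show "set_borel_measurable lborel \<Omega> (wgrad \<Omega> u)"
    using wgrad_works[OF assms(2)] assms(1)
    by (intro loc_integrable_measurable) (auto simp: has_weak_gradient_def)
  show "AE x in lborel. x \<in> \<Omega> \<longrightarrow> g x = wgrad \<Omega> u x"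
    using wgrad_AE[OF assms(1,2)] by eventually_elim auto
qed

section \<open>Smooth approximation of the dipole potential\<close>

lemma flat_exp_0_le: "t \<le> 1 \<Longrightarrow> flat_exp 0 t \<le> exp (- 1)"
  by (auto simp: flat_exp_def field_simps)

lemma flat_exp_2_le: "flat_exp 2 t \<le> 2"
proof (cases "0 < t")
  case True
  have "exp (- (1 / t)) * (1 + 1 / t + (1 / t)\<^sup>2 / 2) \<le> exp (- (1 / t)) * exp (1 / t)"
    by (intro mult_left_mono exp_lower_Taylor_quadratic) (use True in auto)
  also have "\<dots> = 1" by (simp add: exp_minus)
  finally have "exp (- (1 / t)) * (1 + 1 / t + (1 / t)\<^sup>2 / 2) \<le> 1" .
  moreover have "exp (- (1 / t)) * ((1 / t)\<^sup>2 / 2) \<le> exp (- (1 / t)) * (1 + 1 / t + (1 / t)\<^sup>2 / 2)"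
    by (intro mult_left_mono) (use True in auto)
  ultimately have "exp (- (1 / t)) * ((1 / t)\<^sup>2 / 2) \<le> 1" by linarith
  then show ?thesis using True by (simp add: flat_exp_def)
qed (simp add: flat_exp_def)

text \<open>A smooth cutoff with support in \<open>s \<le> n\<close>; the factor \<open>exp 1\<close> gives it the value \<open>1\<close> at \<open>s = 0\<close>.\<close>

definition cutoff :: "nat \<Rightarrow> real \<Rightarrow> real" where
  "cutoff n s = exp 1 * flat_exp 0 (1 - s / real n)"

definition cutoff' :: "nat \<Rightarrow> real \<Rightarrow> real" where
  "cutoff' n s = - exp 1 * flat_exp 2 (1 - s / real n) / real n"

text \<open>A smooth version of \<open>min(1, 1/s)\<close> on \<open>s \<ge> 0\<close>, to which it tends as \<open>n\<close> grows.\<close>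

definition soft_rcp :: "nat \<Rightarrow> real \<Rightarrow> real" where
  "soft_rcp n s = (1 + s ^ n) powr (- 1 / real n)"

definition soft_rcp' :: "nat \<Rightarrow> real \<Rightarrow> real" where
  "soft_rcp' n s = - (s ^ (n - 1) / (1 + s ^ n)) * soft_rcp n s"

definition profile :: "nat \<Rightarrow> real \<Rightarrow> real" where
  "profile n s = soft_rcp n s * cutoff n s"

definition profile' :: "nat \<Rightarrow> real \<Rightarrow> real" where
  "profile' n s = soft_rcp' n s * cutoff n s + soft_rcp n s * cutoff' n s"

lemma cutoff_has_derivative: "n > 0 \<Longrightarrow> (cutoff n has_real_derivative cutoff' n s) (at s)"
  unfolding cutoff_def[abs_def] cutoff'_def
  by (rule DERIV_cong[OF DERIV_cmult[OF DERIV_chain2[OF flat_exp_has_derivative, where g = "\<lambda>s. 1 - s / real n" and s = UNIV and Db = "- 1 / real n"]]])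
    (auto intro!: derivative_eq_intros simp: numeral_2_eq_2)

lemma soft_rcp_has_derivative:
  assumes "n > 0" "0 \<le> s"
  shows "(soft_rcp n has_real_derivative soft_rcp' n s) (at s)"
proof -
  have pos: "0 < 1 + s ^ n" using assms by (simp add: add_pos_nonneg)
  have "((\<lambda>s. 1 + s ^ n) has_real_derivative real n * s ^ (n - 1)) (at s)"
    by (auto intro!: derivative_eq_intros)
  from DERIV_powr[OF this pos DERIV_const[of "- 1 / real n"]]
  have "(soft_rcp n has_real_derivative (1 + s ^ n) powr (- 1 / real n) * (0 * ln (1 + s ^ n) + real n * s ^ (n - 1) * (- 1 / real n) / (1 + s ^ n))) (at s)"
    by (simp add: soft_rcp_def[abs_def])
  then show ?thesis by (rule DERIV_cong) (use assms in \<open>simp add: soft_rcp'_def soft_rcp_def\<close>)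
qed

lemma profile_has_derivative:
  assumes "n > 0" "0 \<le> s"
  shows "(profile n has_real_derivative profile' n s) (at s)"
  unfolding profile_def[abs_def]
  by (rule DERIV_cong[OF DERIV_mult[OF soft_rcp_has_derivative[OF assms] cutoff_has_derivative[OF assms(1)]]])
    (simp add: profile'_def)

lemma cutoff_bounds:
  assumes "n > 0" "0 \<le> s"
  shows "0 \<le> cutoff n s" "cutoff n s \<le> 1" "\<bar>cutoff' n s\<bar> \<le> 12 / (1 + s)"
proof -
  show "0 \<le> cutoff n s" by (simp add: cutoff_def flat_exp_nonneg)
  have "exp 1 * flat_exp 0 (1 - s / real n) \<le> exp 1 * exp (- 1)"
    by (intro mult_left_mono flat_exp_0_le) (use assms in auto)
  then show "cutoff n s \<le> 1" by (simp add: cutoff_def exp_minus)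
  show "\<bar>cutoff' n s\<bar> \<le> 12 / (1 + s)"
  proof (cases "s < real n")
    case True
    have "1 \<le> real n" using assms by simp
    then have n2: "(1 + s) / real n \<le> 2" using True by (simp add: divide_le_eq)
    have t6: "exp 1 * flat_exp 2 (1 - s / real n) \<le> 3 * 2"
      by (intro mult_mono flat_exp_2_le exp_le) (auto simp: flat_exp_nonneg)
    have "exp 1 * flat_exp 2 (1 - s / real n) * ((1 + s) / real n) \<le> (3 * 2) * 2"
      using assms by (intro mult_mono[OF t6 n2]) auto
    moreover have "\<bar>cutoff' n s\<bar> * (1 + s) = exp 1 * flat_exp 2 (1 - s / real n) * ((1 + s) / real n)"
      by (simp add: cutoff'_def flat_exp_nonneg abs_mult)
    ultimately show ?thesis using assms by (simp add: pos_le_divide_eq)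
  next
    case False
    then have "flat_exp 2 (1 - s / real n) = 0" using assms by (simp add: flat_exp_def field_simps)
    then show ?thesis using assms by (simp add: cutoff'_def)
  qed
qed

lemma soft_rcp_bounds:
  assumes "n > 0" "0 \<le> s"
  shows "0 \<le> soft_rcp n s" "soft_rcp n s \<le> 1" "soft_rcp n s * s \<le> 1" "soft_rcp n s \<le> 2 / (1 + s)" "\<bar>soft_rcp' n s\<bar> \<le> 4 / (1 + s)\<^sup>2"
proof -
  have p: "0 \<le> s ^ n" "1 \<le> 1 + s ^ n" using assms by auto
  show nn: "0 \<le> soft_rcp n s" by (simp add: soft_rcp_def)
  show one: "soft_rcp n s \<le> 1"
    unfolding soft_rcp_def using powr_mono[of "- 1 / real n" 0 "1 + s ^ n"] p assms by simp
  show s: "soft_rcp n s * s \<le> 1"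
  proof (cases "s = 0")
    case False
    then have "s > 0" using assms by simp
    have "soft_rcp n s \<le> (s ^ n) powr (- 1 / real n)"
      unfolding soft_rcp_def by (rule powr_mono2') (use \<open>s > 0\<close> in auto)
    also have "(s ^ n) powr (- 1 / real n) = s powr (- 1)"
      using \<open>s > 0\<close> assms by (simp add: powr_realpow[symmetric] powr_powr)
    also have "\<dots> = 1 / s" using \<open>s > 0\<close> by (simp add: powr_minus_divide)
    finally show ?thesis using \<open>s > 0\<close> by (simp add: field_simps)
  qed simp
  have "soft_rcp n s * (1 + s) \<le> 2" using s one by (simp add: algebra_simps)
  then show b: "soft_rcp n s \<le> 2 / (1 + s)" using assms by (simp add: pos_le_divide_eq)
  have "s ^ (n - 1) \<le> 1 + s ^ n"
  proof (cases "s \<le> 1")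
    case True then show ?thesis using assms p power_le_one[of s "n - 1"] by linarith
  next
    case False then show ?thesis using assms power_increasing[of "n - 1" n s] by linarith
  qed
  moreover have "s ^ (n - 1) * s = s ^ n" using assms by (cases n) auto
  ultimately have "s ^ (n - 1) * (1 + s) \<le> 2 * (1 + s ^ n)" using p by (simp add: algebra_simps)
  then have q: "s ^ (n - 1) / (1 + s ^ n) \<le> 2 / (1 + s)"
  proof -
    have "0 < 1 + s ^ n" "0 < 1 + s" using p assms by linarith+
    then show ?thesis using \<open>s ^ (n - 1) * (1 + s) \<le> 2 * (1 + s ^ n)\<close>
      by (simp add: pos_divide_le_eq pos_le_divide_eq mult.commute)
  qed
  have "\<bar>soft_rcp' n s\<bar> = s ^ (n - 1) / (1 + s ^ n) * soft_rcp n s"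
    using nn p assms by (simp add: soft_rcp'_def abs_mult)
  also have "\<dots> \<le> 2 / (1 + s) * (2 / (1 + s))"
    by (intro mult_mono q b nn) (use assms in auto)
  finally show "\<bar>soft_rcp' n s\<bar> \<le> 4 / (1 + s)\<^sup>2" by (simp add: power2_eq_square)
qed

text \<open>Bounds that do not depend on \<open>n\<close>. The decay of the derivative is the one that leaves gradients
of order \<open>1 / (1 + |z|^2)\<close>, square integrable in the plane.\<close>

lemma profile_bounds:
  assumes "n > 0" "0 \<le> s"
  shows "0 \<le> profile n s" "profile n s \<le> 1" "profile n s \<le> 2 / (1 + s)" "\<bar>profile' n s\<bar> \<le> 28 / (1 + s)\<^sup>2"
proof -
  note k = cutoff_bounds[OF assms] and r = soft_rcp_bounds[OF assms]
  show "0 \<le> profile n s" using k r by (simp add: profile_def)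
  have "profile n s \<le> soft_rcp n s * 1" unfolding profile_def using k r by (intro mult_left_mono) auto
  then show "profile n s \<le> 1" "profile n s \<le> 2 / (1 + s)" using r by auto
  have "\<bar>profile' n s\<bar> \<le> \<bar>soft_rcp' n s\<bar> * cutoff n s + soft_rcp n s * \<bar>cutoff' n s\<bar>"
    unfolding profile'_def using k r abs_triangle_ineq[of "soft_rcp' n s * cutoff n s" "soft_rcp n s * cutoff' n s"]
    by (simp add: abs_mult)
  also have "\<dots> \<le> 4 / (1 + s)\<^sup>2 * 1 + 2 / (1 + s) * (12 / (1 + s))"
    using k r assms by (intro add_mono mult_mono) auto
  also have "\<dots> = 28 / (1 + s)\<^sup>2" by (simp add: power2_eq_square)
  finally show "\<bar>profile' n s\<bar> \<le> 28 / (1 + s)\<^sup>2" .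
qed

lemma cutoff_tendsto: "(\<lambda>n. cutoff n s) \<longlonglongrightarrow> 1"
proof -
  have "isCont (flat_exp 0) 1" using DERIV_isCont[OF flat_exp_has_derivative] .
  moreover have "(\<lambda>n. 1 - s / real n) \<longlonglongrightarrow> 1"
    using tendsto_diff[OF tendsto_const[of 1] lim_const_over_n[of s]] by simp
  ultimately have "(\<lambda>n. flat_exp 0 (1 - s / real n)) \<longlonglongrightarrow> flat_exp 0 1"
    by (rule isCont_tendsto_compose)
  from tendsto_mult[OF tendsto_const[of "exp 1"] this]
  show ?thesis by (simp add: cutoff_def flat_exp_def exp_minus)
qed

lemma cutoff'_tendsto: "(\<lambda>n. cutoff' n s) \<longlonglongrightarrow> 0"
proof (rule Lim_null_comparison)
  show "(\<lambda>n. (2 * exp 1) / real n) \<longlonglongrightarrow> 0" by (rule lim_const_over_n)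
  show "\<forall>\<^sub>F n in sequentially. norm (cutoff' n s) \<le> 2 * exp 1 / real n"
    by (intro always_eventually allI)
      (auto simp: cutoff'_def abs_mult flat_exp_nonneg mult.commute[of 2] intro!: divide_right_mono mult_left_mono flat_exp_2_le)
qed

lemma soft_rcp_tendsto:
  assumes "0 \<le> s" "s \<noteq> 1"
  shows "(\<lambda>n. soft_rcp n s) \<longlonglongrightarrow> (if s < 1 then 1 else 1 / s)"
    "(\<lambda>n. soft_rcp' n s) \<longlonglongrightarrow> (if s < 1 then 0 else - 1 / s\<^sup>2)"
proof -
  \<comment> \<open>For \<open>s > 1\<close> this is used at \<open>r = 1 / s\<close> after taking out the factor \<open>s ^ n\<close>.\<close>
  have base: "(\<lambda>n. (1 + r ^ n) powr (- 1 / real n)) \<longlonglongrightarrow> 1" if "0 \<le> r" "r < 1" for r :: real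
  proof -
    have "(\<lambda>n. 1 + r ^ n) \<longlonglongrightarrow> 1 + 0"
      by (intro tendsto_intros LIMSEQ_power_zero) (use that in auto)
    moreover have "(\<lambda>n. - 1 / real n) \<longlonglongrightarrow> 0" by (rule lim_const_over_n)
    ultimately have "(\<lambda>n. (1 + r ^ n) powr (- 1 / real n)) \<longlonglongrightarrow> (1 + 0) powr 0"
      by (rule tendsto_powr) simp
    then show ?thesis by simp
  qed
  have r: "(\<lambda>n. soft_rcp n s) \<longlonglongrightarrow> (if s < 1 then 1 else 1 / s)"
  proof (cases "s < 1")
    case True then show ?thesis using base[of s] assms by (simp add: soft_rcp_def)
  next
    case False
    then have s: "s > 1" using assms by simp
    have "(1 / s) * (1 + (1 / s) ^ n) powr (- 1 / real n) = soft_rcp n s" if "n > 0" for n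
    proof -
      have "1 + s ^ n = s ^ n * (1 + (1 / s) ^ n)" using s by (simp add: field_simps power_divide)
      then have "soft_rcp n s = (s ^ n) powr (- 1 / real n) * (1 + (1 / s) ^ n) powr (- 1 / real n)"
        unfolding soft_rcp_def using s by (simp add: powr_mult)
      also have "(s ^ n) powr (- 1 / real n) = s powr (- 1)"
        using s that by (simp add: powr_realpow[symmetric] powr_powr)
      finally show ?thesis using s by (simp add: powr_minus_divide)
    qed
    then have ev: "\<forall>\<^sub>F n in sequentially. (1 / s) * (1 + (1 / s) ^ n) powr (- 1 / real n) = soft_rcp n s"
      by (rule eventually_mono[OF eventually_gt_at_top[of 0]])
    have "(\<lambda>n. (1 / s) * (1 + (1 / s) ^ n) powr (- 1 / real n)) \<longlonglongrightarrow> (1 / s) * 1"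
      by (intro tendsto_mult tendsto_const base) (use s in auto)
    from Lim_transform_eventually[OF this ev] show ?thesis using False by simp
  qed
  then show "(\<lambda>n. soft_rcp n s) \<longlonglongrightarrow> (if s < 1 then 1 else 1 / s)" .
  have q: "(\<lambda>n. s ^ (n - 1) / (1 + s ^ n)) \<longlonglongrightarrow> (if s < 1 then 0 else 1 / s)"
  proof (cases "s < 1")
    case True
    have "(\<lambda>n. s ^ n / (1 + s ^ Suc n)) \<longlonglongrightarrow> 0 / (1 + s * 0)"
      unfolding power_Suc
      by (intro tendsto_intros LIMSEQ_power_zero) (use True assms in auto)
    then have "(\<lambda>n. s ^ (Suc n - 1) / (1 + s ^ Suc n)) \<longlonglongrightarrow> 0" by simp
    then show ?thesis using True LIMSEQ_imp_Suc[of "\<lambda>n. s ^ (n - 1) / (1 + s ^ n)"] by simp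
  next
    case False
    then have s: "s > 1" using assms by simp
    have "(\<lambda>n. (1 / s) / ((1 / s) * (1 / s) ^ n + 1)) \<longlonglongrightarrow> (1 / s) / ((1 / s) * 0 + 1)"
      by (intro tendsto_intros LIMSEQ_power_zero) (use s in auto)
    moreover have "(1 / s) / ((1 / s) * (1 / s) ^ n + 1) = s ^ (Suc n - 1) / (1 + s ^ Suc n)" for n
      using s by (simp add: field_simps power_divide)
    ultimately have "(\<lambda>n. s ^ (Suc n - 1) / (1 + s ^ Suc n)) \<longlonglongrightarrow> 1 / s" by simp
    then show ?thesis using False LIMSEQ_imp_Suc[of "\<lambda>n. s ^ (n - 1) / (1 + s ^ n)"] by simp
  qed
  from tendsto_mult[OF tendsto_minus[OF q] r]
  show "(\<lambda>n. soft_rcp' n s) \<longlonglongrightarrow> (if s < 1 then 0 else - 1 / s\<^sup>2)"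
    by (simp add: soft_rcp'_def power2_eq_square split: if_splits)
qed

lemma profile_tendsto:
  assumes "0 \<le> s" "s \<noteq> 1"
  shows "(\<lambda>n. profile n s) \<longlonglongrightarrow> (if s < 1 then 1 else 1 / s)"
    "(\<lambda>n. profile' n s) \<longlonglongrightarrow> (if s < 1 then 0 else - 1 / s\<^sup>2)"
proof -
  note r = soft_rcp_tendsto[OF assms]
  from tendsto_mult[OF r(1) cutoff_tendsto[of s]]
  show "(\<lambda>n. profile n s) \<longlonglongrightarrow> (if s < 1 then 1 else 1 / s)" by (simp add: profile_def)
  from tendsto_add[OF tendsto_mult[OF r(2) cutoff_tendsto[of s]] tendsto_mult[OF r(1) cutoff'_tendsto[of s]]]
  show "(\<lambda>n. profile' n s) \<longlonglongrightarrow> (if s < 1 then 0 else - 1 / s\<^sup>2)" by (simp add: profile'_def)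
qed

text \<open>The potential \<open>dipole_pot\<close> with the profile \<open>min(1, 1/s)\<close>, \<open>s = |z|^2\<close>, replaced by a smooth
profile with compact support.\<close>

definition dipole_approx :: "real^2 \<Rightarrow> nat \<Rightarrow> real^2 \<Rightarrow> real" where
  "dipole_approx a n z = (a \<bullet> z) * profile n ((norm z)\<^sup>2)"

text \<open>The gradient of \<open>dipole_pot a\<close> off the unit circle; on the circle, where the potential has a kink,
the outer value is taken.\<close>

definition dipole :: "real^2 \<Rightarrow> real^2 \<Rightarrow> real^2" where
  "dipole a z = (if norm z < 1 then a else (1 / (norm z)\<^sup>2) *\<^sub>R a - (2 * (a \<bullet> z) / ((norm z)\<^sup>2)\<^sup>2) *\<^sub>R z)"

definition dipole_pot :: "real^2 \<Rightarrow> real^2 \<Rightarrow> real" where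
  "dipole_pot a z = (a \<bullet> z) * (if norm z < 1 then 1 else 1 / (norm z)\<^sup>2)"

lemma norm_sq_elementary: "(\<lambda>z :: real^2. (norm z)\<^sup>2) \<in> elementary"
proof -
  have "(\<lambda>z :: real^2. (norm z)\<^sup>2) = (\<lambda>z. z $ 1 * z $ 1 + z $ 2 * z $ 2)"
    by (simp add: power2_norm_eq_inner inner_vec_def sum_2 fun_eq_iff)
  also have "\<dots> \<in> elementary" by (intro elementary.intros)
  finally show ?thesis .
qed

lemma inner_elementary: "(\<lambda>z :: real^2. a \<bullet> z) \<in> elementary"
proof -
  have "(\<lambda>z :: real^2. a \<bullet> z) = (\<lambda>z. a $ 1 * z $ 1 + a $ 2 * z $ 2)"
    by (simp add: inner_vec_def sum_2 fun_eq_iff)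
  also have "\<dots> \<in> elementary" by (intro elementary.intros)
  finally show ?thesis .
qed

lemma dipole_approx_elementary: "dipole_approx a n \<in> elementary"
proof -
  have "0 < 1 + ((norm z)\<^sup>2) ^ n" for z :: "real^2" by (simp add: add_pos_nonneg)
  moreover have "(\<lambda>z :: real^2. 1 + ((norm z)\<^sup>2) ^ n) \<in> elementary"
    by (intro elementary.intros elementary_power norm_sq_elementary)
  ultimately have "(\<lambda>z :: real^2. soft_rcp n ((norm z)\<^sup>2)) \<in> elementary"
    unfolding soft_rcp_def by (intro elementary.powr)
  moreover have "(\<lambda>z :: real^2. cutoff n ((norm z)\<^sup>2)) \<in> elementary"
    unfolding cutoff_def divide_inverse by (intro elementary.intros elementary_diff norm_sq_elementary)
  ultimately show ?thesis
    unfolding dipole_approx_def[abs_def] profile_def by (intro elementary.mult inner_elementary)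
qed

lemma dipole_approx_zero:
  assumes "n > 0" "real n \<le> (norm z)\<^sup>2"
  shows "dipole_approx a n z = 0"
  using assms by (simp add: dipole_approx_def profile_def cutoff_def flat_exp_def field_simps)

lemma dipole_approx_support:
  assumes "n > 0"
  shows "closure {z. dipole_approx a n z \<noteq> 0} \<subseteq> cball 0 (sqrt (real n))"
proof (rule closure_minimal)
  show "{z. dipole_approx a n z \<noteq> 0} \<subseteq> cball 0 (sqrt (real n))"
  proof
    fix z assume "z \<in> {z. dipole_approx a n z \<noteq> 0}"
    then have "\<not> real n \<le> (norm z)\<^sup>2" using dipole_approx_zero[OF assms] by auto
    then have "norm z \<le> sqrt (real n)" by (intro real_le_rsqrt) auto
    then show "z \<in> cball 0 (sqrt (real n))" by simp
  qed
qed auto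

lemma dipole_approx_test_fun:
  assumes "n > 0" "cball 0 (sqrt (real n)) \<subseteq> \<Omega>"
  shows "dipole_approx a n \<in> test_fun \<Omega>"
proof -
  have "compact (closure {z. dipole_approx a n z \<noteq> 0})"
    using compact_Int_closed[OF compact_cball closed_closure] dipole_approx_support[OF assms(1)]
    by (metis Int_absorb1)
  then show ?thesis
    using dipole_approx_support[OF assms(1)] assms(2) elementary_smooth[OF dipole_approx_elementary]
    by (auto simp: test_fun_def)
qed

lemma grad_dipole_approx:
  assumes "n > 0"
  shows "grad (dipole_approx a n) z = profile n ((norm z)\<^sup>2) *\<^sub>R a + (2 * (a \<bullet> z) * profile' n ((norm z)\<^sup>2)) *\<^sub>R z"
proof -
  have "((\<lambda>z :: real^2. z \<bullet> z) has_derivative (\<lambda>h. 2 * (z \<bullet> h))) (at z)"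
    by (auto intro!: derivative_eq_intros simp: inner_commute)
  moreover have "(profile n has_derivative (*) (profile' n (z \<bullet> z))) (at (z \<bullet> z))"
    using profile_has_derivative[OF assms, of "z \<bullet> z"] by (simp add: has_field_derivative_def)
  ultimately have "((\<lambda>z. profile n (z \<bullet> z)) has_derivative (\<lambda>h. profile' n (z \<bullet> z) * (2 * (z \<bullet> h)))) (at z)"
    by (rule has_derivative_compose)
  then have "((\<lambda>z. (a \<bullet> z) * profile n (z \<bullet> z)) has_derivative
      (\<lambda>h. (a \<bullet> z) * (profile' n (z \<bullet> z) * (2 * (z \<bullet> h))) + (a \<bullet> h) * profile n (z \<bullet> z))) (at z)"
    by (intro has_derivative_mult has_derivative_inner_right has_derivative_ident)
  then have "partial i (\<lambda>z. (a \<bullet> z) * profile n (z \<bullet> z)) z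
    = (a \<bullet> z) * (profile' n (z \<bullet> z) * (2 * (z \<bullet> axis i 1))) + (a \<bullet> axis i 1) * profile n (z \<bullet> z)" for i
    by (rule partial_eqI)
  moreover have "dipole_approx a n = (\<lambda>z. (a \<bullet> z) * profile n (z \<bullet> z))"
    by (simp add: dipole_approx_def[abs_def] power2_norm_eq_inner)
  ultimately show ?thesis
    by (simp add: vec_eq_iff grad_def inner_axis power2_norm_eq_inner)
qed

lemma norm_grad_dipole_approx:
  assumes "n > 0"
  shows "norm (grad (dipole_approx a n) z) \<le> 58 * norm a / (1 + (norm z)\<^sup>2)"
proof -
  define s where "s = (norm z)\<^sup>2"
  have s: "0 \<le> s" by (simp add: s_def)
  note p = profile_bounds[OF assms s]
  have az: "\<bar>a \<bullet> z\<bar> * norm z \<le> norm a * s"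
    using mult_right_mono[OF Cauchy_Schwarz_ineq2[of a z], of "norm z"]
    by (simp add: s_def power2_eq_square mult.assoc)
  have "norm (grad (dipole_approx a n) z) \<le> norm (profile n s *\<^sub>R a) + norm ((2 * (a \<bullet> z) * profile' n s) *\<^sub>R z)"
    unfolding grad_dipole_approx[OF assms] s_def by (rule norm_triangle_ineq)
  also have "\<dots> = profile n s * norm a + 2 * \<bar>profile' n s\<bar> * (\<bar>a \<bullet> z\<bar> * norm z)"
    using p by (simp add: abs_mult)
  also have "\<dots> \<le> 2 / (1 + s) * norm a + 2 * (28 / (1 + s)\<^sup>2) * (norm a * s)"
    by (intro add_mono mult_right_mono[OF p(3)] mult_mono[OF mult_left_mono[OF p(4)] az]) auto
  also have "\<dots> \<le> 2 / (1 + s) * norm a + 56 / (1 + s) * norm a"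
  proof -
    have "s / (1 + s) \<le> 1" using s by simp
    then have "56 / (1 + s) * norm a * (s / (1 + s)) \<le> 56 / (1 + s) * norm a * 1"
      using s by (intro mult_left_mono) auto
    moreover have "2 * (28 / (1 + s)\<^sup>2) * (norm a * s) = 56 / (1 + s) * norm a * (s / (1 + s))"
      by (simp add: power2_eq_square)
    ultimately show ?thesis by linarith
  qed
  also have "\<dots> = 58 * norm a / (1 + s)" by (simp add: add_divide_distrib[symmetric] algebra_simps)
  finally show ?thesis by (simp add: s_def)
qed

lemma norm_sq_eq_one: "((norm z)\<^sup>2 = 1) = (norm z = 1)" "((norm z)\<^sup>2 < 1) = (norm z < 1)"
proof -
  have "norm z \<noteq> - 1" using norm_ge_zero[of z] by linarith
  then show "((norm z)\<^sup>2 = 1) = (norm z = 1)" by (simp add: power2_eq_1_iff)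
  show "((norm z)\<^sup>2 < 1) = (norm z < 1)" using abs_square_less_1[of "norm z"] by simp
qed

text \<open>The unit circle is excluded because the limiting profile \<open>min(1, 1/s)\<close> has a kink there.\<close>

lemma grad_dipole_approx_tendsto:
  assumes "norm z \<noteq> 1"
  shows "(\<lambda>n. grad (dipole_approx a n) z) \<longlonglongrightarrow> dipole a z"
proof -
  define s where "s = (norm z)\<^sup>2"
  have s: "0 \<le> s" "s \<noteq> 1" "s < 1 \<longleftrightarrow> norm z < 1" using assms by (auto simp: s_def norm_sq_eq_one)
  note p = profile_tendsto[OF s(1,2)]
  have "(\<lambda>n. profile n s *\<^sub>R a + (2 * (a \<bullet> z) * profile' n s) *\<^sub>R z) \<longlonglongrightarrow>
    (if s < 1 then 1 else 1 / s) *\<^sub>R a + (2 * (a \<bullet> z) * (if s < 1 then 0 else - 1 / s\<^sup>2)) *\<^sub>R z"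
    by (intro tendsto_intros p)
  also have "(if s < 1 then 1 else 1 / s) *\<^sub>R a + (2 * (a \<bullet> z) * (if s < 1 then 0 else - 1 / s\<^sup>2)) *\<^sub>R z = dipole a z"
    using s(3) by (simp add: dipole_def s_def[symmetric])
  finally have l: "(\<lambda>n. profile n s *\<^sub>R a + (2 * (a \<bullet> z) * profile' n s) *\<^sub>R z) \<longlonglongrightarrow> dipole a z" .
  show ?thesis
    by (rule Lim_transform_eventually[OF l], rule eventually_mono[OF eventually_gt_at_top[of 0]])
      (simp add: grad_dipole_approx s_def)
qed

lemma dipole_approx_tendsto:
  assumes "norm z \<noteq> 1"
  shows "(\<lambda>n. dipole_approx a n z) \<longlonglongrightarrow> dipole_pot a z"
proof -
  have "(norm z)\<^sup>2 \<noteq> 1" "(norm z)\<^sup>2 < 1 \<longleftrightarrow> norm z < 1" using assms by (auto simp: norm_sq_eq_one)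
  then show ?thesis
    using tendsto_mult[OF tendsto_const[of "a \<bullet> z"] profile_tendsto(1)[of "(norm z)\<^sup>2"]]
    by (simp add: dipole_approx_def dipole_pot_def)
qed

lemma norm_dipole_le: "norm (dipole a z) \<le> 6 * norm a / (1 + (norm z)\<^sup>2)"
proof (cases "norm z < 1")
  case True
  then have "(norm z)\<^sup>2 < 1" by (simp add: norm_sq_eq_one)
  then have "norm a * (1 + (norm z)\<^sup>2) \<le> norm a * 6" by (intro mult_left_mono) auto
  then show ?thesis using True by (simp add: dipole_def pos_le_divide_eq add_pos_nonneg mult.commute)
next
  case False
  define s where "s = (norm z)\<^sup>2"
  have s: "1 \<le> s" using False by (simp add: s_def)
  have az: "\<bar>a \<bullet> z\<bar> * norm z \<le> norm a * s"
    using mult_right_mono[OF Cauchy_Schwarz_ineq2[of a z], of "norm z"]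
    by (simp add: s_def power2_eq_square mult.assoc)
  have "norm (dipole a z) \<le> norm ((1 / s) *\<^sub>R a) + norm ((2 * (a \<bullet> z) / s\<^sup>2) *\<^sub>R z)"
    using False by (simp add: dipole_def s_def[symmetric] norm_triangle_ineq4 del: norm_scaleR)
  also have "\<dots> = norm a / s + 2 / s\<^sup>2 * (\<bar>a \<bullet> z\<bar> * norm z)"
    using s by (simp add: abs_mult)
  also have "\<dots> \<le> norm a / s + 2 / s\<^sup>2 * (norm a * s)"
    using az by (intro add_left_mono mult_left_mono) auto
  also have "\<dots> = 3 * norm a / s" using s by (simp add: field_simps power2_eq_square)
  also have "\<dots> \<le> 6 * norm a / (1 + s)"
    using s mult_left_mono[of 1 s "norm a"] by (simp add: field_simps)
  finally show ?thesis by (simp add: s_def)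
qed

lemma dipole_measurable [measurable]: "dipole a \<in> borel_measurable borel"
  unfolding dipole_def[abs_def] by measurable

lemma dipole_pot_measurable [measurable]: "dipole_pot a \<in> borel_measurable borel"
  unfolding dipole_pot_def[abs_def] by measurable

section \<open>The dipole field in the plane\<close>

lemma integrable_inverse_1_plus_sq: "integrable lborel (\<lambda>x :: real. 1 / (1 + x\<^sup>2))"
  using integrable_inverse_1_plus_square
  by (simp add: set_integrable_def einterval_def inverse_eq_divide)

text \<open>Each factor \<open>1 + (z \<bullet> b)^2\<close> is at most \<open>1 + |z|^2\<close>; as there are two coordinates, the integrand is
bounded by a product of functions of one variable.\<close>

lemma integrable_planar_decay: "integrable lborel (\<lambda>z :: real^2. (1 / (1 + (norm z)\<^sup>2))\<^sup>2)"
proof (rule integrableI_nonneg)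
  have pos: "0 < 1 + x\<^sup>2" for x :: real by (simp add: add_pos_nonneg)
  have "(\<integral>\<^sup>+z. ennreal ((1 / (1 + (norm z)\<^sup>2))\<^sup>2) \<partial>(lborel :: (real^2) measure))
      \<le> (\<integral>\<^sup>+z. (\<Prod>b\<in>Basis. ennreal (1 / (1 + (z \<bullet> b)\<^sup>2))) \<partial>(lborel :: (real^2) measure))"
  proof (rule nn_integral_mono)
    fix z :: "real^2"
    have "(1 / (1 + (norm z)\<^sup>2)) ^ card (Basis :: (real^2) set) = (\<Prod>b\<in>(Basis :: (real^2) set). 1 / (1 + (norm z)\<^sup>2))"
      by simp
    also have "\<dots> \<le> (\<Prod>b\<in>Basis. 1 / (1 + (z \<bullet> b)\<^sup>2))"
    proof (rule prod_mono, intro conjI)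
      fix b :: "real^2" assume "b \<in> Basis"
      then have "(z \<bullet> b)\<^sup>2 \<le> (norm z)\<^sup>2" using Basis_le_norm[of b z] by (metis abs_le_square_iff abs_norm_cancel)
      then show "1 / (1 + (norm z)\<^sup>2) \<le> 1 / (1 + (z \<bullet> b)\<^sup>2)" using pos[of "z \<bullet> b"] by (intro divide_left_mono) (auto intro!: mult_pos_pos pos)
    qed simp
    finally have "(1 / (1 + (norm z)\<^sup>2))\<^sup>2 \<le> (\<Prod>b\<in>Basis. 1 / (1 + (z \<bullet> b)\<^sup>2))" by simp
    then show "ennreal ((1 / (1 + (norm z)\<^sup>2))\<^sup>2) \<le> (\<Prod>b\<in>Basis. ennreal (1 / (1 + (z \<bullet> b)\<^sup>2)))"
      by (subst prod_ennreal) (auto intro: ennreal_leI)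
  qed
  also have "\<dots> = (\<Prod>b\<in>(Basis :: (real^2) set). \<integral>\<^sup>+x. ennreal (1 / (1 + x\<^sup>2)) \<partial>lborel)"
    by (rule nn_integral_lborel_prod) auto
  also have "\<dots> < \<infinity>"
  proof -
    have "(\<integral>\<^sup>+x. ennreal (1 / (1 + x\<^sup>2)) \<partial>lborel) < \<infinity>"
      using integrable_inverse_1_plus_sq by (subst nn_integral_eq_integral) auto
    then show ?thesis by (simp add: power_less_top_ennreal)
  qed
  finally show "(\<integral>\<^sup>+z. ennreal ((1 / (1 + (norm z)\<^sup>2))\<^sup>2) \<partial>(lborel :: (real^2) measure)) < \<infinity>" .
qed auto

lemma L2_UNIV_iff: "L2 UNIV f \<longleftrightarrow> f \<in> borel_measurable lborel \<and> integrable lborel (\<lambda>x. (norm (f x))\<^sup>2)"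
  by (simp add: L2_def set_borel_measurable_def set_integrable_def)

lemma L2_decay: "L2 UNIV (\<lambda>z :: real^2. 1 / (1 + (norm z)\<^sup>2))"
  using integrable_planar_decay by (simp add: L2_UNIV_iff)

lemma L2_dipole: "L2 UNIV (dipole a)"
proof (rule L2_bound[OF L2_decay, where C = "6 * norm a"])
  show "set_borel_measurable lborel UNIV (dipole a)" by (simp add: set_borel_measurable_def)
  show "AE x in lborel. x \<in> UNIV \<longrightarrow> norm (dipole a x) \<le> 6 * norm a * norm (1 / (1 + (norm x)\<^sup>2))"
    using norm_dipole_le[of a] by (auto simp: abs_of_nonneg)
qed

lemma AE_norm_neq_1: "AE z in lborel. norm (z :: real^2) \<noteq> 1"
proof -
  have "negligible (sphere (0::real^2) 1)" by (rule negligible_sphere)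
  then have "sphere (0::real^2) 1 \<in> null_sets lborel"
    by (simp add: negligible_iff_null_sets null_sets_completion_iff)
  from AE_not_in[OF this] show ?thesis by simp
qed

lemma grad_test_fun_measurable: "\<phi> \<in> test_fun \<Omega> \<Longrightarrow> grad \<phi> \<in> borel_measurable borel"
  unfolding grad_def
  by (intro borel_measurable_continuous_onI continuous_on_vec_lambda test_fun_continuous partial_test_fun)

lemma dipole_approx_test_fun_UNIV: "n > 0 \<Longrightarrow> dipole_approx a n \<in> test_fun UNIV"
  by (rule dipole_approx_test_fun) auto

text \<open>By dominated convergence the dipole field is a limit of gradients of test functions. Through this
limit it inherits the orthogonality relations of such gradients, and its rescaled
copies become competitors in the energy estimate.\<close>

lemma L2_grad_dipole_approx_tendsto:
  "(\<lambda>n. LINT z|lborel. (norm (grad (dipole_approx a (Suc n)) z - dipole a z))\<^sup>2) \<longlonglongrightarrow> 0"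
proof -
  have [measurable]: "grad (dipole_approx a (Suc n)) \<in> borel_measurable borel" for n
    by (rule grad_test_fun_measurable[OF dipole_approx_test_fun_UNIV]) simp
  have "(\<lambda>n. LINT z|lborel. (norm (grad (dipole_approx a (Suc n)) z - dipole a z))\<^sup>2) \<longlonglongrightarrow> (LINT z|(lborel :: (real^2) measure). 0)"
  proof (rule integral_dominated_convergence[where w = "\<lambda>z. (64 * norm a)\<^sup>2 * (1 / (1 + (norm z)\<^sup>2))\<^sup>2"])
    show "AE z in lborel. (\<lambda>n. (norm (grad (dipole_approx a (Suc n)) z - dipole a z))\<^sup>2) \<longlonglongrightarrow> 0"
      using AE_norm_neq_1
    proof eventually_elim
      case (elim z)
      have "(\<lambda>n. (norm (grad (dipole_approx a (Suc n)) z - dipole a z))\<^sup>2) \<longlonglongrightarrow> (norm (dipole a z - dipole a z))\<^sup>2"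
        by (intro tendsto_intros LIMSEQ_Suc[OF grad_dipole_approx_tendsto[OF elim]])
      then show ?case by simp
    qed
    show "AE z in lborel. norm ((norm (grad (dipole_approx a (Suc n)) z - dipole a z))\<^sup>2)
        \<le> (64 * norm a)\<^sup>2 * (1 / (1 + (norm z)\<^sup>2))\<^sup>2" for n
    proof (rule AE_I2)
      fix z
      have "norm (grad (dipole_approx a (Suc n)) z - dipole a z) \<le> 58 * norm a / (1 + (norm z)\<^sup>2) + 6 * norm a / (1 + (norm z)\<^sup>2)"
        by (intro order_trans[OF norm_triangle_ineq4] add_mono norm_grad_dipole_approx norm_dipole_le) simp
      also have "\<dots> = 64 * norm a * (1 / (1 + (norm z)\<^sup>2))"
        by (simp add: add_divide_distrib[symmetric])
      finally have "(norm (grad (dipole_approx a (Suc n)) z - dipole a z))\<^sup>2 \<le> (64 * norm a * (1 / (1 + (norm z)\<^sup>2)))\<^sup>2"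
        by (intro power_mono) auto
      also have "\<dots> = (64 * norm a)\<^sup>2 * (1 / (1 + (norm z)\<^sup>2))\<^sup>2" by (rule power_mult_distrib)
      finally show "norm ((norm (grad (dipole_approx a (Suc n)) z - dipole a z))\<^sup>2)
        \<le> (64 * norm a)\<^sup>2 * (1 / (1 + (norm z)\<^sup>2))\<^sup>2" by simp
    qed
    show "integrable lborel (\<lambda>z::real^2. (64 * norm a)\<^sup>2 * (1 / (1 + (norm z)\<^sup>2))\<^sup>2)"
      by (rule integrable_mult_right[OF integrable_planar_decay])
  qed measurable
  then show ?thesis by simp
qed

lemma abs_dipole_approx_le:
  assumes "n > 0"
  shows "\<bar>dipole_approx a n z\<bar> \<le> norm a"
proof -
  define s where "s = (norm z)\<^sup>2"
  have p: "0 \<le> profile n s" "profile n s \<le> 2 / (1 + s)" using profile_bounds[OF assms, of s] by (auto simp: s_def)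
  have "0 \<le> (1 - norm z)\<^sup>2" by simp
  then have t: "2 * norm z \<le> 1 + s" by (simp add: s_def power2_diff)
  have s1: "0 < 1 + s" by (simp add: s_def add_pos_nonneg)
  have "\<bar>dipole_approx a n z\<bar> = \<bar>a \<bullet> z\<bar> * profile n s" using p by (simp add: dipole_approx_def s_def abs_mult)
  also have "\<dots> \<le> (norm a * norm z) * (2 / (1 + s))"
    by (intro mult_mono Cauchy_Schwarz_ineq2 p) auto
  also have "\<dots> = norm a * (2 * norm z / (1 + s))" by simp
  also have "\<dots> \<le> norm a * 1" using t s1 by (intro mult_left_mono) (auto simp: divide_le_eq)
  finally show ?thesis by simp
qed

lemma abs_dipole_pot_le: "\<bar>dipole_pot a z\<bar> \<le> norm a"
proof (cases "norm z < 1")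
  case True
  then show ?thesis
    using Cauchy_Schwarz_ineq2[of a z] mult_left_mono[of "norm z" 1 "norm a"] by (simp add: dipole_pot_def)
next
  case False
  then have z: "1 \<le> norm z" by simp
  have "\<bar>dipole_pot a z\<bar> = \<bar>a \<bullet> z\<bar> / (norm z)\<^sup>2" using False by (simp add: dipole_pot_def abs_mult)
  also have "\<dots> \<le> (norm a * norm z) / (norm z)\<^sup>2" by (intro divide_right_mono Cauchy_Schwarz_ineq2) simp
  also have "\<dots> = norm a * (1 / norm z)" using z by (simp add: power2_eq_square)
  also have "\<dots> \<le> norm a * 1" using z by (intro mult_left_mono) (auto simp: divide_le_eq)
  finally show ?thesis by simp
qed

lemma bounded_loc_integrable:
  fixes f :: "real^2 \<Rightarrow> 'b::euclidean_space"
  assumes [measurable]: "f \<in> borel_measurable borel" and B: "\<And>x. norm (f x) \<le> B"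
  shows "loc_integrable \<Omega> f"
  unfolding loc_integrable_def
proof (intro allI impI)
  fix C :: "(real^2) set" assume "compact C \<and> C \<subseteq> \<Omega>"
  then have C: "compact C" by simp
  then have [measurable]: "C \<in> sets borel" by (simp add: borel_compact)
  have "integrable lborel (\<lambda>x. indicator C x *\<^sub>R B)"
    by (rule borel_integrable_compact[OF C]) auto
  then have "set_integrable lborel C (\<lambda>x. B)" by (simp add: set_integrable_def)
  then show "set_integrable lborel C f"
    by (rule set_integrable_bound) (use B in \<open>auto simp: set_borel_measurable_def intro!: order_trans[OF B]\<close>)
qed

lemma integral_bounded_mult_compact_tendsto:
  fixes f :: "nat \<Rightarrow> real^2 \<Rightarrow> real"
  assumes [measurable]: "\<And>n. f n \<in> borel_measurable borel" "g \<in> borel_measurable borel" "h \<in> borel_measurable borel"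
    and B: "\<And>n x. \<bar>f n x\<bar> \<le> B" and lim: "AE x in lborel. (\<lambda>n. f n x) \<longlonglongrightarrow> g x"
    and h: "integrable lborel h"
  shows "(\<lambda>n. LINT x|lborel. f n x * h x) \<longlonglongrightarrow> (LINT x|lborel. g x * h x)"
proof (rule integral_dominated_convergence[where w = "\<lambda>x. B * \<bar>h x\<bar>"])
  show "integrable lborel (\<lambda>x. B * \<bar>h x\<bar>)" using h by simp
  show "AE x in lborel. (\<lambda>n. f n x * h x) \<longlonglongrightarrow> g x * h x"
    using lim by eventually_elim (intro tendsto_intros)
  show "AE x in lborel. norm (f n x * h x) \<le> B * \<bar>h x\<bar>" for n
    using B by (auto simp: abs_mult intro!: mult_right_mono)
qed measurable

lemma test_fun_integrable:
  assumes "\<phi> \<in> test_fun \<Omega>"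
  shows "integrable lborel \<phi>"
proof -
  obtain K where K: "compact K" "\<And>x. x \<notin> K \<Longrightarrow> \<phi> x = 0"
    using test_fun_support[OF assms] by blast
  have "integrable lborel (\<lambda>x. indicator K x *\<^sub>R \<phi> x)"
    by (rule borel_integrable_compact[OF K(1) test_fun_continuous[OF assms]])
  also have "(\<lambda>x. indicator K x *\<^sub>R \<phi> x) = \<phi>" using K(2) by (auto simp: indicator_def fun_eq_iff)
  finally show ?thesis .
qed

text \<open>The integration by parts formula passes to the limit along the smooth approximations.\<close>

lemma dipole_pot_has_weak_gradient: "has_weak_gradient UNIV (dipole_pot a) (dipole a)"
  unfolding has_weak_gradient_def
proof (intro conjI ballI allI)
  have db: "norm (dipole a z) \<le> 6 * norm a" for z
  proof -
    have "6 * norm a / (1 + (norm z)\<^sup>2) \<le> 6 * norm a / 1"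
      by (intro divide_left_mono) (auto simp: add_pos_nonneg)
    then show ?thesis using norm_dipole_le[of a z] by simp
  qed
  show "loc_integrable UNIV (dipole_pot a)"
    by (rule bounded_loc_integrable[OF dipole_pot_measurable, of _ "norm a"]) (simp add: abs_dipole_pot_le)
  show "loc_integrable UNIV (dipole a)"
    by (rule bounded_loc_integrable[OF dipole_measurable db])
  fix \<phi> i assume \<phi>: "\<phi> \<in> test_fun UNIV"
  have [measurable]: "\<phi> \<in> borel_measurable borel" "partial i \<phi> \<in> borel_measurable borel"
    by (rule test_fun_measurable[OF \<phi>], rule test_fun_measurable[OF partial_test_fun[OF \<phi>]])
  have T: "dipole_approx a (Suc n) \<in> test_fun UNIV" for n by (rule dipole_approx_test_fun_UNIV) simp
  have [measurable]: "dipole_approx a (Suc n) \<in> borel_measurable borel" "grad (dipole_approx a (Suc n)) \<in> borel_measurable borel" for n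
    by (rule test_fun_measurable[OF T], rule grad_test_fun_measurable[OF T])
  have [measurable]: "(\<lambda>x :: real^2. x $ i) \<in> borel_measurable borel" by (rule borel_measurable_nth)
  have gb: "\<bar>grad (dipole_approx a (Suc n)) z $ i\<bar> \<le> 58 * norm a" for n z
  proof -
    have "58 * norm a / (1 + (norm z)\<^sup>2) \<le> 58 * norm a / 1"
      by (intro divide_left_mono) (auto simp: add_pos_nonneg)
    then show ?thesis
      using norm_grad_dipole_approx[of "Suc n" a z] component_le_norm_cart[of "grad (dipole_approx a (Suc n)) z" i] by simp
  qed
  have l1: "(\<lambda>n. LINT x|lborel. dipole_approx a (Suc n) x * partial i \<phi> x) \<longlonglongrightarrow> (LINT x|lborel. dipole_pot a x * partial i \<phi> x)"
    using AE_norm_neq_1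
    by (intro integral_bounded_mult_compact_tendsto[where B = "norm a"] test_fun_integrable[OF partial_test_fun[OF \<phi>]])
      (auto intro!: abs_dipole_approx_le LIMSEQ_Suc[OF dipole_approx_tendsto])
  have l2: "(\<lambda>n. LINT x|lborel. grad (dipole_approx a (Suc n)) x $ i * \<phi> x) \<longlonglongrightarrow> (LINT x|lborel. dipole a x $ i * \<phi> x)"
    using AE_norm_neq_1
    by (intro integral_bounded_mult_compact_tendsto[where B = "58 * norm a"] test_fun_integrable[OF \<phi>])
      (auto intro!: gb tendsto_vec_nth LIMSEQ_Suc[OF grad_dipole_approx_tendsto])
  have eq: "(LINT x|lborel. dipole_approx a (Suc n) x * partial i \<phi> x) = - (LINT x|lborel. grad (dipole_approx a (Suc n)) x $ i * \<phi> x)" for n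
    using test_fun_has_weak_gradient[OF T open_UNIV] \<phi> by (simp add: has_weak_gradient_def set_lebesgue_integral_def)
  have "(LINT x|lborel. dipole_pot a x * partial i \<phi> x) = - (LINT x|lborel. dipole a x $ i * \<phi> x)"
    by (rule LIMSEQ_unique[OF l1[unfolded eq] tendsto_minus[OF l2]])
  then show "(LINT x:UNIV|lborel. dipole_pot a x * partial i \<phi> x) = - (LINT x:UNIV|lborel. dipole a x $ i * \<phi> x)"
    by (simp add: set_lebesgue_integral_def)
qed

text \<open>The potential decays like \<open>1 / |z|\<close>, one power better than the weight requires.\<close>

lemma dipole_pot_Hw: "dipole_pot a \<in> Hw"
proof -
  have pos: "0 < 1 + (norm x)\<^sup>2" for x :: "real^2" by (simp add: add_pos_nonneg)
  have pot: "\<bar>dipole_pot a x\<bar> \<le> 2 * norm a / sqrt (1 + (norm x)\<^sup>2)" for x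
  proof (cases "norm x < 1")
    case True
    have "sqrt (1 + (norm x)\<^sup>2) \<le> sqrt 4"
      using True norm_sq_eq_one(2)[of x] by (intro real_sqrt_le_mono) simp
    then have "\<bar>dipole_pot a x\<bar> * sqrt (1 + (norm x)\<^sup>2) \<le> norm a * 2"
      using abs_dipole_pot_le[of a x] pos[of x] by (intro mult_mono) auto
    then show ?thesis using pos[of x] by (simp add: pos_le_divide_eq mult.commute)
  next
    case False
    then have x: "1 \<le> norm x" by simp
    have "1 + (norm x)\<^sup>2 \<le> (2 * norm x)\<^sup>2"
    proof -
      have "1 \<le> (norm x)\<^sup>2" using x by simp
      moreover have "(2 * norm x)\<^sup>2 = 4 * (norm x)\<^sup>2" by (simp add: power_mult_distrib)
      ultimately show ?thesis by linarith
    qed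
    then have sq: "sqrt (1 + (norm x)\<^sup>2) \<le> 2 * norm x"
      by (intro real_le_lsqrt) auto
    have "\<bar>dipole_pot a x\<bar> = \<bar>a \<bullet> x\<bar> / (norm x)\<^sup>2" using False by (simp add: dipole_pot_def abs_mult)
    also have "\<dots> \<le> (norm a * norm x) / (norm x)\<^sup>2" by (intro divide_right_mono Cauchy_Schwarz_ineq2) simp
    also have "\<dots> = norm a / norm x" using x by (simp add: power2_eq_square)
    finally have "\<bar>dipole_pot a x\<bar> * sqrt (1 + (norm x)\<^sup>2) \<le> (norm a / norm x) * (2 * norm x)"
      using sq pos[of x] by (intro mult_mono) auto
    also have "\<dots> = 2 * norm a" using x by auto
    finally show ?thesis using pos[of x] by (simp add: pos_le_divide_eq)
  qed
  have "L2 UNIV (\<lambda>x. weight x * dipole_pot a x)"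
  proof (rule L2_bound[OF L2_decay, where C = "2 * norm a / ln 2"])
    have [measurable]: "weight \<in> borel_measurable borel" unfolding weight_def[abs_def] by measurable
    show "set_borel_measurable lborel UNIV (\<lambda>x. weight x * dipole_pot a x)"
      by (simp add: set_borel_measurable_def)
    show "AE x in lborel. x \<in> UNIV \<longrightarrow> norm (weight x * dipole_pot a x) \<le> 2 * norm a / ln 2 * norm (1 / (1 + (norm x)\<^sup>2))"
    proof (rule AE_I2, rule impI)
      fix x :: "real^2"
      have l: "ln 2 \<le> ln (2 + norm x)" by (intro ln_mono) auto
      have l2: "0 < ln (2::real)" by simp
      define q where "q = sqrt (1 + (norm x)\<^sup>2)"
      have q: "0 < q" "q * q = 1 + (norm x)\<^sup>2" using pos[of x] by (auto simp: q_def)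
      have "q * ln 2 \<le> q * ln (2 + norm x)" using l q by (intro mult_left_mono) auto
      then have w: "0 \<le> weight x" "weight x \<le> 1 / (q * ln 2)"
        unfolding weight_def q_def[symmetric] using l2 q less_le_trans[OF l2 l]
        by (auto intro!: divide_left_mono mult_pos_pos mult_nonneg_nonneg)
      have "norm (weight x * dipole_pot a x) = weight x * \<bar>dipole_pot a x\<bar>" using w by (simp add: abs_mult)
      also have "\<dots> \<le> 1 / (q * ln 2) * (2 * norm a / q)"
        unfolding q_def by (rule mult_mono[OF w(2)[unfolded q_def] pot]) (use q l2 in \<open>auto simp: q_def\<close>)
      also have "\<dots> = 2 * norm a / ln 2 * (1 / (q * q))" by simp
      finally show "norm (weight x * dipole_pot a x) \<le> 2 * norm a / ln 2 * norm (1 / (1 + (norm x)\<^sup>2))"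
        using pos[of x] q by simp
    qed
  qed
  then show ?thesis using dipole_pot_has_weak_gradient L2_dipole by (auto simp: Hw_def)
qed

section \<open>Orthogonality of the dipole flux to gradients\<close>

text \<open>The rotation by a right angle that turns gradients into divergence free fields.\<close>

definition quarter :: "real^2 \<Rightarrow> real^2" where
  "quarter v = vector [v $ 2, - v $ 1]"

text \<open>The normal component of this field is continuous across the unit circle, whereas that of
\<open>dipole a\<close> changes its sign there.\<close>

definition flux :: "real^2 \<Rightarrow> real^2 \<Rightarrow> real^2" where
  "flux a z = (if norm z < 1 then - a else dipole a z)"

lemma quarter_nth [simp]: "quarter v $ 1 = v $ 2" "quarter v $ 2 = - v $ 1"
  by (simp_all add: quarter_def)

lemma inner_2: "(x :: real^2) \<bullet> y = x $ 1 * y $ 1 + x $ 2 * y $ 2"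
  by (simp add: inner_vec_def sum_2)

lemma linear_quarter: "linear quarter"
  by (rule linearI) (auto simp: vec_eq_iff forall_2)

lemma norm_quarter: "norm (quarter v) = norm v"
  by (simp add: norm_eq_sqrt_inner inner_2 add.commute)

text \<open>Outside the disc this expresses that the conjugate of a planar dipole is a dipole in
the perpendicular direction; it follows from decomposing \<open>a\<close> along \<open>z\<close> and its quarter turn.\<close>

lemma flux_eq_quarter_dipole: "flux a z = quarter (dipole (quarter a) z)"
proof (cases "norm z < 1")
  case True
  then show ?thesis by (simp add: flux_def dipole_def vec_eq_iff forall_2)
next
  case False
  define s where "s = (norm z)\<^sup>2"
  have s: "s = z $ 1 * z $ 1 + z $ 2 * z $ 2"
    by (simp add: s_def power2_norm_eq_inner inner_2)
  have "s \<noteq> 0" using False by (auto simp: s_def)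
  \<comment> \<open>One coordinate of the identity; the other one is obtained by exchanging the coordinates.\<close>
  have e1: "p / s - 2 * (p * x + q * y) / s\<^sup>2 * x = - p / s - 2 * (q * x - p * y) / s\<^sup>2 * y"
    if "s = x * x + y * y" for p q x y :: real
  proof -
    have "p * s - 2 * (p * x + q * y) * x = - p * s - 2 * (q * x - p * y) * y"
      unfolding that by (simp add: algebra_simps)
    moreover have "p / s - 2 * (p * x + q * y) / s\<^sup>2 * x = (p * s - 2 * (p * x + q * y) * x) / s\<^sup>2"
      "- p / s - 2 * (q * x - p * y) / s\<^sup>2 * y = (- p * s - 2 * (q * x - p * y) * y) / s\<^sup>2"
      using \<open>s \<noteq> 0\<close> by (simp_all add: field_simps power2_eq_square)
    ultimately show ?thesis by simp
  qed
  have "flux a z = (1 / s) *\<^sub>R a - (2 * (a \<bullet> z) / s\<^sup>2) *\<^sub>R z"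
    using False by (simp add: flux_def dipole_def s_def)
  moreover have "quarter (dipole (quarter a) z) = (1 / s) *\<^sub>R quarter (quarter a) - (2 * (quarter a \<bullet> z) / s\<^sup>2) *\<^sub>R quarter z"
    using False linear_quarter by (simp add: dipole_def s_def linear_diff linear_scale)
  moreover have "((1 / s) *\<^sub>R a - (2 * (a \<bullet> z) / s\<^sup>2) *\<^sub>R z) $ 1
      = ((1 / s) *\<^sub>R quarter (quarter a) - (2 * (quarter a \<bullet> z) / s\<^sup>2) *\<^sub>R quarter z) $ 1"
    using e1[OF s, of "a $ 1" "a $ 2"] by (simp add: inner_2)
  moreover have "((1 / s) *\<^sub>R a - (2 * (a \<bullet> z) / s\<^sup>2) *\<^sub>R z) $ 2
      = ((1 / s) *\<^sub>R quarter (quarter a) - (2 * (quarter a \<bullet> z) / s\<^sup>2) *\<^sub>R quarter z) $ 2"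
    using e1[of "z $ 2" "z $ 1" "a $ 2" "a $ 1"] s by (simp add: inner_2 algebra_simps)
  ultimately show ?thesis by (simp only: vec_eq_iff forall_2)
qed

text \<open>Coordinates in which a disc with centre \<open>c\<close> and radius \<open>e\<close> is the unit disc.\<close>

definition zoom :: "real^2 \<Rightarrow> real \<Rightarrow> real^2 \<Rightarrow> real^2" where
  "zoom c e x = (1 / e) *\<^sub>R (x - c)"

lemma zoom_measurable [measurable]: "zoom c e \<in> borel_measurable borel"
  unfolding zoom_def[abs_def] by measurable

lemma norm_zoom_less: "e > 0 \<Longrightarrow> norm (zoom c e x) < r \<longleftrightarrow> dist c x < r * e"
  by (simp add: zoom_def dist_norm norm_minus_commute divide_less_eq)

lemma norm_zoom_le: "e > 0 \<Longrightarrow> norm (zoom c e x) \<le> r \<longleftrightarrow> dist c x \<le> r * e"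
  by (simp add: zoom_def dist_norm norm_minus_commute divide_le_eq)

lemma lborel_zoom:
  assumes "e > 0"
  shows "lborel = density (distr lborel borel (zoom c e)) (\<lambda>_. ennreal ((1 / e)\<^sup>2))"
proof -
  have "lborel = density (distr lborel borel (\<lambda>x. - (1 / e) *\<^sub>R c + (1 / e) *\<^sub>R x)) (\<lambda>_. ennreal (\<bar>1 / e\<bar> ^ DIM(real^2)))"
    using lborel_affine[of "1 / e" "- (1 / e) *\<^sub>R c"] assms by simp
  also have "(\<lambda>x. - (1 / e) *\<^sub>R c + (1 / e) *\<^sub>R x) = zoom c e"
    by (simp add: zoom_def[abs_def] algebra_simps fun_eq_iff)
  finally show ?thesis using assms by simp
qed

lemma integral_zoom:
  fixes f :: "real^2 \<Rightarrow> real"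
  assumes "e > 0" and [measurable]: "f \<in> borel_measurable borel"
  shows "(LINT x|lborel. f (zoom c e x)) = e\<^sup>2 * (LINT z|lborel. f z)"
proof -
  have "(LINT z|lborel. f z) = (LINT z|density (distr lborel borel (zoom c e)) (\<lambda>_. ennreal ((1 / e)\<^sup>2)). f z)"
    by (subst lborel_zoom[OF assms(1), of c]) simp
  also have "\<dots> = (1 / e)\<^sup>2 * (LINT x|lborel. f (zoom c e x))"
    by (subst integral_density) (auto simp: integral_distr)
  finally show ?thesis using assms(1) by (simp add: power_divide)
qed

lemma integrable_zoom:
  fixes f :: "real^2 \<Rightarrow> real"
  assumes "e > 0" and f: "integrable lborel f"
  shows "integrable lborel (\<lambda>x. f (zoom c e x))"
proof -
  have [measurable]: "f \<in> borel_measurable borel" using f by auto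
  have "integrable (density (distr lborel borel (zoom c e)) (\<lambda>_. ennreal ((1 / e)\<^sup>2))) f"
    using f by (subst lborel_zoom[OF assms(1), of c, symmetric])
  then have "integrable lborel (\<lambda>x. (1 / e)\<^sup>2 * f (zoom c e x))"
    by (subst (asm) integrable_density) (auto simp: integrable_distr_eq)
  then have "integrable lborel (\<lambda>x. e\<^sup>2 * ((1 / e)\<^sup>2 * f (zoom c e x)))" by (rule integrable_mult_right)
  then show ?thesis using assms(1) by (simp add: power_divide)
qed

lemma L2_zoom:
  fixes f :: "real^2 \<Rightarrow> real^2"
  assumes "e > 0" "L2 UNIV f"
  shows "L2 UNIV (\<lambda>x. f (zoom c e x))"
proof -
  have [measurable]: "f \<in> borel_measurable borel" using assms(2) by (simp add: L2_UNIV_iff)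
  have "(\<lambda>x. f (zoom c e x)) \<in> borel_measurable borel" by measurable
  then show ?thesis
    using assms integrable_zoom[OF assms(1), of "\<lambda>x. (norm (f x))\<^sup>2" c] by (simp add: L2_UNIV_iff)
qed

lemma elementary_zoom: "f \<in> elementary \<Longrightarrow> (\<lambda>x. f (zoom c e x)) \<in> elementary"
proof (induction rule: elementary.induct)
  case (coord i)
  have "(\<lambda>x. zoom c e x $ i) = (\<lambda>x. (1 / e) * (x $ i - c $ i))" by (simp add: zoom_def)
  also have "\<dots> \<in> elementary" by (intro elementary.intros elementary_diff)
  finally show ?case .
qed (auto intro: elementary.intros)

text \<open>The factor \<open>e\<close> makes the gradient the rescaled gradient, without a power of \<open>e\<close>.\<close>

definition scaled_approx :: "real^2 \<Rightarrow> nat \<Rightarrow> real^2 \<Rightarrow> real \<Rightarrow> real^2 \<Rightarrow> real" where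
  "scaled_approx a n c e x = e * dipole_approx a n (zoom c e x)"

lemma scaled_approx_elementary: "scaled_approx a n c e \<in> elementary"
  unfolding scaled_approx_def[abs_def] by (intro elementary.intros elementary_zoom dipole_approx_elementary)

lemma scaled_approx_test_fun:
  assumes "n > 0" "e > 0" "cball c (sqrt (real n) * e) \<subseteq> \<Omega>"
  shows "scaled_approx a n c e \<in> test_fun \<Omega>"
proof -
  have "{x. scaled_approx a n c e x \<noteq> 0} \<subseteq> cball c (sqrt (real n) * e)"
  proof
    fix x assume "x \<in> {x. scaled_approx a n c e x \<noteq> 0}"
    then have "dipole_approx a n (zoom c e x) \<noteq> 0" by (auto simp: scaled_approx_def)
    then have "zoom c e x \<in> cball 0 (sqrt (real n))"
      using dipole_approx_support[OF assms(1), of a] closure_subset[of "{z. dipole_approx a n z \<noteq> 0}"] by blast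
    then show "x \<in> cball c (sqrt (real n) * e)" using norm_zoom_le[OF assms(2)] by simp
  qed
  then have s: "closure {x. scaled_approx a n c e x \<noteq> 0} \<subseteq> cball c (sqrt (real n) * e)"
    by (rule closure_minimal) auto
  then have "compact (closure {x. scaled_approx a n c e x \<noteq> 0})"
    using compact_Int_closed[OF compact_cball closed_closure] by (metis Int_absorb1)
  then show ?thesis using s assms(3) elementary_smooth[OF scaled_approx_elementary] by (auto simp: test_fun_def)
qed

lemma grad_scaled_approx:
  assumes "e > 0"
  shows "grad (scaled_approx a n c e) x = grad (dipole_approx a n) (zoom c e x)"
proof -
  have "(zoom c e has_derivative (\<lambda>h. (1 / e) *\<^sub>R h)) (at x)"
    unfolding zoom_def[abs_def] by (auto intro!: derivative_eq_intros)
  from has_derivative_compose[OF this has_derivative_partial[OF elementary_differentiable[OF dipole_approx_elementary]]]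
  have "((\<lambda>x. dipole_approx a n (zoom c e x)) has_derivative (\<lambda>h. grad (dipole_approx a n) (zoom c e x) \<bullet> ((1 / e) *\<^sub>R h))) (at x)" .
  from has_derivative_mult_right[OF this, of e]
  have "partial i (scaled_approx a n c e) x = e * (grad (dipole_approx a n) (zoom c e x) \<bullet> ((1 / e) *\<^sub>R axis i 1))" for i
    unfolding scaled_approx_def[abs_def] by (rule partial_eqI)
  then show ?thesis using assms by (simp add: vec_eq_iff grad_def inner_axis)
qed

lemma integral_grad_scaled_approx:
  assumes "e > 0"
  shows "(LINT x|lborel. (norm (grad (scaled_approx a (Suc n) c e) x - dipole a (zoom c e x)))\<^sup>2)
    = e\<^sup>2 * (LINT z|lborel. (norm (grad (dipole_approx a (Suc n)) z - dipole a z))\<^sup>2)"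
proof -
  have [measurable]: "grad (dipole_approx a (Suc n)) \<in> borel_measurable borel"
    by (rule grad_test_fun_measurable[OF dipole_approx_test_fun_UNIV]) simp
  show ?thesis unfolding grad_scaled_approx[OF assms]
    by (rule integral_zoom[OF assms, of "\<lambda>z. (norm (grad (dipole_approx a (Suc n)) z - dipole a z))\<^sup>2"]) measurable
qed

lemma test_fun_L2: "\<phi> \<in> test_fun \<Omega> \<Longrightarrow> L2 UNIV \<phi>"
proof -
  assume \<phi>: "\<phi> \<in> test_fun \<Omega>"
  obtain K where K: "compact K" "\<And>x. x \<notin> K \<Longrightarrow> \<phi> x = 0"
    using test_fun_support[OF \<phi>] by blast
  have "integrable lborel (\<lambda>x. indicator K x *\<^sub>R (norm (\<phi> x))\<^sup>2)"
    by (rule borel_integrable_compact[OF K(1)]) (intro continuous_intros test_fun_continuous[OF \<phi>])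
  also have "(\<lambda>x. indicator K x *\<^sub>R (norm (\<phi> x))\<^sup>2) = (\<lambda>x. (norm (\<phi> x))\<^sup>2)"
    using K(2) by (auto simp: indicator_def fun_eq_iff)
  finally show ?thesis using test_fun_measurable[OF \<phi>] by (simp add: L2_UNIV_iff)
qed

lemma test_fun_grad_L2: "\<phi> \<in> test_fun \<Omega> \<Longrightarrow> L2 UNIV (grad \<phi>)"
proof -
  assume \<phi>: "\<phi> \<in> test_fun \<Omega>"
  have "integrable lborel (\<lambda>x. (norm (partial i \<phi> x))\<^sup>2)" for i
    using test_fun_L2[OF partial_test_fun[OF \<phi>, of i]] by (simp add: L2_UNIV_iff)
  then have "integrable lborel (\<lambda>x. \<Sum>i\<in>UNIV. (partial i \<phi> x)\<^sup>2)" by simp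
  moreover have "(\<Sum>i\<in>UNIV. (partial i \<phi> x)\<^sup>2) = (norm (grad \<phi> x))\<^sup>2" for x
    unfolding power2_norm_eq_inner by (simp add: inner_vec_def grad_def power2_eq_square)
  ultimately show ?thesis using grad_test_fun_measurable[OF \<phi>] by (simp add: L2_UNIV_iff)
qed

text \<open>The weak gradient \<open>g\<close> of \<open>\<eta>\<close> is tested with the two partial derivatives of \<open>\<psi>\<close>; the mixed second
derivatives cancel.\<close>

lemma curl_grad_orthogonal:
  assumes \<psi>: "\<psi> \<in> test_fun UNIV" "\<psi> \<in> elementary" and \<eta>: "has_weak_gradient UNIV \<eta> g"
  shows "(LINT x:UNIV|lborel. quarter (grad \<psi> x) \<bullet> g x) = 0"
proof -
  have gi: "loc_integrable UNIV (\<lambda>x. g x $ i)" for i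
    using \<eta> by (auto simp: has_weak_gradient_def intro: loc_integrable_nth)
  have int: "set_integrable lborel UNIV (\<lambda>x. g x $ i * partial j \<psi> x)" for i j
    by (rule loc_integrable_mult_test[OF gi partial_test_fun[OF \<psi>(1)]])
  have eq: "(LINT x:UNIV|lborel. g x $ i * partial j \<psi> x) = - (LINT x:UNIV|lborel. \<eta> x * partial i (partial j \<psi>) x)" for i j
    using \<eta> partial_test_fun[OF \<psi>(1), of j] by (simp add: has_weak_gradient_def)
  have "(LINT x:UNIV|lborel. quarter (grad \<psi> x) \<bullet> g x)
    = (LINT x:UNIV|lborel. g x $ 1 * partial 2 \<psi> x - g x $ 2 * partial 1 \<psi> x)"
    by (simp add: inner_2 grad_def mult.commute)
  also have "\<dots> = 0"
    using int by (subst set_integral_diff) (auto simp: eq elementary_partial_commute[OF \<psi>(2), of 1 2])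
  finally show ?thesis .
qed

lemma flux_zoom_L2: "e > 0 \<Longrightarrow> L2 UNIV (\<lambda>x. flux a (zoom c e x))"
  unfolding flux_eq_quarter_dipole by (rule L2_linear[OF L2_zoom[OF _ L2_dipole] linear_quarter])

text \<open>The flux is a limit of quarter turns of gradients of test functions.\<close>

lemma flux_orthogonal:
  assumes \<eta>: "has_weak_gradient UNIV \<eta> g" and g: "L2 UNIV g" and e: "e > 0"
  shows "(LINT x:UNIV|lborel. flux a (zoom c e x) \<bullet> g x) = 0"
proof -
  let ?b = "quarter a"
  let ?f = "\<lambda>n x. quarter (grad (scaled_approx ?b (Suc n) c e) x)"
  have T: "scaled_approx ?b (Suc n) c e \<in> test_fun UNIV" for n by (rule scaled_approx_test_fun) (use e in auto)
  have "(\<lambda>n. LINT x:UNIV|lborel. ?f n x \<bullet> g x) \<longlonglongrightarrow> (LINT x:UNIV|lborel. flux a (zoom c e x) \<bullet> g x)"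
  proof (rule L2_limit_inner[OF _ flux_zoom_L2[OF e] g])
    show "L2 UNIV (?f n)" for n by (rule L2_linear[OF test_fun_grad_L2[OF T] linear_quarter])
    have "norm (?f n x - flux a (zoom c e x)) = norm (grad (scaled_approx ?b (Suc n) c e) x - dipole ?b (zoom c e x))" for n x
      unfolding flux_eq_quarter_dipole linear_diff[OF linear_quarter, symmetric] norm_quarter ..
    then have "(LINT x:UNIV|lborel. (norm (?f n x - flux a (zoom c e x)))\<^sup>2)
      = e\<^sup>2 * (LINT z|lborel. (norm (grad (dipole_approx ?b (Suc n)) z - dipole ?b z))\<^sup>2)" for n
      using integral_grad_scaled_approx[OF e, of ?b n c] by (simp add: set_lebesgue_integral_def)
    then show "(\<lambda>n. LINT x:UNIV|lborel. (norm (?f n x - flux a (zoom c e x)))\<^sup>2) \<longlonglongrightarrow> 0"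
      using tendsto_mult_right_zero[OF L2_grad_dipole_approx_tendsto, of "e\<^sup>2" ?b] by simp
  qed
  moreover have "(LINT x:UNIV|lborel. ?f n x \<bullet> g x) = 0" for n
    by (rule curl_grad_orthogonal[OF T scaled_approx_elementary \<eta>])
  ultimately show ?thesis by (simp add: LIMSEQ_const_iff)
qed

section \<open>Sobolev functions on open sets\<close>

lemma H1_D:
  assumes "open \<Omega>" "u \<in> H1 \<Omega>"
  shows "has_weak_gradient \<Omega> u (wgrad \<Omega> u)" "L2 \<Omega> (wgrad \<Omega> u)" "L2 \<Omega> u"
  using assms wgrad_works wgrad_L2 by (auto simp: H1_def)

lemma H1_diff:
  assumes "open \<Omega>" "u \<in> H1 \<Omega>" "v \<in> H1 \<Omega>"
  shows "(\<lambda>x. u x - v x) \<in> H1 \<Omega>"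
  using has_weak_gradient_diff[OF H1_D(1)[OF assms(1,2)] H1_D(1)[OF assms(1,3)]]
    L2_diff[OF H1_D(2)[OF assms(1,2)] H1_D(2)[OF assms(1,3)]]
    L2_diff[OF H1_D(3)[OF assms(1,2)] H1_D(3)[OF assms(1,3)]]
  by (auto simp: H1_def)

lemma wgrad_diff_AE:
  assumes "open \<Omega>" "u \<in> H1 \<Omega>" "v \<in> H1 \<Omega>"
  shows "AE x in lborel. x \<in> \<Omega> \<longrightarrow> wgrad \<Omega> (\<lambda>x. u x - v x) x = wgrad \<Omega> u x - wgrad \<Omega> v x"
  by (rule wgrad_AE[OF assms(1) has_weak_gradient_diff[OF H1_D(1)[OF assms(1,2)] H1_D(1)[OF assms(1,3)]]])

lemma set_integral_nonneg': "(\<And>x. 0 \<le> f x) \<Longrightarrow> 0 \<le> (LINT x:A|M. f x :: real)"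
  unfolding set_lebesgue_integral_def by (rule Bochner_Integration.integral_nonneg) simp

lemma set_integral_cong_AE':
  fixes f g :: "real^2 \<Rightarrow> 'b::{banach, second_countable_topology}"
  assumes "AE x in lborel. x \<in> A \<longrightarrow> f x = g x"
    and "set_borel_measurable lborel A f" "set_borel_measurable lborel A g"
  shows "(LINT x:A|lborel. f x) = (LINT x:A|lborel. g x)"
  unfolding set_lebesgue_integral_def
  by (rule integral_cong_AE) (use assms in \<open>auto simp: set_borel_measurable_def indicator_def\<close>)

lemma set_borel_measurable_inner:
  fixes f g :: "real^2 \<Rightarrow> real^2"
  assumes "set_borel_measurable lborel A f" "set_borel_measurable lborel A g"
  shows "set_borel_measurable lborel A (\<lambda>x. f x \<bullet> g x)"
proof -
  have [measurable]: "(\<lambda>x. indicator A x *\<^sub>R f x) \<in> borel_measurable lborel"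
    "(\<lambda>x. indicator A x *\<^sub>R g x) \<in> borel_measurable lborel"
    using assms by (simp_all add: set_borel_measurable_def)
  have "(\<lambda>x. (indicator A x *\<^sub>R f x) \<bullet> (indicator A x *\<^sub>R g x)) \<in> borel_measurable lborel" by measurable
  also have "(\<lambda>x. (indicator A x *\<^sub>R f x) \<bullet> (indicator A x *\<^sub>R g x)) = (\<lambda>x. indicator A x *\<^sub>R (f x \<bullet> g x))"
    by (auto simp: indicator_def fun_eq_iff)
  finally show ?thesis by (simp add: set_borel_measurable_def)
qed

lemma L2_measurable: "L2 A f \<Longrightarrow> set_borel_measurable lborel A f"
  by (simp add: L2_def)

lemma set_borel_measurable_norm_sq:
  fixes f :: "real^2 \<Rightarrow> real^2"
  shows "set_borel_measurable lborel A f \<Longrightarrow> set_borel_measurable lborel A (\<lambda>x. (norm (f x))\<^sup>2)"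
  using set_borel_measurable_inner[of A f f] by (simp add: power2_norm_eq_inner)

lemma H1_norm_sq:
  "(H1_norm \<Omega> u)\<^sup>2 = (LINT x:\<Omega>|lborel. (u x)\<^sup>2) + (LINT x:\<Omega>|lborel. (norm (wgrad \<Omega> u x))\<^sup>2)"
  unfolding H1_norm_def by (intro real_sqrt_pow2 add_nonneg_nonneg set_integral_nonneg') auto

lemma norm_diff_sq_le: "(norm (a - b))\<^sup>2 \<le> 2 * (norm a)\<^sup>2 + 2 * (norm (b :: 'a::real_inner))\<^sup>2"
proof -
  have "0 \<le> (norm (a + b))\<^sup>2" by simp
  then show ?thesis by (simp add: power2_norm_eq_inner inner_diff inner_add inner_commute)
qed

lemma set_integral_norm_diff_le:
  fixes f g :: "real^2 \<Rightarrow> 'b::euclidean_space"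
  assumes "L2 A f" "L2 A g"
  shows "(LINT x:A|lborel. (norm (f x - g x))\<^sup>2)
    \<le> 2 * (LINT x:A|lborel. (norm (f x))\<^sup>2) + 2 * (LINT x:A|lborel. (norm (g x))\<^sup>2)"
proof -
  have "(LINT x:A|lborel. (norm (f x - g x))\<^sup>2) \<le> (LINT x:A|lborel. 2 * (norm (f x))\<^sup>2 + 2 * (norm (g x))\<^sup>2)"
    using L2_D2[OF L2_diff[OF assms]] L2_D2[OF assms(1)] L2_D2[OF assms(2)]
    by (intro set_integral_mono set_integral_add norm_diff_sq_le) auto
  also have "\<dots> = 2 * (LINT x:A|lborel. (norm (f x))\<^sup>2) + 2 * (LINT x:A|lborel. (norm (g x))\<^sup>2)"
    using L2_D2[OF assms(1)] L2_D2[OF assms(2)] by (simp add: set_integral_add)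
  finally show ?thesis .
qed

text \<open>A form of the triangle inequality for squared norms, which suffices for limits.\<close>

lemma H1_norm_diff_le:
  assumes "open \<Omega>" "u \<in> H1 \<Omega>" "v \<in> H1 \<Omega>"
  shows "(H1_norm \<Omega> (\<lambda>x. u x - v x))\<^sup>2 \<le> 2 * (H1_norm \<Omega> u)\<^sup>2 + 2 * (H1_norm \<Omega> v)\<^sup>2"
proof -
  note u = H1_D[OF assms(1,2)] and v = H1_D[OF assms(1,3)] and d = H1_D[OF assms(1) H1_diff[OF assms]]
  have "(LINT x:\<Omega>|lborel. (norm (wgrad \<Omega> (\<lambda>x. u x - v x) x))\<^sup>2)
      = (LINT x:\<Omega>|lborel. (norm (wgrad \<Omega> u x - wgrad \<Omega> v x))\<^sup>2)"
    using wgrad_diff_AE[OF assms]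
    by (intro set_integral_cong_AE' set_borel_measurable_norm_sq L2_measurable d(2) L2_diff u(2) v(2)) (auto elim: eventually_mono)
  then show ?thesis
    using set_integral_norm_diff_le[OF u(3) v(3)] set_integral_norm_diff_le[OF u(2) v(2)]
    by (simp add: H1_norm_sq)
qed

lemma smooth_diff:
  assumes "smooth f" "smooth g"
  shows "smooth (\<lambda>x. f x - g x)"
proof -
  have "foldr partial is (\<lambda>x. f x - g x) = (\<lambda>x. foldr partial is f x - foldr partial is g x)" for "is"
  proof (induction "is")
    case (Cons i "is")
    have d: "foldr partial is f differentiable at x" "foldr partial is g differentiable at x" for x
      using assms by (auto simp: smooth_def)
    have "partial i (\<lambda>x. foldr partial is f x - foldr partial is g x) x
      = partial i (foldr partial is f) x - partial i (foldr partial is g) x" for x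
      by (subst partial_eqI[OF has_derivative_diff[OF has_derivative_partial[OF d(1)] has_derivative_partial[OF d(2)]]])
        (simp add: inner_axis grad_def)
    then show ?case using Cons by auto
  qed simp
  then show ?thesis using assms unfolding smooth_def by simp
qed

lemma test_fun_diff:
  assumes "\<phi> \<in> test_fun \<Omega>" "\<psi> \<in> test_fun \<Omega>"
  shows "(\<lambda>x. \<phi> x - \<psi> x) \<in> test_fun \<Omega>"
proof -
  let ?K = "closure {x. \<phi> x \<noteq> 0} \<union> closure {x. \<psi> x \<noteq> 0}"
  have K: "compact ?K" "?K \<subseteq> \<Omega>" using assms by (auto simp: test_fun_def)
  have "{x. \<phi> x - \<psi> x \<noteq> 0} \<subseteq> {x. \<phi> x \<noteq> 0} \<union> {x. \<psi> x \<noteq> 0}" by auto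
  also have "\<dots> \<subseteq> ?K" by (intro Un_mono closure_subset)
  finally have "{x. \<phi> x - \<psi> x \<noteq> 0} \<subseteq> ?K" .
  then have s: "closure {x. \<phi> x - \<psi> x \<noteq> 0} \<subseteq> ?K"
    by (rule closure_minimal) auto
  then have "compact (closure {x. \<phi> x - \<psi> x \<noteq> 0})"
    using compact_Int_closed[OF K(1), of "closure {x. \<phi> x - \<psi> x \<noteq> 0}"] Int_absorb1[OF s] by simp
  moreover have "smooth (\<lambda>x. \<phi> x - \<psi> x)" using assms by (auto simp: test_fun_def intro: smooth_diff)
  ultimately show ?thesis using s K(2) unfolding test_fun_def by blast
qed

lemma test_fun_H1:
  assumes "open \<Omega>" "\<phi> \<in> test_fun \<Omega>"
  shows "\<phi> \<in> H1 \<Omega>"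
proof -
  have "\<Omega> \<in> sets borel" using assms(1) by simp
  then show ?thesis
    using test_fun_has_weak_gradient[OF assms(2,1)] L2_subset[OF test_fun_L2[OF assms(2)], of \<Omega>]
      L2_subset[OF test_fun_grad_L2[OF assms(2)], of \<Omega>]
    by (auto simp: H1_def)
qed

lemma wgrad_test_fun_AE:
  assumes "open \<Omega>" "\<phi> \<in> test_fun \<Omega>"
  shows "AE x in lborel. x \<in> \<Omega> \<longrightarrow> wgrad \<Omega> \<phi> x = grad \<phi> x"
  by (rule wgrad_AE[OF assms(1) test_fun_has_weak_gradient[OF assms(2,1)]])

lemma H10_H1: "u \<in> H10 \<Omega> \<Longrightarrow> u \<in> H1 \<Omega>"
  by (simp add: H10_def)

lemma H1_norm_zero:
  assumes "open \<Omega>"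
  shows "H1_norm \<Omega> (\<lambda>x. 0) = 0"
proof -
  have w: "has_weak_gradient \<Omega> (\<lambda>x. 0) (\<lambda>x. 0)"
    by (auto simp: has_weak_gradient_def loc_integrable_def set_integrable_def)
  have "L2 \<Omega> (\<lambda>x. 0 :: real^2)" by (simp add: L2_def set_borel_measurable_def set_integrable_def)
  then have L: "L2 \<Omega> (wgrad \<Omega> (\<lambda>x. 0))" by (rule wgrad_L2[OF assms w])
  have "(LINT x:\<Omega>|lborel. (norm (wgrad \<Omega> (\<lambda>x. 0) x))\<^sup>2) = (LINT x:\<Omega>|lborel. 0)"
  proof (rule set_integral_cong_AE')
    show "AE x in lborel. x \<in> \<Omega> \<longrightarrow> (norm (wgrad \<Omega> (\<lambda>x. 0) x))\<^sup>2 = 0"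
      using wgrad_AE[OF assms w] by eventually_elim auto
    show "set_borel_measurable lborel \<Omega> (\<lambda>x. (norm (wgrad \<Omega> (\<lambda>x. 0) x))\<^sup>2)"
      by (rule set_borel_measurable_norm_sq[OF L2_measurable[OF L]])
    show "set_borel_measurable lborel \<Omega> (\<lambda>x. 0 :: real)" by (simp add: set_borel_measurable_def)
  qed
  then show ?thesis by (simp add: H1_norm_def)
qed

lemma test_fun_H10:
  assumes "open \<Omega>" "\<phi> \<in> test_fun \<Omega>"
  shows "\<phi> \<in> H10 \<Omega>"
  using test_fun_H1[OF assms] assms(2) H1_norm_zero[OF assms(1)]
  by (auto simp: H10_def intro!: exI[of _ "\<lambda>_. \<phi>"])

lemma H10_diff:
  assumes "open \<Omega>" "u \<in> H10 \<Omega>" "v \<in> H10 \<Omega>"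
  shows "(\<lambda>x. u x - v x) \<in> H10 \<Omega>"
proof -
  obtain \<phi> \<psi> where \<phi>: "\<And>n. \<phi> n \<in> test_fun \<Omega>" "(\<lambda>n. H1_norm \<Omega> (\<lambda>x. \<phi> n x - u x)) \<longlonglongrightarrow> 0"
    and \<psi>: "\<And>n. \<psi> n \<in> test_fun \<Omega>" "(\<lambda>n. H1_norm \<Omega> (\<lambda>x. \<psi> n x - v x)) \<longlonglongrightarrow> 0"
    using assms(2,3) by (auto simp: H10_def)
  note u = H10_H1[OF assms(2)] and v = H10_H1[OF assms(3)]
  have le: "(H1_norm \<Omega> (\<lambda>x. (\<phi> n x - \<psi> n x) - (u x - v x)))\<^sup>2
    \<le> 2 * (H1_norm \<Omega> (\<lambda>x. \<phi> n x - u x))\<^sup>2 + 2 * (H1_norm \<Omega> (\<lambda>x. \<psi> n x - v x))\<^sup>2" for n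
  proof -
    have "(\<lambda>x. (\<phi> n x - \<psi> n x) - (u x - v x)) = (\<lambda>x. (\<phi> n x - u x) - (\<psi> n x - v x))" by auto
    then show ?thesis
      using H1_norm_diff_le[OF assms(1) H1_diff[OF assms(1) test_fun_H1[OF assms(1) \<phi>(1)] u]
          H1_diff[OF assms(1) test_fun_H1[OF assms(1) \<psi>(1)] v], of n n] by simp
  qed
  have "(\<lambda>n. (H1_norm \<Omega> (\<lambda>x. (\<phi> n x - \<psi> n x) - (u x - v x)))\<^sup>2) \<longlonglongrightarrow> 0"
  proof (rule Lim_null_comparison)
    show "(\<lambda>n. 2 * (H1_norm \<Omega> (\<lambda>x. \<phi> n x - u x))\<^sup>2 + 2 * (H1_norm \<Omega> (\<lambda>x. \<psi> n x - v x))\<^sup>2) \<longlonglongrightarrow> 0"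
      by (rule tendsto_eq_intros \<phi>(2) \<psi>(2) refl)+ simp
  qed (use le in simp)
  from tendsto_real_sqrt[OF this]
  have "(\<lambda>n. \<bar>H1_norm \<Omega> (\<lambda>x. (\<phi> n x - \<psi> n x) - (u x - v x))\<bar>) \<longlonglongrightarrow> 0" by simp
  then have "(\<lambda>n. H1_norm \<Omega> (\<lambda>x. (\<phi> n x - \<psi> n x) - (u x - v x))) \<longlonglongrightarrow> 0" by (rule tendsto_rabs_zero_cancel)
  then show ?thesis
    using H1_diff[OF assms(1) u v] test_fun_diff[OF \<phi>(1) \<psi>(1)]
    by (auto simp: H10_def intro!: exI[of _ "\<lambda>n x. \<phi> n x - \<psi> n x"])
qed

text \<open>The approximating test functions of the definition, in terms of classical gradients.\<close>

lemma H10_gradient_approx: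
  assumes "open \<Omega>" "u \<in> H10 \<Omega>"
  shows "\<exists>\<phi>. (\<forall>n. \<phi> n \<in> test_fun \<Omega>) \<and>
    (\<lambda>n. LINT x:\<Omega>|lborel. (norm (grad (\<phi> n) x - wgrad \<Omega> u x))\<^sup>2) \<longlonglongrightarrow> 0"
proof -
  obtain \<phi> where \<phi>: "\<And>n. \<phi> n \<in> test_fun \<Omega>" "(\<lambda>n. H1_norm \<Omega> (\<lambda>x. \<phi> n x - u x)) \<longlonglongrightarrow> 0"
    using assms(2) by (auto simp: H10_def)
  note u = H10_H1[OF assms(2)]
  have mO: "\<Omega> \<in> sets borel" using assms(1) by simp
  have le: "(LINT x:\<Omega>|lborel. (norm (grad (\<phi> n) x - wgrad \<Omega> u x))\<^sup>2) \<le> (H1_norm \<Omega> (\<lambda>x. \<phi> n x - u x))\<^sup>2" for n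
  proof -
    have "(LINT x:\<Omega>|lborel. (norm (grad (\<phi> n) x - wgrad \<Omega> u x))\<^sup>2)
        = (LINT x:\<Omega>|lborel. (norm (wgrad \<Omega> (\<lambda>x. \<phi> n x - u x) x))\<^sup>2)"
    proof (rule set_integral_cong_AE')
      show "AE x in lborel. x \<in> \<Omega> \<longrightarrow> (norm (grad (\<phi> n) x - wgrad \<Omega> u x))\<^sup>2 = (norm (wgrad \<Omega> (\<lambda>x. \<phi> n x - u x) x))\<^sup>2"
        using wgrad_diff_AE[OF assms(1) test_fun_H1[OF assms(1) \<phi>(1)[of n]] u] wgrad_test_fun_AE[OF assms(1) \<phi>(1)[of n]]
        by eventually_elim auto
      show "set_borel_measurable lborel \<Omega> (\<lambda>x. (norm (grad (\<phi> n) x - wgrad \<Omega> u x))\<^sup>2)"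
        by (intro set_borel_measurable_norm_sq L2_measurable L2_diff H1_D(2)[OF assms(1) u] L2_subset[OF test_fun_grad_L2[OF \<phi>(1)] mO]) auto
      show "set_borel_measurable lborel \<Omega> (\<lambda>x. (norm (wgrad \<Omega> (\<lambda>x. \<phi> n x - u x) x))\<^sup>2)"
        by (intro set_borel_measurable_norm_sq L2_measurable H1_D(2)[OF assms(1)] H1_diff[OF assms(1)] test_fun_H1[OF assms(1) \<phi>(1)] u)
    qed
    moreover have "0 \<le> (LINT x:\<Omega>|lborel. (\<phi> n x - u x)\<^sup>2)" by (rule set_integral_nonneg') simp
    ultimately show ?thesis by (simp add: H1_norm_sq)
  qed
  have "(\<lambda>n. LINT x:\<Omega>|lborel. (norm (grad (\<phi> n) x - wgrad \<Omega> u x))\<^sup>2) \<longlonglongrightarrow> 0"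
  proof (rule Lim_null_comparison)
    show "(\<lambda>n. (H1_norm \<Omega> (\<lambda>x. \<phi> n x - u x))\<^sup>2) \<longlonglongrightarrow> 0"
      using tendsto_power[OF \<phi>(2), of 2] by simp
    show "\<forall>\<^sub>F n in sequentially. norm (LINT x:\<Omega>|lborel. (norm (grad (\<phi> n) x - wgrad \<Omega> u x))\<^sup>2) \<le> (H1_norm \<Omega> (\<lambda>x. \<phi> n x - u x))\<^sup>2"
      using le by (auto intro!: always_eventually simp: abs_of_nonneg set_integral_nonneg')
  qed
  then show ?thesis using \<phi>(1) by blast
qed

text \<open>For functions in \<open>H10\<close> the orthogonality needs only test functions on \<open>\<Omega>\<close>, extended by zero:
they are dense by definition.\<close>

lemma flux_orthogonal_H10:
  assumes "open \<Omega>" "\<eta> \<in> H10 \<Omega>" "e > 0"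
  shows "(LINT x:\<Omega>|lborel. flux a (zoom c e x) \<bullet> wgrad \<Omega> \<eta> x) = 0"
proof -
  obtain \<phi> where \<phi>: "\<And>n. \<phi> n \<in> test_fun \<Omega>"
    "(\<lambda>n. LINT x:\<Omega>|lborel. (norm (grad (\<phi> n) x - wgrad \<Omega> \<eta> x))\<^sup>2) \<longlonglongrightarrow> 0"
    using H10_gradient_approx[OF assms(1,2)] by blast
  have mO: "\<Omega> \<in> sets borel" using assms(1) by simp
  have F: "L2 \<Omega> (\<lambda>x. flux a (zoom c e x))" by (rule L2_subset[OF flux_zoom_L2[OF assms(3)] mO]) simp
  have "(\<lambda>n. LINT x:\<Omega>|lborel. grad (\<phi> n) x \<bullet> flux a (zoom c e x)) \<longlonglongrightarrow> (LINT x:\<Omega>|lborel. wgrad \<Omega> \<eta> x \<bullet> flux a (zoom c e x))"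
    by (rule L2_limit_inner[OF L2_subset[OF test_fun_grad_L2[OF \<phi>(1)] mO] H1_D(2)[OF assms(1) H10_H1[OF assms(2)]] F \<phi>(2)]) simp
  moreover have "(LINT x:\<Omega>|lborel. grad (\<phi> n) x \<bullet> flux a (zoom c e x)) = 0" for n
  proof -
    obtain K where K: "K \<subseteq> \<Omega>" "\<And>i x. x \<notin> K \<Longrightarrow> partial i (\<phi> n) x = 0"
      using test_fun_support[OF \<phi>(1)[of n]] by blast
    have "grad (\<phi> n) x = 0" if "x \<notin> \<Omega>" for x using K that by (auto simp: grad_def vec_eq_iff)
    then have "(LINT x:\<Omega>|lborel. grad (\<phi> n) x \<bullet> flux a (zoom c e x)) = (LINT x:UNIV|lborel. grad (\<phi> n) x \<bullet> flux a (zoom c e x))"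
      unfolding set_lebesgue_integral_def by (intro Bochner_Integration.integral_cong) (auto simp: indicator_def)
    also have "\<dots> = 0"
      using flux_orthogonal[OF test_fun_has_weak_gradient[OF \<phi>(1)[of n] open_UNIV] test_fun_grad_L2[OF \<phi>(1)] assms(3)]
      by (simp add: inner_commute)
    finally show ?thesis .
  qed
  ultimately show ?thesis by (simp add: LIMSEQ_const_iff inner_commute)
qed

text \<open>The restriction of a weak gradient to a smaller open set is a weak gradient there, and the
classical gradient is another one.\<close>

lemma C1_holder_wgrad:
  assumes "open D" "open A" "A \<subseteq> D" "u \<in> H1 D" "C1_holder A \<beta> u" "\<beta> > 0"
  shows "continuous_on A (grad u)" "AE x in lborel. x \<in> A \<longrightarrow> wgrad D u x = grad u x"
proof -
  obtain C where C: "\<And>x y. x \<in> A \<Longrightarrow> y \<in> A \<Longrightarrow> norm (grad u x - grad u y) \<le> C * dist x y powr \<beta>"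
    using assms(5) by (auto simp: C1_holder_def)
  show cont: "continuous_on A (grad u)"
    unfolding continuous_on_def
  proof
    fix x assume x: "x \<in> A"
    show "(grad u \<longlongrightarrow> grad u x) (at x within A)"
    proof (rule LIM_zero_cancel, rule Lim_null_comparison)
      show "\<forall>\<^sub>F y in at x within A. norm (grad u y - grad u x) \<le> C * dist y x powr \<beta>"
        using C x by (auto simp: eventually_at_filter)
      have "((\<lambda>y. dist y x) \<longlongrightarrow> dist x x) (at x within A)"
        by (intro tendsto_intros)
      then have "((\<lambda>y. dist y x powr \<beta>) \<longlongrightarrow> 0) (at x within A)"
        using assms(6) by (intro tendsto_zero_powrI[where b = \<beta>]) auto
      from tendsto_mult[OF tendsto_const[of C] this]
      show "((\<lambda>y. C * dist y x powr \<beta>) \<longlongrightarrow> 0) (at x within A)" by simp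
    qed
  qed
  have g: "has_weak_gradient A u (grad u)"
    using assms(5) by (intro has_weak_gradient_C1 assms(2) cont) (auto simp: C1_holder_def)
  have w: "has_weak_gradient D u (wgrad D u)" by (rule H1_D(1)[OF assms(1,4)])
  have "has_weak_gradient A u (wgrad D u)"
    unfolding has_weak_gradient_def
  proof (intro conjI ballI allI)
    show "loc_integrable A u" "loc_integrable A (wgrad D u)"
      using w assms(3) by (auto simp: has_weak_gradient_def loc_integrable_def)
    fix \<phi> i assume \<phi>: "\<phi> \<in> test_fun A"
    obtain K where K: "K \<subseteq> A" "\<And>x. x \<notin> K \<Longrightarrow> \<phi> x = 0" "\<And>i x. x \<notin> K \<Longrightarrow> partial i \<phi> x = 0"
      using test_fun_support[OF \<phi>] by blast
    have "(LINT x:A|lborel. u x * partial i \<phi> x) = (LINT x:D|lborel. u x * partial i \<phi> x)"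
      "(LINT x:A|lborel. wgrad D u x $ i * \<phi> x) = (LINT x:D|lborel. wgrad D u x $ i * \<phi> x)"
    proof -
      have z: "\<phi> x = 0" "partial i \<phi> x = 0" if "x \<notin> A" for x using K that by auto
      show "(LINT x:A|lborel. u x * partial i \<phi> x) = (LINT x:D|lborel. u x * partial i \<phi> x)"
        "(LINT x:A|lborel. wgrad D u x $ i * \<phi> x) = (LINT x:D|lborel. wgrad D u x $ i * \<phi> x)"
        unfolding set_lebesgue_integral_def
        by (rule Bochner_Integration.integral_cong; use z assms(3) in \<open>auto simp: indicator_def dest: subsetD\<close>)+
    qed
    then show "(LINT x:A|lborel. u x * partial i \<phi> x) = - (LINT x:A|lborel. wgrad D u x $ i * \<phi> x)"
      using w test_fun_mono[OF \<phi> assms(3)] by (simp add: has_weak_gradient_def)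
  qed
  from weak_gradient_unique[OF assms(2) this g, of 0]
  show "AE x in lborel. x \<in> A \<longrightarrow> wgrad D u x = grad u x" by simp
qed

section \<open>The transmission problem on the unit disc\<close>

lemma Hw_D:
  assumes "u \<in> Hw"
  shows "has_weak_gradient UNIV u (wgrad UNIV u)" "L2 UNIV (wgrad UNIV u)" "L2 UNIV (\<lambda>x. weight x * u x)"
  using assms wgrad_works wgrad_L2[OF open_UNIV] by (auto simp: Hw_def)

lemma Hw_diff:
  assumes "u \<in> Hw" "v \<in> Hw"
  shows "(\<lambda>x. u x - v x) \<in> Hw"
  using has_weak_gradient_diff[OF Hw_D(1)[OF assms(1)] Hw_D(1)[OF assms(2)]]
    L2_diff[OF Hw_D(2)[OF assms(1)] Hw_D(2)[OF assms(2)]]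
    L2_diff[OF Hw_D(3)[OF assms(1)] Hw_D(3)[OF assms(2)]]
  by (auto simp: Hw_def right_diff_distrib)

lemma mod_const_refl: "u \<in> Hw \<Longrightarrow> (u, u) \<in> mod_const"
  by (auto simp: mod_const_def)

lemma Hq_representative:
  assumes "X \<in> Hq"
  shows "\<exists>u\<in>Hw. qgrad X = wgrad UNIV u"
proof -
  obtain v where v: "v \<in> Hw" "X = mod_const `` {v}" using assms by (auto simp: Hq_def quotient_def)
  then have "v \<in> X" using mod_const_refl by auto
  then have "(SOME u. u \<in> X) \<in> X" by (rule someI[of "\<lambda>u. u \<in> X"])
  then have "(SOME u. u \<in> X) \<in> Hw" using v(2) by (auto simp: mod_const_def)
  then show ?thesis unfolding qgrad_def by blast
qed

lemma qgrad_L2: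
  assumes "X \<in> Hq"
  shows "L2 UNIV (qgrad X)" "\<exists>u\<in>Hw. has_weak_gradient UNIV u (qgrad X)"
  using Hq_representative[OF assms] Hw_D by metis+

text \<open>The gradient of a class is that of an arbitrary representative; it agrees with any weak
gradient of any other representative because these differ by a constant.\<close>

lemma Hq_of_Hw:
  assumes "u \<in> Hw" "has_weak_gradient UNIV u g"
  shows "\<exists>X\<in>Hq. AE x in lborel. qgrad X x = g x"
proof
  let ?X = "mod_const `` {u}"
  show "?X \<in> Hq" using assms(1) unfolding Hq_def by (rule quotientI)
  have "u \<in> ?X" using mod_const_refl[OF assms(1)] by auto
  then have "(SOME v. v \<in> ?X) \<in> ?X" by (rule someI[of "\<lambda>v. v \<in> ?X"])
  then obtain c where v: "(SOME v. v \<in> ?X) \<in> Hw" and c: "AE x in lborel. u x - (SOME v. v \<in> ?X) x = c"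
    by (auto simp: mod_const_def)
  have "AE x in lborel. x \<in> UNIV \<longrightarrow> g x = wgrad UNIV (SOME v. v \<in> ?X) x"
    by (rule weak_gradient_unique[OF open_UNIV assms(2) Hw_D(1)[OF v]]) (use c in auto)
  then show "AE x in lborel. qgrad ?X x = g x"
    unfolding qgrad_def by eventually_elim auto
qed

lemma Hq_diff_dipole:
  assumes "X \<in> Hq"
  shows "\<exists>Y\<in>Hq. AE x in lborel. qgrad Y x = qgrad X x - dipole a x"
proof -
  obtain u where "u \<in> Hw" "has_weak_gradient UNIV u (qgrad X)" using qgrad_L2(2)[OF assms] by blast
  then show ?thesis
    using Hq_of_Hw[OF Hw_diff[OF _ dipole_pot_Hw] has_weak_gradient_diff[OF _ dipole_pot_has_weak_gradient]] by blast
qed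

lemma zoom_id: "zoom 0 1 x = x" by (simp add: zoom_def)

text \<open>The orthogonality of the flux, split at the unit circle: the dipole field outside balances a
source \<open>a\<close> inside.\<close>

lemma flux_orthogonal_Hq:
  assumes "X \<in> Hq"
  shows "(LINT x:(- ball 0 1)|lborel. dipole a x \<bullet> qgrad X x) = (LINT x:ball 0 1|lborel. a \<bullet> qgrad X x)"
proof -
  obtain u where "has_weak_gradient UNIV u (qgrad X)" using qgrad_L2(2)[OF assms] by blast
  from flux_orthogonal[OF this qgrad_L2(1)[OF assms], of 1 a 0]
  have "(LINT x:UNIV|lborel. flux a x \<bullet> qgrad X x) = 0" by (simp add: zoom_id)
  moreover have i: "set_integrable lborel UNIV (\<lambda>x. flux a x \<bullet> qgrad X x)"
    using L2_inner[OF flux_zoom_L2[of 1 a 0] qgrad_L2(1)[OF assms]] by (simp add: zoom_id)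
  have "(LINT x:(- ball 0 1) \<union> ball 0 1|lborel. flux a x \<bullet> qgrad X x)
      = (LINT x:(- ball 0 1)|lborel. flux a x \<bullet> qgrad X x) + (LINT x:ball 0 1|lborel. flux a x \<bullet> qgrad X x)"
    by (rule set_integral_Un) (auto intro!: set_integrable_subset[OF i])
  moreover have "(LINT x:(- ball 0 1)|lborel. flux a x \<bullet> qgrad X x) = (LINT x:(- ball 0 1)|lborel. dipole a x \<bullet> qgrad X x)"
    by (rule set_lebesgue_integral_cong) (auto simp: flux_def)
  moreover have "(LINT x:ball 0 1|lborel. flux a x \<bullet> qgrad X x) = (LINT x:ball 0 1|lborel. - (a \<bullet> qgrad X x))"
    by (rule set_lebesgue_integral_cong) (auto simp: flux_def)
  moreover have "(LINT x:ball 0 1|lborel. - (a \<bullet> qgrad X x)) = - (LINT x:ball 0 1|lborel. a \<bullet> qgrad X x)"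
    by (simp add: set_lebesgue_integral_def)
  ultimately show ?thesis by (simp add: Un_commute)
qed

lemma borel_set_borel_measurable:
  fixes f :: "real^2 \<Rightarrow> 'b::{second_countable_topology, real_normed_vector}"
  assumes "f \<in> borel_measurable borel" "A \<in> sets borel"
  shows "set_borel_measurable lborel A f"
  unfolding set_borel_measurable_def using assms by simp

lemma L2_const_ball: "L2 (ball (c::real^2) r) (\<lambda>x. a :: real^2)"
proof -
  have "set_integrable lborel (cball c r) (\<lambda>x. (norm a)\<^sup>2)"
    unfolding set_integrable_def by (rule borel_integrable_compact) auto
  then have "set_integrable lborel (ball c r) (\<lambda>x. (norm a)\<^sup>2)"
    by (rule set_integrable_subset) auto
  moreover have "set_borel_measurable lborel (ball c r) (\<lambda>x. a)"
    by (intro borel_set_borel_measurable) auto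
  ultimately show ?thesis by (simp add: L2_def)
qed

lemma continuous_of_Lipschitz:
  fixes N :: "'a::real_normed_vector \<Rightarrow> 'b::real_normed_vector"
  assumes "\<And>v w. norm (N v - N w) \<le> L * norm (v - w)"
  shows "continuous_on UNIV N"
proof (rule lipschitz_on_continuous_on)
  show "lipschitz_on \<bar>L\<bar> UNIV N"
    by (rule lipschitz_onI) (auto simp: dist_norm intro: order_trans[OF assms mult_right_mono])
qed

text \<open>Let \<open>g\<close> be the gradient of the solution. The difference of \<open>g\<close> and the dipole field is again the
gradient of a class in \<open>Hq\<close> and may serve as test function. By the condition on \<open>a\<close> the dipole field
satisfies the same equation, as its flux is orthogonal to gradients; subtracting and
using that \<open>A\<close> is monotone shows that the difference vanishes in the disc.\<close>

lemma transmission_solution_in_disc: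
  fixes A :: "real^2 \<Rightarrow> real^2"
  assumes nu0: "nu0 > 0" and m: "m > 0"
    and lip: "\<And>v w. norm (A v - A w) \<le> L * norm (v - w)"
    and mono: "\<And>v w. m * (norm (v - w))\<^sup>2 \<le> (A v - A w) \<bullet> (v - w)"
    and a: "A a - B = - (nu0 *\<^sub>R a)"
    and X: "X \<in> Hq"
    and eq: "\<And>\<eta>. \<eta> \<in> Hq \<Longrightarrow>
      (LINT x:(- ball 0 1)|lborel. nu0 * (qgrad X x \<bullet> qgrad \<eta> x)) + (LINT x:ball 0 1|lborel. A (qgrad X x) \<bullet> qgrad \<eta> x)
      = (LINT x:ball 0 1|lborel. B \<bullet> qgrad \<eta> x)"
  shows "AE x in lborel. x \<in> ball 0 1 \<longrightarrow> qgrad X x = a"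
proof -
  let ?O = "- ball (0::real^2) 1" and ?I = "ball (0::real^2) 1"
  define g where "g = qgrad X"
  obtain Y where Y: "Y \<in> Hq" "AE x in lborel. qgrad Y x = qgrad X x - dipole a x"
    using Hq_diff_dipole[OF X] by blast
  define y where "y = qgrad Y"
  have gL: "L2 UNIV g" and yL: "L2 UNIV y" using qgrad_L2(1) X Y by (auto simp: g_def y_def)
  have yI: "L2 ?I y" and yO: "L2 ?O y" and gO: "L2 ?O g" and gI: "L2 ?I g" and dO: "L2 ?O (dipole a)"
    using L2_subset[OF yL] L2_subset[OF gL] L2_subset[OF L2_dipole] by auto
  have "continuous_on UNIV A" by (rule continuous_of_Lipschitz[OF lip])
  then have [measurable]: "A \<in> borel_measurable borel" by (rule borel_measurable_continuous_onI)
  have [measurable]: "g \<in> borel_measurable borel" "y \<in> borel_measurable borel"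
    using gL yL by (auto simp: L2_UNIV_iff)
  have Am: "set_borel_measurable lborel ?I (\<lambda>x. A (g x) - A a)"
    by (intro borel_set_borel_measurable) auto
  have AL: "L2 ?I (\<lambda>x. A (g x) - A a)"
    by (rule L2_bound[OF L2_diff[OF gI L2_const_ball[of 0 1 a]] Am, of L]) (use lip in auto)
  have AgL: "L2 ?I (\<lambda>x. A (g x))" using L2_add[OF AL L2_const_ball[of 0 1 "A a"]] by simp
  have yAE: "AE x in lborel. y x = g x - dipole a x" using Y(2) by (simp add: y_def g_def)
  have f1: "nu0 * (LINT x:?O|lborel. g x \<bullet> y x) + (LINT x:?I|lborel. A (g x) \<bullet> y x) = (LINT x:?I|lborel. B \<bullet> y x)"
    using eq[OF Y(1)] by (simp add: y_def g_def)
  have f2: "(LINT x:?O|lborel. dipole a x \<bullet> y x) = (LINT x:?I|lborel. a \<bullet> y x)"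
    using flux_orthogonal_Hq[OF Y(1)] by (simp add: y_def)
  have f3: "(LINT x:?I|lborel. (A (g x) - A a) \<bullet> y x)
      = (LINT x:?I|lborel. A (g x) \<bullet> y x) - (LINT x:?I|lborel. B \<bullet> y x) + nu0 * (LINT x:?I|lborel. a \<bullet> y x)"
  proof -
    have Aa: "A a = B - nu0 *\<^sub>R a" using a by (simp add: algebra_simps)
    have "(LINT x:?I|lborel. (A (g x) - A a) \<bullet> y x) = (LINT x:?I|lborel. (A (g x) \<bullet> y x - B \<bullet> y x) + nu0 * (a \<bullet> y x))"
      unfolding Aa by (simp add: inner_diff_left algebra_simps)
    also have "\<dots> = (LINT x:?I|lborel. A (g x) \<bullet> y x - B \<bullet> y x) + (LINT x:?I|lborel. nu0 * (a \<bullet> y x))"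
      by (intro set_integral_add set_integral_diff set_integrable_mult_right L2_inner AgL yI L2_const_ball)
    also have "(LINT x:?I|lborel. A (g x) \<bullet> y x - B \<bullet> y x) = (LINT x:?I|lborel. A (g x) \<bullet> y x) - (LINT x:?I|lborel. B \<bullet> y x)"
      by (intro set_integral_diff L2_inner AgL yI L2_const_ball)
    finally show ?thesis by simp
  qed
  have f4: "(LINT x:?O|lborel. (norm (y x))\<^sup>2) = (LINT x:?O|lborel. g x \<bullet> y x) - (LINT x:?O|lborel. dipole a x \<bullet> y x)"
  proof -
    have "(LINT x:?O|lborel. (norm (y x))\<^sup>2) = (LINT x:?O|lborel. g x \<bullet> y x - dipole a x \<bullet> y x)"
    proof (rule set_integral_cong_AE')
      show "AE x in lborel. x \<in> ?O \<longrightarrow> (norm (y x))\<^sup>2 = g x \<bullet> y x - dipole a x \<bullet> y x"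
        using yAE by eventually_elim (simp add: power2_norm_eq_inner inner_diff_left[symmetric])
    qed (auto simp: set_borel_measurable_def)
    also have "\<dots> = (LINT x:?O|lborel. g x \<bullet> y x) - (LINT x:?O|lborel. dipole a x \<bullet> y x)"
      by (intro set_integral_diff L2_inner gO yO dO)
    finally show ?thesis .
  qed
  have combine: "n * YO + AI = 0" if "n * GO + P = Q" "DO = E" "AI = P - Q + n * E" "YO = GO - DO"
    for n GO P Q DO E AI YO :: real
  proof -
    have "n * YO = n * GO - n * E" using that by (simp add: right_diff_distrib)
    then show ?thesis using that by linarith
  qed
  have z: "nu0 * (LINT x:?O|lborel. (norm (y x))\<^sup>2) + (LINT x:?I|lborel. (A (g x) - A a) \<bullet> y x) = 0"
    by (rule combine[OF f1 f2 f3 f4])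
  have le: "m * (LINT x:?I|lborel. (norm (y x))\<^sup>2) \<le> (LINT x:?I|lborel. (A (g x) - A a) \<bullet> y x)"
  proof -
    have "(LINT x:?I|lborel. m * (norm (y x))\<^sup>2) \<le> (LINT x:?I|lborel. (A (g x) - A a) \<bullet> y x)"
    proof (rule set_integral_mono_AE)
      show "set_integrable lborel ?I (\<lambda>x. m * (norm (y x))\<^sup>2)" using L2_D2[OF yI] by simp
      show "set_integrable lborel ?I (\<lambda>x. (A (g x) - A a) \<bullet> y x)" by (rule L2_inner[OF AL yI])
      show "AE x\<in>?I in lborel. m * (norm (y x))\<^sup>2 \<le> (A (g x) - A a) \<bullet> y x"
        using yAE by eventually_elim (use mono in \<open>auto simp: dipole_def\<close>)
    qed
    then show ?thesis by simp
  qed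
  have "0 \<le> (LINT x:?O|lborel. (norm (y x))\<^sup>2)" by (rule set_integral_nonneg') simp
  moreover have nnI: "0 \<le> (LINT x:?I|lborel. (norm (y x))\<^sup>2)" by (rule set_integral_nonneg') simp
  ultimately have "m * (LINT x:?I|lborel. (norm (y x))\<^sup>2) \<le> 0"
    using z le nu0 by (smt (verit) mult_nonneg_nonneg)
  then have "(LINT x:?I|lborel. (norm (y x))\<^sup>2) = 0" using m nnI by (simp add: mult_le_0_iff)
  then have "AE x in lborel. indicator ?I x *\<^sub>R (norm (y x))\<^sup>2 = 0"
    unfolding set_lebesgue_integral_def
    by (subst (asm) integral_nonneg_eq_0_iff_AE) (use L2_D2[OF yI] in \<open>auto simp: set_integrable_def\<close>)
  with yAE show ?thesis
    by eventually_elim (auto simp: dipole_def g_def)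
qed

section \<open>The material law\<close>

lemma Ck_hl_1_has_derivative:
  assumes "Ck_hl 1 nu" "0 \<le> s"
  shows "(nu has_real_derivative deriv_hl nu s) (at s within {0..})"
proof -
  have "nu differentiable_on {0..}" using assms(1) by (auto simp: Ck_hl_def)
  then have "nu differentiable (at s within {0..})" using assms(2) by (auto simp: differentiable_on_def)
  then show ?thesis
    unfolding deriv_hl_def has_real_derivative_iff_has_vector_derivative
    by (simp add: vector_derivative_works)
qed

lemma at_within_half_line_nontrivial: "0 \<le> s \<Longrightarrow> at s within {0..} \<noteq> (bot :: real filter)"
proof -
  assume "0 \<le> s"
  have "at_right s \<le> at s within {0..}" by (rule at_le) (use \<open>0 \<le> s\<close> in auto)
  then show ?thesis using trivial_limit_at_right_real[of s] by (auto simp: bot_unique)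
qed

lemma flux_law_has_derivative:
  assumes "Ck_hl 1 nu" "0 \<le> s"
  shows "((\<lambda>s. nu s * s) has_real_derivative deriv_hl (\<lambda>s. nu s * s) s) (at s within {0..})"
    "deriv_hl (\<lambda>s. nu s * s) s = nu s + deriv_hl nu s * s"
proof -
  have d: "((\<lambda>s. nu s * s) has_real_derivative nu s + deriv_hl nu s * s) (at s within {0..})"
    by (rule DERIV_cong[OF DERIV_mult[OF Ck_hl_1_has_derivative[OF assms] DERIV_ident]]) simp
  then show eq: "deriv_hl (\<lambda>s. nu s * s) s = nu s + deriv_hl nu s * s"
    unfolding deriv_hl_def has_real_derivative_iff_has_vector_derivative
    by (intro vector_derivative_within at_within_half_line_nontrivial[OF assms(2)])
  show "((\<lambda>s. nu s * s) has_real_derivative deriv_hl (\<lambda>s. nu s * s) s) (at s within {0..})"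
    using d eq by simp
qed

text \<open>The consequences of the first condition on the material law that drive the analysis: \<open>T\<close> is
Lipschitz continuous and strongly monotone, and its derivative is coercive.\<close>

locale material =
  fixes nu0 m :: real and nu :: "real \<Rightarrow> real"
  assumes N1: "cond_N1 nu0 m nu"
begin

lemma m_pos: "m > 0" and Ck: "Ck_hl 1 nu"
  using N1 by (auto simp: cond_N1_def)

lemma nu_bounds: "0 \<le> s \<Longrightarrow> m \<le> nu s" "0 \<le> s \<Longrightarrow> nu s \<le> nu0"
  using N1 by (auto simp: cond_N1_def)

lemma m_le_nu0: "m \<le> nu0"
  using nu_bounds[of 0] by simp

lemma nu0_pos: "nu0 > 0"
  using m_pos m_le_nu0 by simp

text \<open>The mean value theorem for \<open>s \<mapsto> \<nu>(s) s\<close>; interior points see the two-sided derivative.\<close>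

lemma flux_law_increment:
  assumes "0 \<le> s" "s \<le> t"
  shows "m * (t - s) \<le> nu t * t - nu s * s" "nu t * t - nu s * s \<le> nu0 * (t - s)"
proof -
  have "m * (t - s) \<le> nu t * t - nu s * s \<and> nu t * t - nu s * s \<le> nu0 * (t - s)"
  proof (cases "s = t")
    case False
    then have st: "s < t" using assms by simp
    let ?f = "\<lambda>s. nu s * s"
    have "continuous_on {s..t} ?f"
      unfolding continuous_on_eq_continuous_within
    proof
      fix x assume "x \<in> {s..t}"
      then have x: "0 \<le> x" using assms by simp
      have "continuous (at x within {0..}) ?f"
        using flux_law_has_derivative(1)[OF Ck x] by (rule DERIV_continuous)
      then show "continuous (at x within {s..t}) ?f"
        by (rule continuous_within_subset) (use assms in auto)
    qed
    moreover have "(?f has_derivative (*) (deriv_hl ?f x)) (at x)" if "s < x" "x < t" for x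
    proof -
      have "at x within {0..} = at x" using that assms by (intro at_within_interior) auto
      then show ?thesis
        using flux_law_has_derivative(1)[OF Ck, of x] that assms
        by (simp add: has_field_derivative_def)
    qed
    ultimately obtain x where x: "s < x" "x < t" "?f t - ?f s = deriv_hl ?f x * (t - s)"
      using mvt[OF st, of ?f "\<lambda>x. (*) (deriv_hl ?f x)"] by auto
    have "m \<le> deriv_hl ?f x" "deriv_hl ?f x \<le> nu0" using N1 x assms by (auto simp: cond_N1_def)
    then have "m * (t - s) \<le> deriv_hl ?f x * (t - s)" "deriv_hl ?f x * (t - s) \<le> nu0 * (t - s)"
      using st by (auto intro!: mult_right_mono)
    then show ?thesis using x(3) by simp
  qed simp
  then show "m * (t - s) \<le> nu t * t - nu s * s" "nu t * t - nu s * s \<le> nu0 * (t - s)" by auto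
qed

text \<open>By the Cauchy-Schwarz inequality the claim reduces to parallel vectors, that is, to the
increments of \<open>s \<mapsto> \<nu>(s) s\<close>.\<close>

lemma T_strongly_monotone: "m * (norm (V - W))\<^sup>2 \<le> (T_op nu V - T_op nu W) \<bullet> (V - W)"
proof -
  define p q c where "p = norm V" and "q = norm W" and "c = V \<bullet> W"
  have pq: "0 \<le> p" "0 \<le> q" "c \<le> p * q" by (auto simp: p_def q_def c_def norm_cauchy_schwarz)
  have V: "V \<bullet> V = p * p" "W \<bullet> W = q * q" by (auto simp: p_def q_def norm_eq_sqrt_inner)
  have lhs: "(T_op nu V - T_op nu W) \<bullet> (V - W) = nu p * (p * p) + nu q * (q * q) - (nu p + nu q) * c"
    by (simp add: T_op_def inner_diff_left inner_diff_right p_def[symmetric] q_def[symmetric] V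
        inner_commute[of W V] c_def[symmetric] algebra_simps)
  have rhs: "(norm (V - W))\<^sup>2 = p * p + q * q - 2 * c"
    by (simp add: power2_norm_eq_inner inner_diff_left inner_diff_right V inner_commute[of W V] c_def[symmetric])
  have "0 \<le> nu p + nu q - 2 * m" using nu_bounds(1)[OF pq(1)] nu_bounds(1)[OF pq(2)] by simp
  from mult_left_mono[OF pq(3) this]
  have 1: "(nu p + nu q - 2 * m) * c \<le> (nu p + nu q - 2 * m) * (p * q)" .
  have "0 \<le> ((nu p * p - nu q * q) - m * (p - q)) * (p - q)"
  proof (cases "q \<le> p")
    case True
    then show ?thesis using flux_law_increment(1)[OF pq(2) True] by (intro mult_nonneg_nonneg) auto
  next
    case False
    then have "p \<le> q" by simp
    then show ?thesis using flux_law_increment(1)[OF pq(1) \<open>p \<le> q\<close>]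
      by (intro mult_nonpos_nonpos) (auto simp: algebra_simps)
  qed
  then show ?thesis unfolding lhs rhs using 1 by (simp add: algebra_simps)
qed

text \<open>The difference is split into \<open>\<nu>(|W|) (V - W)\<close> and \<open>(\<nu>(|V|) - \<nu>(|W|)) V\<close>. The length of the
second part is a difference of increments of \<open>s \<mapsto> \<nu>(s) s\<close> and of a linear function.\<close>

lemma T_Lipschitz: "norm (T_op nu V - T_op nu W) \<le> 2 * nu0 * norm (V - W)"
proof -
  define p q where "p = norm V" and "q = norm W"
  have pq: "0 \<le> p" "0 \<le> q" by (auto simp: p_def q_def)
  have n: "\<bar>p - q\<bar> \<le> norm (V - W)" by (simp add: p_def q_def norm_triangle_ineq3)
  have nq: "0 \<le> nu q" "nu q \<le> nu0" using nu_bounds[OF pq(2)] m_pos by auto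
  have "\<bar>(nu p - nu q) * p\<bar> \<le> nu0 * \<bar>p - q\<bar>"
  proof (cases "q \<le> p")
    case True
    have "0 \<le> nu q * (p - q)" "nu q * (p - q) \<le> nu0 * (p - q)" "0 \<le> m * (p - q)"
      using nq True m_pos by (auto intro!: mult_right_mono mult_nonneg_nonneg)
    moreover have "(nu p - nu q) * p = (nu p * p - nu q * q) - nu q * (p - q)" by (simp add: algebra_simps)
    ultimately show ?thesis using flux_law_increment[OF pq(2) True] True by auto
  next
    case False
    then have le: "p \<le> q" by simp
    have "0 \<le> nu q * (q - p)" "nu q * (q - p) \<le> nu0 * (q - p)" "0 \<le> m * (q - p)"
      using nq le m_pos by (auto intro!: mult_right_mono mult_nonneg_nonneg)
    moreover have "(nu p - nu q) * p = nu q * (q - p) - (nu q * q - nu p * p)" by (simp add: algebra_simps)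
    ultimately show ?thesis using flux_law_increment[OF pq(1) le] le by auto
  qed
  also have "\<dots> \<le> nu0 * norm (V - W)" using n nu0_pos by (intro mult_left_mono) auto
  finally have 1: "\<bar>(nu p - nu q) * p\<bar> \<le> nu0 * norm (V - W)" .
  have "T_op nu V - T_op nu W = nu q *\<^sub>R (V - W) + (nu p - nu q) *\<^sub>R V"
    by (simp add: T_op_def p_def q_def algebra_simps)
  then have "norm (T_op nu V - T_op nu W) \<le> norm (nu q *\<^sub>R (V - W)) + norm ((nu p - nu q) *\<^sub>R V)"
    by (simp add: norm_triangle_ineq del: norm_scaleR)
  also have "norm ((nu p - nu q) *\<^sub>R V) = \<bar>(nu p - nu q) * p\<bar>" using pq by (simp add: p_def abs_mult)
  also have "norm (nu q *\<^sub>R (V - W)) \<le> nu0 * norm (V - W)" using nq by (auto intro!: mult_right_mono)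
  finally show ?thesis using 1 by simp
qed

text \<open>With the convention for division by zero this formula includes \<open>U = 0\<close>.\<close>

lemma DT_apply: "DT_op nu U *v v = nu (norm U) *\<^sub>R v + (deriv_hl nu (norm U) / norm U * (U \<bullet> v)) *\<^sub>R U"
proof -
  have s: "(c *\<^sub>R A) *v v = c *\<^sub>R (A *v v)" for c and A :: "real^2^2"
    by (simp add: vec_eq_iff forall_2 matrix_vector_mult_def sum_2 algebra_simps)
  have o: "outer U U *v v = (U \<bullet> v) *\<^sub>R U"
    by (simp add: vec_eq_iff forall_2 outer_def matrix_vector_mult_def sum_2 inner_2 algebra_simps)
  show ?thesis
    by (simp add: DT_op_def s o matrix_vector_mult_add_rdistrib)
qed

lemma lambda2_bounds:
  "m \<le> nu (norm U) + deriv_hl nu (norm U) * norm U"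
proof -
  have "m \<le> deriv_hl (\<lambda>s. nu s * s) (norm U)" using N1 by (simp add: cond_N1_def)
  then show ?thesis using flux_law_has_derivative(2)[OF Ck, of "norm U"] by simp
qed

text \<open>For a negative derivative of \<open>\<nu>\<close> the worst direction is that of \<open>U\<close>, where \<open>DT\<close> has the
eigenvalue \<open>(\<nu>(s) s)'\<close> at \<open>s = |U|\<close>.\<close>

lemma DT_coercive: "m * (norm v)\<^sup>2 \<le> (DT_op nu U *v v) \<bullet> v"
proof -
  define r d where "r = norm U" and "d = deriv_hl nu r"
  have r: "0 \<le> r" by (simp add: r_def)
  have eq: "(DT_op nu U *v v) \<bullet> v = nu r * (norm v)\<^sup>2 + d / r * (U \<bullet> v)\<^sup>2"
    unfolding DT_apply r_def[symmetric] d_def[symmetric] power2_norm_eq_inner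
    by (simp add: inner_add_left power2_eq_square)
  show ?thesis
  proof (cases "d \<ge> 0 \<or> r = 0")
    case True
    then have "0 \<le> d / r * (U \<bullet> v)\<^sup>2" using r by auto
    moreover have "m * (norm v)\<^sup>2 \<le> nu r * (norm v)\<^sup>2" using nu_bounds(1)[OF r] by (intro mult_right_mono) auto
    ultimately show ?thesis unfolding eq by linarith
  next
    case False
    then have r0: "0 < r" "d < 0" using r by auto
    have "(U \<bullet> v)\<^sup>2 \<le> (r * norm v)\<^sup>2"
      using Cauchy_Schwarz_ineq2[of U v] by (auto simp: r_def abs_le_square_iff[symmetric] abs_mult)
    then have "d / r * (r * norm v)\<^sup>2 \<le> d / r * (U \<bullet> v)\<^sup>2"
      using r0 by (intro mult_left_mono_neg) (auto simp: divide_nonpos_pos)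
    moreover have "d / r * (r * norm v)\<^sup>2 = d * r * (norm v)\<^sup>2" using r0 by (simp add: power2_eq_square)
    moreover have "m * (norm v)\<^sup>2 \<le> (nu r + d * r) * (norm v)\<^sup>2"
      using lambda2_bounds[of U] by (intro mult_right_mono) (auto simp: r_def d_def)
    ultimately show ?thesis unfolding eq by (simp add: algebra_simps)
  qed
qed

text \<open>On multiples \<open>t U\<close> the equation is scalar, with values \<open>0\<close> at \<open>t = 0\<close> and at least \<open>2 \<nu>0\<close> at
\<open>t = 2\<close>.\<close>

lemma exists_interior_field: "\<exists>b. T_op nu b + nu0 *\<^sub>R b = (2 * nu0) *\<^sub>R U"
proof -
  define r where "r = norm U"
  let ?h = "\<lambda>t. (nu (t * r) + nu0) * t"
  have "continuous_on {0..2} ?h"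
  proof -
    have "continuous_on {0..} nu"
      using Ck by (auto simp: Ck_hl_def intro: differentiable_imp_continuous_on)
    then have "continuous_on {0..2} (\<lambda>t. nu (t * r))"
      by (rule continuous_on_compose2) (auto intro!: continuous_intros simp: r_def)
    then show ?thesis by (intro continuous_intros)
  qed
  moreover have "?h 0 \<le> 2 * nu0" "2 * nu0 \<le> ?h 2" using nu0_pos nu_bounds(1)[of "2 * r"] m_pos by (auto simp: r_def)
  ultimately obtain t where t: "0 \<le> t" "?h t = 2 * nu0"
    using IVT'[of ?h 0 "2 * nu0" 2] by auto
  have "T_op nu (t *\<^sub>R U) + nu0 *\<^sub>R (t *\<^sub>R U) = ?h t *\<^sub>R U"
    using t(1) by (simp add: T_op_def r_def algebra_simps)
  then show ?thesis using t(2) by metis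
qed

end

text \<open>The columns of \<open>R\<close> are the axes in which the conjugated matrix is diagonal.\<close>

lemma conjugated_diagonal_apply:
  fixes R :: "real^2^2"
  shows "(R ** vector [vector [d, 0], vector [0, e]] ** transpose R) *v v
    = (d * (column 1 R \<bullet> v)) *\<^sub>R column 1 R + (e * (column 2 R \<bullet> v)) *\<^sub>R column 2 R"
  by (simp add: vec_eq_iff forall_2 matrix_vector_mult_def matrix_matrix_mult_def transpose_def column_def
      sum_2 inner_2 algebra_simps)

lemma orthogonal_columns:
  fixes R :: "real^2^2"
  assumes "orthogonal_matrix R"
  shows "column 1 R \<bullet> column 1 R = 1" "column 2 R \<bullet> column 2 R = 1" "column 1 R \<bullet> column 2 R = 0"
    "v = (column 1 R \<bullet> v) *\<^sub>R column 1 R + (column 2 R \<bullet> v) *\<^sub>R column 2 R"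
proof -
  have 1: "transpose R ** R = mat 1" and 2: "R ** transpose R = mat 1"
    using assms by (auto simp: orthogonal_matrix_def)
  have "(transpose R ** R) $ i $ j = column i R \<bullet> column j R" for i j
    by (simp add: matrix_matrix_mult_def transpose_def column_def inner_vec_def)
  then have e: "column i R \<bullet> column j R = (if i = j then 1 else 0)" for i j
    unfolding 1 by (metis (mono_tags, lifting) mat_def vec_lambda_beta)
  show "column 1 R \<bullet> column 1 R = 1" "column 2 R \<bullet> column 2 R = 1" "column 1 R \<bullet> column 2 R = 0"
    by (simp_all add: e)
  have "v = (R ** transpose R) *v v" unfolding 2 by simp
  also have "\<dots> = (column 1 R \<bullet> v) *\<^sub>R column 1 R + (column 2 R \<bullet> v) *\<^sub>R column 2 R"
    by (simp add: vec_eq_iff forall_2 matrix_vector_mult_def matrix_matrix_mult_def transpose_def column_def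
        sum_2 inner_2 algebra_simps)
  finally show "v = (column 1 R \<bullet> v) *\<^sub>R column 1 R + (column 2 R \<bullet> v) *\<^sub>R column 2 R" .
qed

lemma rotated_axis: "R *v vector [r, 0] = r *\<^sub>R column 1 (R :: real^2^2)"
  by (simp add: vec_eq_iff forall_2 matrix_vector_mult_def column_def sum_2)

section \<open>Averages over small discs and tails of the dipole\<close>

lemma L2_Lipschitz_comp:
  fixes N :: "real^2 \<Rightarrow> real^2"
  assumes f: "L2 A f" and N: "N 0 = 0" "\<And>v w. norm (N v - N w) \<le> L * norm (v - w)"
  shows "L2 A (\<lambda>x. N (f x))"
proof (rule L2_bound[OF f, where C = L])
  have [measurable]: "N \<in> borel_measurable borel"
    by (rule borel_measurable_continuous_onI[OF continuous_of_Lipschitz[OF N(2)]])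
  have [measurable]: "(\<lambda>x. indicator A x *\<^sub>R f x) \<in> borel_measurable lborel" by (rule L2_D1[OF f])
  have "(\<lambda>x. N (indicator A x *\<^sub>R f x)) \<in> borel_measurable lborel" by measurable
  also have "(\<lambda>x. N (indicator A x *\<^sub>R f x)) = (\<lambda>x. indicator A x *\<^sub>R N (f x))"
    by (auto simp: indicator_def N(1) fun_eq_iff)
  finally show "set_borel_measurable lborel A (\<lambda>x. N (f x))" by (simp add: set_borel_measurable_def)
  show "AE x in lborel. x \<in> A \<longrightarrow> norm (N (f x)) \<le> L * norm (f x)"
    using N(2)[of "f _" 0] N(1) by simp
qed

lemma L2_indicator:
  fixes f :: "real^2 \<Rightarrow> real^2"
  assumes "L2 A f" "B \<in> sets borel"
  shows "L2 A (\<lambda>x. indicator B x *\<^sub>R f x)"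
proof (rule L2_bound[OF assms(1), where C = 1])
  have [measurable]: "(\<lambda>x. indicator A x *\<^sub>R f x) \<in> borel_measurable lborel" "B \<in> sets borel"
    using L2_D1[OF assms(1)] assms(2) by auto
  have "(\<lambda>x. indicator B x *\<^sub>R (indicator A x *\<^sub>R f x)) \<in> borel_measurable lborel" by measurable
  then show "set_borel_measurable lborel A (\<lambda>x. indicator B x *\<^sub>R f x)"
    by (simp add: set_borel_measurable_def mult.commute)
qed (auto simp: indicator_def)

lemma L2_const_bounded:
  assumes "bounded D" "D \<in> sets borel"
  shows "L2 D (\<lambda>x. c :: real^2)"
proof -
  obtain r where "D \<subseteq> ball 0 r" using bounded_subset_ballD[OF assms(1), of 0] by auto
  then show ?thesis using L2_subset[OF L2_const_ball assms(2)] by blast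
qed

lemma set_integral_indicator_subset:
  fixes f :: "real^2 \<Rightarrow> 'b::{banach, second_countable_topology}"
  assumes "B \<subseteq> D"
  shows "(LINT x:D|lborel. indicator B x *\<^sub>R f x) = (LINT x:B|lborel. f x)"
  unfolding set_lebesgue_integral_def
  by (rule Bochner_Integration.integral_cong) (use assms in \<open>auto simp: indicator_def\<close>)

lemma scaled_unit_ball: "\<epsilon> > 0 \<Longrightarrow> scaled x0 (ball 0 1) \<epsilon> = ball x0 \<epsilon>"
  unfolding scaled_def
proof safe
  assume e: "\<epsilon> > 0"
  show "x0 + \<epsilon> *\<^sub>R y \<in> ball x0 \<epsilon>" if "y \<in> ball 0 1" for y using that e by (simp add: dist_norm)
  show "x \<in> (\<lambda>y. x0 + \<epsilon> *\<^sub>R y) ` ball 0 1" if "x \<in> ball x0 \<epsilon>" for x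
  proof (rule image_eqI[of _ _ "zoom x0 \<epsilon> x"])
    show "x = x0 + \<epsilon> *\<^sub>R zoom x0 \<epsilon> x" using e by (simp add: zoom_def)
    show "zoom x0 \<epsilon> x \<in> ball 0 1" using norm_zoom_less[OF e, of x0 x 1] that by simp
  qed
qed

lemma measure_ball_scale:
  assumes "\<epsilon> > 0"
  shows "measure lborel (ball (c :: real^2) \<epsilon>) = \<epsilon>\<^sup>2 * measure lborel (ball (0 :: real^2) 1)"
proof -
  have "(LINT x|lborel. indicator (ball (0::real^2) 1) (zoom c \<epsilon> x)) = \<epsilon>\<^sup>2 * (LINT z|lborel. indicator (ball (0::real^2) 1) z :: real)"
    by (rule integral_zoom[OF assms borel_measurable_indicator]) simp
  moreover have "(\<lambda>x. indicator (ball (0::real^2) 1) (zoom c \<epsilon> x) :: real) = indicator (ball c \<epsilon>)"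
    using norm_zoom_less[OF assms, of c _ 1] by (auto simp: indicator_def fun_eq_iff)
  ultimately show ?thesis by simp
qed

lemma set_integral_const_ball:
  "(LINT x:ball (c::real^2) r|lborel. (a :: 'b::euclidean_space)) = measure lborel (ball c r) *\<^sub>R a"
  using emeasure_lborel_ball_finite[of c r] by (intro set_integral_const) (auto simp: less_top)

lemma set_integrable_const_ball: "set_integrable lborel (ball (c :: real^2) r) (\<lambda>x. k :: real)"
proof -
  have "set_integrable lborel (cball c r) (\<lambda>x. k)"
    unfolding set_integrable_def by (rule borel_integrable_compact) auto
  then show ?thesis by (rule set_integrable_subset) auto
qed

lemma eventually_small_ball:
  assumes "open S" "x0 \<in> S"
  shows "\<forall>\<^sub>F \<epsilon> in at_right (0::real). ball x0 \<epsilon> \<subseteq> S"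
    "\<forall>\<^sub>F \<epsilon> in at_right (0::real). cball x0 (k * \<epsilon>) \<subseteq> S"
proof -
  obtain r where r: "r > 0" "ball x0 r \<subseteq> S" using assms open_contains_ball by blast
  have "\<forall>\<^sub>F \<epsilon> in at_right (0::real). \<epsilon> < r" using r(1) by (auto simp: eventually_at_right_field)
  then show "\<forall>\<^sub>F \<epsilon> in at_right (0::real). ball x0 \<epsilon> \<subseteq> S"
    by eventually_elim (use r(2) in auto)
  have "((\<lambda>\<epsilon>. k * \<epsilon>) \<longlongrightarrow> k * 0) (at_right 0)" by (intro tendsto_intros)
  then have "\<forall>\<^sub>F \<epsilon> in at_right (0::real). k * \<epsilon> < r" by (rule order_tendstoD) (use r(1) in simp)
  then show "\<forall>\<^sub>F \<epsilon> in at_right (0::real). cball x0 (k * \<epsilon>) \<subseteq> S"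
    by eventually_elim (use r(2) in auto)
qed

text \<open>Continuity of the classical gradient at \<open>x0\<close>, in the integrated form in which both the state and
the adjoint state use it.\<close>

lemma mean_oscillation_tendsto_0:
  assumes D: "open D" and A: "open A" "A \<subseteq> D" "x0 \<in> A" and w: "w \<in> H1 D" "C1_holder A \<beta> w" "\<beta> > 0"
  shows "((\<lambda>\<epsilon>. (LINT x:ball x0 \<epsilon>|lborel. (norm (wgrad D w x - grad w x0))\<^sup>2) / \<epsilon>\<^sup>2) \<longlongrightarrow> 0) (at_right 0)"
proof (rule tendstoI)
  fix e :: real assume e: "e > 0"
  note C = C1_holder_wgrad[OF D A(1,2) w]
  define M where "M = measure lborel (ball (0::real^2) 1)"
  define d where "d = sqrt (e / (2 * (M + 1)))"
  have M: "0 \<le> M" by (simp add: M_def)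
  then have pos: "0 < e / (2 * (M + 1))" using e by simp
  have "M / (2 * (M + 1)) < 1" using M by simp
  then have "e * (M / (2 * (M + 1))) < e * 1" using e by (intro mult_strict_left_mono)
  moreover have "d\<^sup>2 = e / (2 * (M + 1))" unfolding d_def using pos by (intro real_sqrt_pow2) simp
  ultimately have d: "0 < d" "d\<^sup>2 * M < e" using pos by (auto simp: d_def)
  have "isCont (grad w) x0" using C(1) A by (simp add: continuous_on_eq_continuous_at)
  then obtain r where r: "r > 0" "\<And>x. dist x x0 < r \<Longrightarrow> dist (grad w x) (grad w x0) < d"
    using d(1) unfolding continuous_at_eps_delta by blast
  have "\<forall>\<^sub>F \<epsilon> in at_right (0::real). \<epsilon> < r" using r(1) by (auto simp: eventually_at_right_field)
  with eventually_small_ball(1)[OF A(1,3)] eventually_at_right_less[of "0::real"]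
  show "\<forall>\<^sub>F \<epsilon> in at_right 0. dist ((LINT x:ball x0 \<epsilon>|lborel. (norm (wgrad D w x - grad w x0))\<^sup>2) / \<epsilon>\<^sup>2) 0 < e"
  proof eventually_elim
    case (elim \<epsilon>)
    have wL: "L2 (ball x0 \<epsilon>) (wgrad D w)"
      by (rule L2_subset[OF H1_D(2)[OF D w(1)]]) (use elim A(2) in auto)
    have "(LINT x:ball x0 \<epsilon>|lborel. (norm (wgrad D w x - grad w x0))\<^sup>2) \<le> (LINT x:ball x0 \<epsilon>|lborel. d\<^sup>2)"
    proof (rule set_integral_mono_AE)
      show "set_integrable lborel (ball x0 \<epsilon>) (\<lambda>x. (norm (wgrad D w x - grad w x0))\<^sup>2)"
        by (intro L2_D2 L2_diff wL L2_const_ball)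
      show "set_integrable lborel (ball x0 \<epsilon>) (\<lambda>x. d\<^sup>2)"
        by (rule set_integrable_const_ball)
      show "AE x\<in>ball x0 \<epsilon> in lborel. (norm (wgrad D w x - grad w x0))\<^sup>2 \<le> d\<^sup>2"
        using C(2)
      proof eventually_elim
        case (elim x)
        show ?case
        proof
          assume x: "x \<in> ball x0 \<epsilon>"
          then have "dist x x0 < r" using \<open>\<epsilon> < r\<close> by (simp add: dist_commute)
          then have "dist (grad w x) (grad w x0) < d" by (rule r(2))
          then have "norm (wgrad D w x - grad w x0) < d" using elim x \<open>ball x0 \<epsilon> \<subseteq> A\<close> by (auto simp: dist_norm)
          then show "(norm (wgrad D w x - grad w x0))\<^sup>2 \<le> d\<^sup>2" by (intro power_mono) auto
        qed
      qed
    qed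
    also have "\<dots> = d\<^sup>2 * M * \<epsilon>\<^sup>2" by (simp add: set_integral_const_ball measure_ball_scale[OF \<open>0 < \<epsilon>\<close>, of x0] M_def)
    finally have "(LINT x:ball x0 \<epsilon>|lborel. (norm (wgrad D w x - grad w x0))\<^sup>2) / \<epsilon>\<^sup>2 \<le> d\<^sup>2 * M"
      using elim by (simp add: divide_le_eq)
    moreover have "0 \<le> (LINT x:ball x0 \<epsilon>|lborel. (norm (wgrad D w x - grad w x0))\<^sup>2) / \<epsilon>\<^sup>2"
      by (intro divide_nonneg_nonneg set_integral_nonneg') auto
    ultimately show ?case using d(2) by (simp add: dist_real_def)
  qed
qed

lemma dipole_tail_tendsto_0:
  "((\<lambda>s. LINT z|lborel. indicator {z. s \<le> norm z} z * (norm (dipole a z))\<^sup>2) \<longlongrightarrow> 0) at_top"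
proof -
  have i: "integrable lborel (\<lambda>z. (norm (dipole a z))\<^sup>2)" using L2_dipole[of a] by (simp add: L2_UNIV_iff)
  have "((\<lambda>s. LINT z|lborel. indicator {z. s \<le> norm z} z * (norm (dipole a z))\<^sup>2) \<longlongrightarrow> (LINT z|(lborel :: (real^2) measure). 0)) at_top"
  proof (rule integral_dominated_convergence_at_top[OF _ _ i])
    show "\<forall>\<^sub>F s in at_top. AE z in lborel. norm (indicator {z. s \<le> norm z} z * (norm (dipole a z))\<^sup>2) \<le> (norm (dipole a z))\<^sup>2"
      by (intro always_eventually allI AE_I2) (auto simp: indicator_def)
    show "AE z in lborel. ((\<lambda>s. indicator {z. s \<le> norm z} z * (norm (dipole a z))\<^sup>2) \<longlongrightarrow> 0) at_top"
    proof (rule AE_I2)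
      fix z :: "real^2"
      show "((\<lambda>s. indicator {z. s \<le> norm z} z * (norm (dipole a z))\<^sup>2) \<longlongrightarrow> 0) at_top"
        by (rule tendsto_eventually, rule eventually_mono[OF eventually_gt_at_top[of "norm z"]]) auto
    qed
  qed measurable
  then show ?thesis by simp
qed

lemma young_lower_bound:
  fixes m c t s :: real
  assumes "m > 0"
  shows "m / 2 * t\<^sup>2 - c\<^sup>2 / (2 * m) * s\<^sup>2 \<le> m * t\<^sup>2 - c * t * s"
proof -
  have "0 \<le> (m * t - c * s)\<^sup>2 / (2 * m)" using assms by simp
  also have "\<dots> = (m\<^sup>2 * t\<^sup>2) / (2 * m) - (2 * m * t * c * s) / (2 * m) + (c\<^sup>2 * s\<^sup>2) / (2 * m)"
    by (simp add: power2_diff power_mult_distrib add_divide_distrib diff_divide_distrib ac_simps)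
  also have "\<dots> = m / 2 * t\<^sup>2 - c * t * s + c\<^sup>2 / (2 * m) * s\<^sup>2"
    using assms by (simp add: power2_eq_square)
  finally show ?thesis by (simp add: algebra_simps)
qed

section \<open>Asymptotics of the perturbed state\<close>

text \<open>The Young inequality absorbs the mixed terms into half of the coercive term. In the application
\<open>A\<close> is the error, \<open>\<Delta>\<close> the increment of the material law, \<open>d\<close> the oscillation of the unperturbed
gradient, and \<open>k\<close> the defect of the competitor.\<close>

lemma monotone_remainder_lower_bound:
  fixes \<Delta> A d k :: "real^2"
  assumes m: "m > 0" and n: "n \<ge> 0"
    and mono: "m * (norm A)\<^sup>2 \<le> \<Delta> \<bullet> A" and lip: "norm \<Delta> \<le> 2 * n * norm A"
  shows "m / 2 * (norm A)\<^sup>2 - 2 * ((3 * n)\<^sup>2 / (2 * m) + n) * ((norm d)\<^sup>2 + (norm k)\<^sup>2)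
    \<le> (\<Delta> - n *\<^sub>R d) \<bullet> (A - d + k)"
proof -
  define t s where "t = norm A" and "s = norm k + norm d"
  have ts: "0 \<le> t" "0 \<le> s" "norm d \<le> s" "norm (k - d) \<le> s"
    using norm_triangle_ineq4[of k d] by (auto simp: t_def s_def)
  have lower: "- (norm x * norm y) \<le> x \<bullet> y" for x y :: "real^2"
    using Cauchy_Schwarz_ineq2[of x y] by linarith
  have "- (2 * n * t * s) \<le> \<Delta> \<bullet> (k - d)"
    using lower[of \<Delta> "k - d"] mult_mono[OF lip ts(4)] n ts by (simp add: t_def)
  moreover have "n * (d \<bullet> A) \<le> n * (s * t)"
    using norm_cauchy_schwarz[of d A] mult_right_mono[OF ts(3,1)] n by (intro mult_left_mono) (auto simp: t_def)
  moreover have "n * (d \<bullet> (k - d)) \<le> n * (s * s)"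
    using norm_cauchy_schwarz[of d "k - d"] mult_mono[OF ts(3,4)] n ts by (intro mult_left_mono) auto
  moreover have "(\<Delta> - n *\<^sub>R d) \<bullet> (A - d + k) = \<Delta> \<bullet> A + \<Delta> \<bullet> (k - d) - n * (d \<bullet> A) - n * (d \<bullet> (k - d))"
    by (simp add: inner_diff_left inner_diff_right inner_add_right algebra_simps)
  ultimately have 1: "m * t\<^sup>2 - (3 * n) * t * s - n * s\<^sup>2 \<le> (\<Delta> - n *\<^sub>R d) \<bullet> (A - d + k)"
    using mono by (simp add: t_def power2_eq_square algebra_simps)
  have "0 \<le> (norm k - norm d)\<^sup>2" by simp
  then have "s\<^sup>2 \<le> 2 * ((norm d)\<^sup>2 + (norm k)\<^sup>2)" by (simp add: s_def power2_eq_square algebra_simps)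
  then have "((3 * n)\<^sup>2 / (2 * m) + n) * s\<^sup>2 \<le> ((3 * n)\<^sup>2 / (2 * m) + n) * (2 * ((norm d)\<^sup>2 + (norm k)\<^sup>2))"
    using m n by (intro mult_left_mono) auto
  then have 2: "(3 * n)\<^sup>2 / (2 * m) * s\<^sup>2 + n * s\<^sup>2 \<le> 2 * ((3 * n)\<^sup>2 / (2 * m) + n) * ((norm d)\<^sup>2 + (norm k)\<^sup>2)"
    by (simp only: distrib_right mult.assoc mult.left_commute[of _ 2])
  show ?thesis using 1 2 young_lower_bound[OF m, of t "3 * n" s] unfolding t_def[symmetric] by linarith
qed

text \<open>The vector \<open>b\<close> is the total field in the rescaled inclusion in the limit of small \<open>\<epsilon>\<close>.\<close>

locale inclusion = material nu0 m nu for nu0 m :: real and nu :: "real \<Rightarrow> real" +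
  fixes D Omd :: "(real^2) set" and x0 b :: "real^2"
    and F :: "(real^2 \<Rightarrow> real) \<Rightarrow> real" and u :: "real \<Rightarrow> real^2 \<Rightarrow> real"
  assumes D: "open D" "bounded D" and Omd: "open Omd" "Omd \<subseteq> D" "x0 \<in> Omd"
    and u0: "solves_linear D nu0 F (u 0)"
    and u_eps: "\<And>\<epsilon>. \<epsilon> > 0 \<Longrightarrow> solves_perturbed D nu0 nu F (scaled x0 (ball 0 1) \<epsilon>) (u \<epsilon>)"
    and u0_reg: "\<exists>\<beta>>0. C1_holder Omd \<beta> (u 0)"
    and b: "T_op nu b + nu0 *\<^sub>R b = (2 * nu0) *\<^sub>R grad (u 0) x0"
begin

definition Du :: "real \<Rightarrow> real^2 \<Rightarrow> real^2" where
  "Du \<epsilon> = wgrad D (u \<epsilon>)"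

text \<open>The oscillation of the unperturbed gradient on the inclusion.\<close>

definition core :: "real \<Rightarrow> real^2 \<Rightarrow> real^2" where
  "core \<epsilon> x = indicator (ball x0 \<epsilon>) x *\<^sub>R (Du 0 x - grad (u 0) x0)"

text \<open>The predicted correction of the gradient.\<close>

definition layer :: "real \<Rightarrow> real^2 \<Rightarrow> real^2" where
  "layer \<epsilon> x = dipole (b - grad (u 0) x0) (zoom x0 \<epsilon> x)"

text \<open>Outside the inclusion this is the error of the prediction. Inside, the term \<open>core\<close> replaces the
unperturbed gradient by its value at \<open>x0\<close>, so that \<open>err\<close> becomes \<open>Du \<epsilon> x - b\<close>.\<close>

definition err :: "real \<Rightarrow> real^2 \<Rightarrow> real^2" where
  "err \<epsilon> x = Du \<epsilon> x - Du 0 x - layer \<epsilon> x + core \<epsilon> x"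

definition flow :: "real \<Rightarrow> real^2 \<Rightarrow> real^2" where
  "flow \<epsilon> x = T_eps D nu0 nu (ball x0 \<epsilon>) x (Du \<epsilon> x)"

lemma D_borel: "D \<in> sets borel" using D(1) by simp

lemma u_H10: "0 \<le> \<epsilon> \<Longrightarrow> u \<epsilon> \<in> H10 D"
  using u0 u_eps[of \<epsilon>] by (cases "\<epsilon> = 0") (auto simp: solves_linear_def solves_perturbed_def)

lemma Du_L2: "0 \<le> \<epsilon> \<Longrightarrow> L2 D (Du \<epsilon>)"
  unfolding Du_def by (rule H1_D(2)[OF D(1) H10_H1[OF u_H10]])

lemma core_L2: "L2 D (core \<epsilon>)"
  unfolding core_def[abs_def]
  by (intro L2_indicator L2_diff Du_L2 L2_const_bounded[OF D(2) D_borel]) auto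

lemma layer_L2_UNIV: "0 < \<epsilon> \<Longrightarrow> L2 UNIV (layer \<epsilon>)"
  unfolding layer_def[abs_def] by (rule L2_zoom[OF _ L2_dipole])

lemma layer_L2: "0 < \<epsilon> \<Longrightarrow> L2 D (layer \<epsilon>)"
  using L2_subset[OF layer_L2_UNIV D_borel] by simp

lemma err_L2: "0 < \<epsilon> \<Longrightarrow> L2 D (err \<epsilon>)"
  unfolding err_def[abs_def] by (intro L2_add L2_diff Du_L2 layer_L2 core_L2) auto

lemma T_0: "T_op nu 0 = 0" by (simp add: T_op_def)

lemma flow_L2:
  assumes "0 < \<epsilon>"
  shows "L2 D (flow \<epsilon>)"
  unfolding flow_def[abs_def] T_eps_def using assms D_borel
  by (intro L2_add L2_indicator L2_scaleR L2_Lipschitz_comp[OF Du_L2 T_0 T_Lipschitz] Du_L2) auto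

lemma state_equations:
  assumes "0 < \<epsilon>" "\<eta> \<in> H10 D"
  shows "(LINT x:D|lborel. flow \<epsilon> x \<bullet> wgrad D \<eta> x) = (LINT x:D|lborel. (nu0 *\<^sub>R Du 0 x) \<bullet> wgrad D \<eta> x)"
  using u_eps[OF assms(1)] u0 assms(2)
  by (simp add: solves_perturbed_def solves_linear_def scaled_unit_ball[OF assms(1)] flow_def Du_def)

lemma layer_in_core: "x \<in> ball x0 \<epsilon> \<Longrightarrow> 0 < \<epsilon> \<Longrightarrow> layer \<epsilon> x = b - grad (u 0) x0"
  using norm_zoom_less[of \<epsilon> x0 x 1] by (simp add: layer_def dipole_def)

lemma err_in_core: "x \<in> ball x0 \<epsilon> \<Longrightarrow> 0 < \<epsilon> \<Longrightarrow> err \<epsilon> x = Du \<epsilon> x - b"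
  by (simp add: err_def layer_in_core core_def)

text \<open>The flux of the corrector does not contribute to the weak formulation and may be subtracted.
Inside the inclusion the equation for \<open>b\<close> turns the rest into the increment of \<open>T\<close> from \<open>b\<close>;
outside it is \<open>\<nu>0\<close> times the error. Both are monotone in the error.\<close>

lemma residual_decomposition:
  assumes e: "0 < \<epsilon>" "ball x0 \<epsilon> \<subseteq> D" and x: "x \<in> D"
  shows "\<exists>\<Delta>. flow \<epsilon> x - nu0 *\<^sub>R Du 0 x - nu0 *\<^sub>R flux (b - grad (u 0) x0) (zoom x0 \<epsilon> x) = \<Delta> - nu0 *\<^sub>R core \<epsilon> x
    \<and> m * (norm (err \<epsilon> x))\<^sup>2 \<le> \<Delta> \<bullet> err \<epsilon> x \<and> norm \<Delta> \<le> 2 * nu0 * norm (err \<epsilon> x)"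
proof (cases "x \<in> ball x0 \<epsilon>")
  case True
  have f: "flux (b - grad (u 0) x0) (zoom x0 \<epsilon> x) = - (b - grad (u 0) x0)"
    using norm_zoom_less[OF e(1), of x0 x 1] True by (simp add: flux_def)
  have t: "T_op nu b = nu0 *\<^sub>R grad (u 0) x0 + nu0 *\<^sub>R grad (u 0) x0 - nu0 *\<^sub>R b"
  proof -
    have "(2 * nu0) *\<^sub>R grad (u 0) x0 = nu0 *\<^sub>R grad (u 0) x0 + nu0 *\<^sub>R grad (u 0) x0"
      by (simp flip: scaleR_left_distrib)
    then show ?thesis using b by (simp add: eq_diff_eq)
  qed
  have "flow \<epsilon> x - nu0 *\<^sub>R Du 0 x - nu0 *\<^sub>R flux (b - grad (u 0) x0) (zoom x0 \<epsilon> x)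
      = (T_op nu (Du \<epsilon> x) - T_op nu b) - nu0 *\<^sub>R core \<epsilon> x"
    unfolding f t using True by (simp add: flow_def T_eps_def core_def scaleR_diff_right)
  then show ?thesis
    using T_strongly_monotone[of "Du \<epsilon> x" b] T_Lipschitz[of "Du \<epsilon> x" b] err_in_core[OF True e(1)] by auto
next
  case False
  have "flux (b - grad (u 0) x0) (zoom x0 \<epsilon> x) = layer \<epsilon> x"
    using norm_zoom_less[OF e(1), of x0 x 1] False by (simp add: flux_def layer_def)
  then have "flow \<epsilon> x - nu0 *\<^sub>R Du 0 x - nu0 *\<^sub>R flux (b - grad (u 0) x0) (zoom x0 \<epsilon> x)
      = nu0 *\<^sub>R err \<epsilon> x - nu0 *\<^sub>R core \<epsilon> x"
    using False x by (simp add: flow_def T_eps_def core_def err_def algebra_simps)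
  moreover have "m * (norm (err \<epsilon> x))\<^sup>2 \<le> (nu0 *\<^sub>R err \<epsilon> x) \<bullet> err \<epsilon> x"
    using m_le_nu0 by (auto simp: power2_norm_eq_inner intro!: mult_right_mono)
  moreover have "norm (nu0 *\<^sub>R err \<epsilon> x) \<le> 2 * nu0 * norm (err \<epsilon> x)"
    using nu0_pos by auto
  ultimately show ?thesis by blast
qed

text \<open>Quasi-optimality: \<open>v\<close> is an arbitrary competitor for the corrector, and the only errors are its
distance to \<open>layer\<close> and the oscillation \<open>core\<close>.\<close>

lemma energy_estimate:
  assumes e: "0 < \<epsilon>" "ball x0 \<epsilon> \<subseteq> D" and v: "v \<in> test_fun D"
  shows "m / 2 * (LINT x:D|lborel. (norm (err \<epsilon> x))\<^sup>2)
    \<le> 2 * ((3 * nu0)\<^sup>2 / (2 * m) + nu0) *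
      ((LINT x:D|lborel. (norm (core \<epsilon> x))\<^sup>2) + (LINT x:D|lborel. (norm (layer \<epsilon> x - grad v x))\<^sup>2))"
    (is "_ \<le> ?C * _")
proof -
  \<comment> \<open>The test function is the difference of the two approximations of the corrector.\<close>
  define \<eta> where "\<eta> = (\<lambda>x. (u \<epsilon> x - u 0 x) - v x)"
  define W where "W x = flow \<epsilon> x - nu0 *\<^sub>R Du 0 x - nu0 *\<^sub>R flux (b - grad (u 0) x0) (zoom x0 \<epsilon> x)" for x
  have uu: "(\<lambda>x. u \<epsilon> x - u 0 x) \<in> H10 D" by (rule H10_diff[OF D(1) u_H10 u_H10]) (use e in auto)
  have \<eta>: "\<eta> \<in> H10 D" unfolding \<eta>_def by (rule H10_diff[OF D(1) uu test_fun_H10[OF D(1) v]])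
  have yL: "L2 D (wgrad D \<eta>)" by (rule H1_D(2)[OF D(1) H10_H1[OF \<eta>]])
  have FL: "L2 D (\<lambda>x. flux (b - grad (u 0) x0) (zoom x0 \<epsilon> x))"
    by (rule L2_subset[OF flux_zoom_L2[OF e(1)] D_borel]) simp
  have q0L: "L2 D (\<lambda>x. nu0 *\<^sub>R Du 0 x)" by (intro L2_scaleR Du_L2) simp
  have FL': "L2 D (\<lambda>x. nu0 *\<^sub>R flux (b - grad (u 0) x0) (zoom x0 \<epsilon> x))" by (rule L2_scaleR[OF FL])
  have WL: "L2 D W" unfolding W_def[abs_def] by (intro L2_diff flow_L2 q0L FL' e)
  have gvL: "L2 D (grad v)" by (rule L2_subset[OF test_fun_grad_L2[OF v] D_borel]) simp
  have kL: "L2 D (\<lambda>x. layer \<epsilon> x - grad v x)" by (intro L2_diff layer_L2 gvL e)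
  have "(LINT x:D|lborel. W x \<bullet> wgrad D \<eta> x)
    = (LINT x:D|lborel. (flow \<epsilon> x \<bullet> wgrad D \<eta> x - (nu0 *\<^sub>R Du 0 x) \<bullet> wgrad D \<eta> x)
        - (nu0 *\<^sub>R flux (b - grad (u 0) x0) (zoom x0 \<epsilon> x)) \<bullet> wgrad D \<eta> x)"
    by (simp only: W_def inner_diff_left)
  also have "\<dots> = (LINT x:D|lborel. flow \<epsilon> x \<bullet> wgrad D \<eta> x - (nu0 *\<^sub>R Du 0 x) \<bullet> wgrad D \<eta> x)
        - (LINT x:D|lborel. (nu0 *\<^sub>R flux (b - grad (u 0) x0) (zoom x0 \<epsilon> x)) \<bullet> wgrad D \<eta> x)"
    by (intro set_integral_diff L2_inner flow_L2 q0L yL FL' e)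
  also have "(LINT x:D|lborel. flow \<epsilon> x \<bullet> wgrad D \<eta> x - (nu0 *\<^sub>R Du 0 x) \<bullet> wgrad D \<eta> x)
      = (LINT x:D|lborel. flow \<epsilon> x \<bullet> wgrad D \<eta> x) - (LINT x:D|lborel. (nu0 *\<^sub>R Du 0 x) \<bullet> wgrad D \<eta> x)"
    by (intro set_integral_diff L2_inner flow_L2 q0L yL e)
  also have "(LINT x:D|lborel. (nu0 *\<^sub>R flux (b - grad (u 0) x0) (zoom x0 \<epsilon> x)) \<bullet> wgrad D \<eta> x) = 0"
    using flux_orthogonal_H10[OF D(1) \<eta> e(1)] by simp
  finally have zero: "(LINT x:D|lborel. W x \<bullet> wgrad D \<eta> x) = 0"
    using state_equations[OF e(1) \<eta>] by simp
  have y: "AE x in lborel. x \<in> D \<longrightarrow> wgrad D \<eta> x = err \<epsilon> x - core \<epsilon> x + (layer \<epsilon> x - grad v x)"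
    using wgrad_diff_AE[OF D(1) H10_H1[OF uu] test_fun_H1[OF D(1) v]]
      wgrad_diff_AE[OF D(1) H10_H1[OF u_H10] H10_H1[OF u_H10], of \<epsilon> 0, OF less_imp_le[OF e(1)] order_refl]
      wgrad_test_fun_AE[OF D(1) v]
    unfolding \<eta>_def[symmetric]
    by eventually_elim (auto simp: err_def Du_def)
  have "(LINT x:D|lborel. m / 2 * (norm (err \<epsilon> x))\<^sup>2
        - ?C * ((norm (core \<epsilon> x))\<^sup>2 + (norm (layer \<epsilon> x - grad v x))\<^sup>2)) \<le> (LINT x:D|lborel. W x \<bullet> wgrad D \<eta> x)"
  proof (rule set_integral_mono_AE)
    show "set_integrable lborel D (\<lambda>x. m / 2 * (norm (err \<epsilon> x))\<^sup>2
        - ?C * ((norm (core \<epsilon> x))\<^sup>2 + (norm (layer \<epsilon> x - grad v x))\<^sup>2))"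
      by (intro set_integral_diff set_integrable_mult_right set_integral_add L2_D2 err_L2 core_L2 kL e)
    show "set_integrable lborel D (\<lambda>x. W x \<bullet> wgrad D \<eta> x)" by (rule L2_inner[OF WL yL])
    show "AE x\<in>D in lborel. m / 2 * (norm (err \<epsilon> x))\<^sup>2
        - ?C * ((norm (core \<epsilon> x))\<^sup>2 + (norm (layer \<epsilon> x - grad v x))\<^sup>2) \<le> W x \<bullet> wgrad D \<eta> x"
      using y
    proof eventually_elim
      case (elim x)
      show ?case
      proof
        assume x: "x \<in> D"
        obtain \<Delta> where \<Delta>: "W x = \<Delta> - nu0 *\<^sub>R core \<epsilon> x"
          "m * (norm (err \<epsilon> x))\<^sup>2 \<le> \<Delta> \<bullet> err \<epsilon> x" "norm \<Delta> \<le> 2 * nu0 * norm (err \<epsilon> x)"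
          using residual_decomposition[OF e x] unfolding W_def by blast
        have "wgrad D \<eta> x = err \<epsilon> x - core \<epsilon> x + (layer \<epsilon> x - grad v x)" using elim x by blast
        then show "m / 2 * (norm (err \<epsilon> x))\<^sup>2
          - ?C * ((norm (core \<epsilon> x))\<^sup>2 + (norm (layer \<epsilon> x - grad v x))\<^sup>2) \<le> W x \<bullet> wgrad D \<eta> x"
          unfolding \<Delta>(1)
          using monotone_remainder_lower_bound[OF m_pos less_imp_le[OF nu0_pos] \<Delta>(2,3), of "core \<epsilon> x" "layer \<epsilon> x - grad v x"]
          by simp
      qed
    qed
  qed
  also have "(LINT x:D|lborel. m / 2 * (norm (err \<epsilon> x))\<^sup>2
        - ?C * ((norm (core \<epsilon> x))\<^sup>2 + (norm (layer \<epsilon> x - grad v x))\<^sup>2))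
    = (LINT x:D|lborel. m / 2 * (norm (err \<epsilon> x))\<^sup>2)
      - (LINT x:D|lborel. ?C * ((norm (core \<epsilon> x))\<^sup>2 + (norm (layer \<epsilon> x - grad v x))\<^sup>2))"
    by (intro set_integral_diff set_integrable_mult_right set_integral_add L2_D2 err_L2 core_L2 kL e)
  also have "(LINT x:D|lborel. ?C * ((norm (core \<epsilon> x))\<^sup>2 + (norm (layer \<epsilon> x - grad v x))\<^sup>2))
    = ?C * ((LINT x:D|lborel. (norm (core \<epsilon> x))\<^sup>2) + (LINT x:D|lborel. (norm (layer \<epsilon> x - grad v x))\<^sup>2))"
    unfolding set_integral_mult_right
    by (subst set_integral_add) (auto intro: L2_D2 core_L2 kL)
  finally show ?thesis unfolding zero set_integral_mult_right by linarith
qed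

lemma core_energy_tendsto: "((\<lambda>\<epsilon>. (LINT x:D|lborel. (norm (core \<epsilon> x))\<^sup>2) / \<epsilon>\<^sup>2) \<longlongrightarrow> 0) (at_right 0)"
proof -
  obtain \<beta> where \<beta>: "\<beta> > 0" "C1_holder Omd \<beta> (u 0)" using u0_reg by blast
  have "((\<lambda>\<epsilon>. (LINT x:ball x0 \<epsilon>|lborel. (norm (wgrad D (u 0) x - grad (u 0) x0))\<^sup>2) / \<epsilon>\<^sup>2) \<longlongrightarrow> 0) (at_right 0)"
    by (rule mean_oscillation_tendsto_0[OF D(1) Omd H10_H1[OF u_H10] \<beta>(2,1)]) simp
  then show ?thesis
  proof (rule Lim_transform_eventually)
    show "\<forall>\<^sub>F \<epsilon> in at_right 0. (LINT x:ball x0 \<epsilon>|lborel. (norm (wgrad D (u 0) x - grad (u 0) x0))\<^sup>2) / \<epsilon>\<^sup>2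
      = (LINT x:D|lborel. (norm (core \<epsilon> x))\<^sup>2) / \<epsilon>\<^sup>2"
      using eventually_small_ball(1)[OF Omd(1,3)]
    proof eventually_elim
      case (elim \<epsilon>)
      then have "ball x0 \<epsilon> \<subseteq> D" using Omd(2) by blast
      have "(\<lambda>x. (norm (core \<epsilon> x))\<^sup>2) = (\<lambda>x. indicator (ball x0 \<epsilon>) x *\<^sub>R (norm (Du 0 x - grad (u 0) x0))\<^sup>2)"
        by (auto simp: core_def indicator_def fun_eq_iff)
      then show ?case using set_integral_indicator_subset[OF \<open>ball x0 \<epsilon> \<subseteq> D\<close>, of "\<lambda>x. (norm (Du 0 x - grad (u 0) x0))\<^sup>2"]
        by (simp add: Du_def)
    qed
  qed
qed

text \<open>First fix an approximation of the dipole potential by a function with compact support; it is an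
admissible competitor as soon as its rescaled support lies in \<open>D\<close>.\<close>

lemma err_energy_tendsto: "((\<lambda>\<epsilon>. (LINT x:D|lborel. (norm (err \<epsilon> x))\<^sup>2) / \<epsilon>\<^sup>2) \<longlongrightarrow> 0) (at_right 0)"
proof (rule tendstoI)
  fix e :: real assume e: "e > 0"
  define C where "C = 2 * ((3 * nu0)\<^sup>2 / (2 * m) + nu0) / (m / 2)"
  have C: "0 < C" using m_pos nu0_pos by (auto simp: C_def intro!: divide_pos_pos mult_pos_pos add_pos_pos)
  define a where "a = b - grad (u 0) x0"
  define \<kappa> where "\<kappa> n = (LINT z|lborel. (norm (grad (dipole_approx a (Suc n)) z - dipole a z))\<^sup>2)" for n
  have "\<kappa> \<longlonglongrightarrow> 0" unfolding \<kappa>_def[abs_def] by (rule L2_grad_dipole_approx_tendsto)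
  then have "\<forall>\<^sub>F n in sequentially. \<kappa> n < e / (2 * C)" by (rule order_tendstoD) (use e C in simp)
  then obtain n where n: "\<kappa> n < e / (2 * C)" by (auto simp: eventually_sequentially)
  have "\<forall>\<^sub>F \<epsilon> in at_right 0. (LINT x:D|lborel. (norm (core \<epsilon> x))\<^sup>2) / \<epsilon>\<^sup>2 < e / (2 * C)"
    using core_energy_tendsto by (rule order_tendstoD) (use e C in simp)
  with eventually_small_ball(1)[OF D(1) subsetD[OF Omd(2,3)]]
    eventually_small_ball(2)[OF D(1) subsetD[OF Omd(2,3)], of "sqrt (real (Suc n))"] eventually_at_right_less[of "0::real"]
  show "\<forall>\<^sub>F \<epsilon> in at_right 0. dist ((LINT x:D|lborel. (norm (err \<epsilon> x))\<^sup>2) / \<epsilon>\<^sup>2) 0 < e"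
  proof eventually_elim
    case (elim \<epsilon>)
    define v where "v = scaled_approx a (Suc n) x0 \<epsilon>"
    define E where "E = (LINT x:D|lborel. (norm (err \<epsilon> x))\<^sup>2)"
    define c where "c = (LINT x:D|lborel. (norm (core \<epsilon> x))\<^sup>2)"
    have v: "v \<in> test_fun D" unfolding v_def by (rule scaled_approx_test_fun) (use elim in auto)
    have L: "L2 UNIV (\<lambda>x. layer \<epsilon> x - grad v x)" by (intro L2_diff layer_L2_UNIV test_fun_grad_L2[OF v] elim)
    have "(LINT x:D|lborel. (norm (layer \<epsilon> x - grad v x))\<^sup>2) \<le> (LINT x|lborel. (norm (layer \<epsilon> x - grad v x))\<^sup>2)"
      unfolding set_lebesgue_integral_def
    proof (rule integral_mono)
      show "integrable lborel (\<lambda>x. (norm (layer \<epsilon> x - grad v x))\<^sup>2)" using L by (simp add: L2_UNIV_iff)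
      show "integrable lborel (\<lambda>x. indicator D x *\<^sub>R (norm (layer \<epsilon> x - grad v x))\<^sup>2)"
        using L2_D2[OF L2_subset[OF L D_borel]] by (simp add: set_integrable_def)
    qed (auto simp: indicator_def)
    also have "\<dots> = \<epsilon>\<^sup>2 * \<kappa> n"
      using integral_grad_scaled_approx[OF \<open>0 < \<epsilon>\<close>, of a n x0]
      by (simp add: v_def layer_def a_def[symmetric] \<kappa>_def norm_minus_commute)
    finally have k: "(LINT x:D|lborel. (norm (layer \<epsilon> x - grad v x))\<^sup>2) \<le> \<epsilon>\<^sup>2 * \<kappa> n" .
    have "m / 2 * E \<le> 2 * ((3 * nu0)\<^sup>2 / (2 * m) + nu0) * (c + \<epsilon>\<^sup>2 * \<kappa> n)"
    proof -
      have "2 * ((3 * nu0)\<^sup>2 / (2 * m) + nu0) * (c + (LINT x:D|lborel. (norm (layer \<epsilon> x - grad v x))\<^sup>2))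
          \<le> 2 * ((3 * nu0)\<^sup>2 / (2 * m) + nu0) * (c + \<epsilon>\<^sup>2 * \<kappa> n)"
        using k nu0_pos m_pos by (intro mult_left_mono) auto
      then show ?thesis
        using energy_estimate[OF \<open>0 < \<epsilon>\<close> elim(1) v] unfolding E_def c_def by linarith
    qed
    then have "E \<le> C * (c + \<epsilon>\<^sup>2 * \<kappa> n)"
      using m_pos by (simp add: C_def field_simps)
    then have "E / \<epsilon>\<^sup>2 \<le> C * (c + \<epsilon>\<^sup>2 * \<kappa> n) / \<epsilon>\<^sup>2" by (rule divide_right_mono) simp
    also have "\<dots> = C * (c / \<epsilon>\<^sup>2 + \<kappa> n)" using \<open>0 < \<epsilon>\<close> by (simp add: field_simps)
    also have "\<dots> < C * (e / (2 * C) + e / (2 * C))"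
      using elim(4) n C unfolding c_def by (intro mult_strict_left_mono add_strict_mono) auto
    also have "\<dots> = e" using C by simp
    finally have "E / \<epsilon>\<^sup>2 < e" .
    moreover have "0 \<le> E / \<epsilon>\<^sup>2" unfolding E_def by (intro divide_nonneg_nonneg set_integral_nonneg') auto
    ultimately show ?case by (simp add: E_def dist_real_def)
  qed
qed

end

section \<open>The topological derivative\<close>

lemma tendsto_0_of_square:
  fixes f :: "'a \<Rightarrow> real"
  assumes "((\<lambda>x. (f x)\<^sup>2) \<longlongrightarrow> 0) F"
  shows "(f \<longlongrightarrow> 0) F"
  using tendsto_real_sqrt[OF assms] by (auto intro: tendsto_rabs_zero_cancel)

lemma set_integral_mono_set:
  fixes f :: "real^2 \<Rightarrow> real"
  assumes "set_integrable lborel D f" "B \<in> sets borel" "B \<subseteq> D" "\<And>x. 0 \<le> f x"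
  shows "(LINT x:B|lborel. f x) \<le> (LINT x:D|lborel. f x)"
  unfolding set_lebesgue_integral_def
  using assms set_integrable_subset[OF assms(1), of B]
  by (intro integral_mono) (auto simp: set_integrable_def indicator_def)

context inclusion
begin

text \<open>The contrast between the two material laws.\<close>

definition gap :: "real^2 \<Rightarrow> real^2" where
  "gap v = T_op nu v - nu0 *\<^sub>R v"

lemma gap_Lipschitz: "norm (gap v - gap w) \<le> 3 * nu0 * norm (v - w)"
proof -
  have "gap v - gap w = (T_op nu v - T_op nu w) - nu0 *\<^sub>R (v - w)"
    by (simp add: gap_def algebra_simps)
  then have "norm (gap v - gap w) \<le> norm (T_op nu v - T_op nu w) + norm (nu0 *\<^sub>R (v - w))"
    by (simp add: norm_triangle_ineq4 del: norm_scaleR)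
  then show ?thesis using T_Lipschitz[of v w] nu0_pos by simp
qed

lemma gap_0: "gap 0 = 0" by (simp add: gap_def T_0)

text \<open>The adjoint equation is tested with \<open>u \<epsilon> - u 0\<close>, both state equations with \<open>p0\<close>; outside the
inclusion all terms cancel.\<close>

lemma adjoint_representation:
  assumes e: "0 < \<epsilon>" "ball x0 \<epsilon> \<subseteq> D" and p0: "solves_linear D nu0 (\<lambda>\<eta>. - G \<eta>) p0"
  shows "G (\<lambda>x. u \<epsilon> x - u 0 x) = (LINT x:ball x0 \<epsilon>|lborel. gap (Du \<epsilon> x) \<bullet> wgrad D p0 x)"
proof -
  let ?p = "wgrad D p0"
  have p: "p0 \<in> H10 D" using p0 by (simp add: solves_linear_def)
  have pL: "L2 D ?p" by (rule H1_D(2)[OF D(1) H10_H1[OF p]])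
  have u: "u \<epsilon> \<in> H10 D" "u 0 \<in> H10 D" using u_H10 e by auto
  have uu: "(\<lambda>x. u \<epsilon> x - u 0 x) \<in> H10 D" by (rule H10_diff[OF D(1) u])
  have qL: "L2 D (Du \<epsilon>)" "L2 D (Du 0)" using Du_L2 e by auto
  have "- G (\<lambda>x. u \<epsilon> x - u 0 x) = (LINT x:D|lborel. nu0 * (?p x \<bullet> wgrad D (\<lambda>x. u \<epsilon> x - u 0 x) x))"
    using p0 uu by (simp add: solves_linear_def)
  also have "\<dots> = (LINT x:D|lborel. (nu0 *\<^sub>R Du \<epsilon> x) \<bullet> ?p x - (nu0 *\<^sub>R Du 0 x) \<bullet> ?p x)"
  proof (rule set_integral_cong_AE')
    show "AE x in lborel. x \<in> D \<longrightarrow> nu0 * (?p x \<bullet> wgrad D (\<lambda>x. u \<epsilon> x - u 0 x) x)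
      = (nu0 *\<^sub>R Du \<epsilon> x) \<bullet> ?p x - (nu0 *\<^sub>R Du 0 x) \<bullet> ?p x"
      using wgrad_diff_AE[OF D(1) H10_H1[OF u(1)] H10_H1[OF u(2)]]
      by eventually_elim (auto simp: Du_def inner_diff_right inner_commute right_diff_distrib)
    have "set_borel_measurable lborel D (\<lambda>x. ?p x \<bullet> (nu0 *\<^sub>R wgrad D (\<lambda>x. u \<epsilon> x - u 0 x) x))"
      by (intro set_borel_measurable_inner L2_measurable pL L2_scaleR H1_D(2)[OF D(1) H10_H1[OF uu]])
    then show "set_borel_measurable lborel D (\<lambda>x. nu0 * (?p x \<bullet> wgrad D (\<lambda>x. u \<epsilon> x - u 0 x) x))" by simp
    have "set_borel_measurable lborel D (\<lambda>x. (nu0 *\<^sub>R Du \<epsilon> x - nu0 *\<^sub>R Du 0 x) \<bullet> ?p x)"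
      by (intro set_borel_measurable_inner L2_measurable pL L2_scaleR L2_diff qL)
    then show "set_borel_measurable lborel D (\<lambda>x. (nu0 *\<^sub>R Du \<epsilon> x) \<bullet> ?p x - (nu0 *\<^sub>R Du 0 x) \<bullet> ?p x)"
      by (simp add: inner_diff_left)
  qed
  also have "\<dots> = (LINT x:D|lborel. (nu0 *\<^sub>R Du \<epsilon> x) \<bullet> ?p x) - (LINT x:D|lborel. (nu0 *\<^sub>R Du 0 x) \<bullet> ?p x)"
    by (intro set_integral_diff L2_inner L2_scaleR qL pL)
  finally have "G (\<lambda>x. u \<epsilon> x - u 0 x) = (LINT x:D|lborel. flow \<epsilon> x \<bullet> ?p x) - (LINT x:D|lborel. (nu0 *\<^sub>R Du \<epsilon> x) \<bullet> ?p x)"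
    using state_equations[OF e(1) p] by linarith
  also have "\<dots> = (LINT x:D|lborel. flow \<epsilon> x \<bullet> ?p x - (nu0 *\<^sub>R Du \<epsilon> x) \<bullet> ?p x)"
    by (intro set_integral_diff(2)[symmetric] L2_inner flow_L2 e L2_scaleR qL pL)
  also have "\<dots> = (LINT x:D|lborel. indicator (ball x0 \<epsilon>) x *\<^sub>R (gap (Du \<epsilon> x) \<bullet> ?p x))"
    by (rule set_lebesgue_integral_cong)
      (use D_borel in \<open>auto simp: flow_def T_eps_def gap_def indicator_def inner_diff_left\<close>)
  also have "\<dots> = (LINT x:ball x0 \<epsilon>|lborel. gap (Du \<epsilon> x) \<bullet> ?p x)"
    by (rule set_integral_indicator_subset[OF e(2)])
  finally show ?thesis .
qed

text \<open>The integrand is replaced by the constant \<open>gap b \<bullet> P0\<close>; by the Cauchy-Schwarz inequality the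
first error is controlled by the energy of \<open>err\<close>, the second one by the oscillation of the gradient
of \<open>p0\<close>.\<close>

lemma core_integral_tendsto:
  assumes p: "p0 \<in> H10 D" "\<exists>\<beta>>0. C1_holder Omd \<beta> p0"
  shows "((\<lambda>\<epsilon>. (LINT x:ball x0 \<epsilon>|lborel. gap (Du \<epsilon> x) \<bullet> wgrad D p0 x) / \<epsilon>\<^sup>2)
    \<longlongrightarrow> measure lborel (ball (0::real^2) 1) * (gap b \<bullet> grad p0 x0)) (at_right 0)"
proof -
  let ?p = "wgrad D p0" and ?P = "grad p0 x0"
  define M where "M = measure lborel (ball (0::real^2) 1)"
  define I1 where "I1 \<epsilon> = (LINT x:ball x0 \<epsilon>|lborel. (gap (Du \<epsilon> x) - gap b) \<bullet> ?p x)" for \<epsilon>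
  define I2 where "I2 \<epsilon> = (LINT x:ball x0 \<epsilon>|lborel. gap b \<bullet> (?p x - ?P))" for \<epsilon>
  define X where "X \<epsilon> = (LINT x:D|lborel. (norm (err \<epsilon> x))\<^sup>2) / \<epsilon>\<^sup>2" for \<epsilon>
  define Y where "Y \<epsilon> = (LINT x:ball x0 \<epsilon>|lborel. (norm (?p x - ?P))\<^sup>2) / \<epsilon>\<^sup>2" for \<epsilon>
  obtain \<beta> where \<beta>: "\<beta> > 0" "C1_holder Omd \<beta> p0" using p(2) by blast
  have X: "(X \<longlongrightarrow> 0) (at_right 0)" unfolding X_def[abs_def] by (rule err_energy_tendsto)
  have Y: "(Y \<longlongrightarrow> 0) (at_right 0)" unfolding Y_def[abs_def]
    by (rule mean_oscillation_tendsto_0[OF D(1) Omd H10_H1[OF p(1)] \<beta>(2,1)])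
  have good: "\<forall>\<^sub>F \<epsilon> in at_right 0. 0 < \<epsilon> \<and> ball x0 \<epsilon> \<subseteq> D"
    using eventually_small_ball(1)[OF D(1) subsetD[OF Omd(2,3)]] eventually_at_right_less[of "0::real"]
    by eventually_elim auto
  \<comment> \<open>\<open>X\<close> and \<open>Y\<close> are the two mean squares that tend to zero.\<close>
  have est: "(I1 \<epsilon> / \<epsilon>\<^sup>2)\<^sup>2 \<le> (3 * nu0)\<^sup>2 * X \<epsilon> * (2 * Y \<epsilon> + 2 * (M * (norm ?P)\<^sup>2))
      \<and> (I2 \<epsilon> / \<epsilon>\<^sup>2)\<^sup>2 \<le> M * (norm (gap b))\<^sup>2 * Y \<epsilon>
      \<and> I1 \<epsilon> / \<epsilon>\<^sup>2 + I2 \<epsilon> / \<epsilon>\<^sup>2 + M * (gap b \<bullet> ?P) = (LINT x:ball x0 \<epsilon>|lborel. gap (Du \<epsilon> x) \<bullet> ?p x) / \<epsilon>\<^sup>2"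
    if "0 < \<epsilon> \<and> ball x0 \<epsilon> \<subseteq> D" for \<epsilon>
  proof -
    let ?B = "ball x0 \<epsilon>"
    have e: "0 < \<epsilon>" "?B \<subseteq> D" using that by auto
    have mB: "measure lborel ?B = \<epsilon>\<^sup>2 * M" using measure_ball_scale[OF e(1), of x0] by (simp add: M_def)
    have pL: "L2 ?B ?p" by (rule L2_subset[OF H1_D(2)[OF D(1) H10_H1[OF p(1)]] _ e(2)]) simp
    have qL: "L2 ?B (Du \<epsilon>)" by (rule L2_subset[OF Du_L2 _ e(2)]) (use e in auto)
    have gL: "L2 ?B (\<lambda>x. gap (Du \<epsilon> x))" by (rule L2_Lipschitz_comp[OF qL gap_0 gap_Lipschitz])
    have dL: "L2 ?B (\<lambda>x. gap (Du \<epsilon> x) - gap b)" by (rule L2_diff[OF gL L2_const_ball])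
    have rL: "L2 ?B (\<lambda>x. ?p x - ?P)" by (rule L2_diff[OF pL L2_const_ball])
    have eL: "L2 ?B (err \<epsilon>)" by (rule L2_subset[OF err_L2[OF e(1)] _ e(2)]) simp
    have "(LINT x:?B|lborel. (norm (gap (Du \<epsilon> x) - gap b))\<^sup>2) \<le> (LINT x:?B|lborel. (3 * nu0)\<^sup>2 * (norm (err \<epsilon> x))\<^sup>2)"
    proof (rule set_integral_mono)
      show "set_integrable lborel ?B (\<lambda>x. (norm (gap (Du \<epsilon> x) - gap b))\<^sup>2)" by (rule L2_D2[OF dL])
      show "set_integrable lborel ?B (\<lambda>x. (3 * nu0)\<^sup>2 * (norm (err \<epsilon> x))\<^sup>2)"
        by (rule set_integrable_mult_right) (rule L2_D2[OF eL])
      fix x assume "x \<in> ?B"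
      then have "norm (gap (Du \<epsilon> x) - gap b) \<le> 3 * nu0 * norm (err \<epsilon> x)"
        using gap_Lipschitz[of "Du \<epsilon> x" b] err_in_core[OF _ e(1)] by simp
      then have "(norm (gap (Du \<epsilon> x) - gap b))\<^sup>2 \<le> (3 * nu0 * norm (err \<epsilon> x))\<^sup>2" by (rule power_mono) simp
      then show "(norm (gap (Du \<epsilon> x) - gap b))\<^sup>2 \<le> (3 * nu0)\<^sup>2 * (norm (err \<epsilon> x))\<^sup>2"
        by (simp only: power_mult_distrib)
    qed
    also have "\<dots> = (3 * nu0)\<^sup>2 * (LINT x:?B|lborel. (norm (err \<epsilon> x))\<^sup>2)" by (rule set_integral_mult_right)
    also have "\<dots> \<le> (3 * nu0)\<^sup>2 * (X \<epsilon> * \<epsilon>\<^sup>2)"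
    proof (rule mult_left_mono)
      have "(LINT x:?B|lborel. (norm (err \<epsilon> x))\<^sup>2) \<le> (LINT x:D|lborel. (norm (err \<epsilon> x))\<^sup>2)"
        by (rule set_integral_mono_set[OF L2_D2[OF err_L2[OF e(1)]] _ e(2)]) auto
      then show "(LINT x:?B|lborel. (norm (err \<epsilon> x))\<^sup>2) \<le> X \<epsilon> * \<epsilon>\<^sup>2" using e(1) by (simp add: X_def)
    qed simp
    finally have a1: "(LINT x:?B|lborel. (norm (gap (Du \<epsilon> x) - gap b))\<^sup>2) \<le> (3 * nu0)\<^sup>2 * (X \<epsilon> * \<epsilon>\<^sup>2)" .
    have cI: "(LINT x:?B|lborel. (norm (c :: real^2))\<^sup>2) = \<epsilon>\<^sup>2 * M * (norm c)\<^sup>2" for c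
      by (simp add: set_integral_const_ball mB)
    have YI: "(LINT x:?B|lborel. (norm (?p x - ?P))\<^sup>2) = Y \<epsilon> * \<epsilon>\<^sup>2" using e(1) by (simp add: Y_def)
    have a2: "(LINT x:?B|lborel. (norm (?p x))\<^sup>2) \<le> (2 * Y \<epsilon> + 2 * (M * (norm ?P)\<^sup>2)) * \<epsilon>\<^sup>2"
      using set_integral_norm_diff_le[OF rL L2_const_ball[of x0 \<epsilon> "- ?P"]] cI[of "- ?P"]
      unfolding YI by (simp add: algebra_simps)
    have nn: "0 \<le> (LINT x:?B|lborel. (norm (?p x))\<^sup>2)" "0 \<le> X \<epsilon>"
      unfolding X_def by (auto intro!: set_integral_nonneg' divide_nonneg_nonneg)
    have "(I1 \<epsilon>)\<^sup>2 \<le> ((3 * nu0)\<^sup>2 * (X \<epsilon> * \<epsilon>\<^sup>2)) * ((2 * Y \<epsilon> + 2 * (M * (norm ?P)\<^sup>2)) * \<epsilon>\<^sup>2)"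
      unfolding I1_def
      by (rule order_trans[OF L2_Cauchy_Schwarz[OF dL pL] mult_mono[OF a1 a2]]) (use nn in auto)
    then have r1: "(I1 \<epsilon> / \<epsilon>\<^sup>2)\<^sup>2 \<le> (3 * nu0)\<^sup>2 * X \<epsilon> * (2 * Y \<epsilon> + 2 * (M * (norm ?P)\<^sup>2))"
      using e(1) by (simp add: power_divide divide_le_eq power2_eq_square[of "\<epsilon>\<^sup>2"] ac_simps)
    have "(I2 \<epsilon>)\<^sup>2 \<le> (\<epsilon>\<^sup>2 * M * (norm (gap b))\<^sup>2) * (Y \<epsilon> * \<epsilon>\<^sup>2)"
      unfolding I2_def YI[symmetric] cI[symmetric] by (rule L2_Cauchy_Schwarz[OF L2_const_ball rL])
    then have r2: "(I2 \<epsilon> / \<epsilon>\<^sup>2)\<^sup>2 \<le> M * (norm (gap b))\<^sup>2 * Y \<epsilon>"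
      using e(1) by (simp add: power_divide divide_le_eq power2_eq_square[of "\<epsilon>\<^sup>2"] ac_simps)
    have "(LINT x:?B|lborel. gap (Du \<epsilon> x) \<bullet> ?p x)
      = (LINT x:?B|lborel. ((gap (Du \<epsilon> x) - gap b) \<bullet> ?p x + gap b \<bullet> (?p x - ?P)) + gap b \<bullet> ?P)"
      by (simp add: inner_diff_left inner_diff_right)
    also have "\<dots> = (LINT x:?B|lborel. (gap (Du \<epsilon> x) - gap b) \<bullet> ?p x + gap b \<bullet> (?p x - ?P)) + (LINT x:?B|lborel. gap b \<bullet> ?P)"
      by (intro set_integral_add L2_inner dL pL rL L2_const_ball)
    also have "(LINT x:?B|lborel. (gap (Du \<epsilon> x) - gap b) \<bullet> ?p x + gap b \<bullet> (?p x - ?P)) = I1 \<epsilon> + I2 \<epsilon>"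
      unfolding I1_def I2_def by (intro set_integral_add L2_inner dL pL rL L2_const_ball)
    also have "(LINT x:?B|lborel. gap b \<bullet> ?P) = \<epsilon>\<^sup>2 * M * (gap b \<bullet> ?P)"
      by (simp add: set_integral_const_ball mB)
    finally have r3: "I1 \<epsilon> / \<epsilon>\<^sup>2 + I2 \<epsilon> / \<epsilon>\<^sup>2 + M * (gap b \<bullet> ?P) = (LINT x:ball x0 \<epsilon>|lborel. gap (Du \<epsilon> x) \<bullet> ?p x) / \<epsilon>\<^sup>2"
      using e(1) by (simp add: add_divide_distrib)
    show ?thesis using r1 r2 r3 by blast
  qed
  have i1: "((\<lambda>\<epsilon>. I1 \<epsilon> / \<epsilon>\<^sup>2) \<longlongrightarrow> 0) (at_right 0)"
  proof (rule tendsto_0_of_square, rule Lim_null_comparison)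
    have "((\<lambda>\<epsilon>. (3 * nu0)\<^sup>2 * X \<epsilon> * (2 * Y \<epsilon> + 2 * (M * (norm ?P)\<^sup>2)))
      \<longlongrightarrow> (3 * nu0)\<^sup>2 * 0 * (2 * 0 + 2 * (M * (norm ?P)\<^sup>2))) (at_right 0)"
      by (intro tendsto_intros X Y)
    then show "((\<lambda>\<epsilon>. (3 * nu0)\<^sup>2 * X \<epsilon> * (2 * Y \<epsilon> + 2 * (M * (norm ?P)\<^sup>2))) \<longlongrightarrow> 0) (at_right 0)" by simp
    show "\<forall>\<^sub>F \<epsilon> in at_right 0. norm ((I1 \<epsilon> / \<epsilon>\<^sup>2)\<^sup>2) \<le> (3 * nu0)\<^sup>2 * X \<epsilon> * (2 * Y \<epsilon> + 2 * (M * (norm ?P)\<^sup>2))"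
      using good by eventually_elim (use est in auto)
  qed
  have i2: "((\<lambda>\<epsilon>. I2 \<epsilon> / \<epsilon>\<^sup>2) \<longlongrightarrow> 0) (at_right 0)"
  proof (rule tendsto_0_of_square, rule Lim_null_comparison)
    show "((\<lambda>\<epsilon>. M * (norm (gap b))\<^sup>2 * Y \<epsilon>) \<longlongrightarrow> 0) (at_right 0)"
      by (rule tendsto_mult_right_zero[OF Y])
    show "\<forall>\<^sub>F \<epsilon> in at_right 0. norm ((I2 \<epsilon> / \<epsilon>\<^sup>2)\<^sup>2) \<le> M * (norm (gap b))\<^sup>2 * Y \<epsilon>"
      using good by eventually_elim (use est in auto)
  qed
  have "((\<lambda>\<epsilon>. I1 \<epsilon> / \<epsilon>\<^sup>2 + I2 \<epsilon> / \<epsilon>\<^sup>2 + M * (gap b \<bullet> ?P)) \<longlongrightarrow> 0 + 0 + M * (gap b \<bullet> ?P)) (at_right 0)"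
    by (intro tendsto_intros i1 i2)
  then have "((\<lambda>\<epsilon>. I1 \<epsilon> / \<epsilon>\<^sup>2 + I2 \<epsilon> / \<epsilon>\<^sup>2 + M * (gap b \<bullet> ?P)) \<longlongrightarrow> M * (gap b \<bullet> ?P)) (at_right 0)" by simp
  then show ?thesis unfolding M_def[symmetric]
  proof (rule Lim_transform_eventually)
    show "\<forall>\<^sub>F \<epsilon> in at_right 0. I1 \<epsilon> / \<epsilon>\<^sup>2 + I2 \<epsilon> / \<epsilon>\<^sup>2 + M * (gap b \<bullet> ?P)
      = (LINT x:ball x0 \<epsilon>|lborel. gap (Du \<epsilon> x) \<bullet> ?p x) / \<epsilon>\<^sup>2"
      using good by eventually_elim (use est in blast)
  qed
qed

text \<open>As \<open>r < 1\<close>, the removed disc has a radius that is large compared with \<open>\<epsilon>\<close>. What is left is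
the error and a tail of the dipole.\<close>

lemma far_energy_tendsto:
  assumes "0 < \<alpha>" "r < 1"
  shows "((\<lambda>\<epsilon>. (LINT x:(D - ball x0 (\<alpha> * \<epsilon> powr r))|lborel. (norm (wgrad D (\<lambda>x. u \<epsilon> x - u 0 x) x))\<^sup>2) / \<epsilon>\<^sup>2) \<longlongrightarrow> 0) (at_right 0)"
proof (rule Lim_null_comparison)
  define a where "a = b - grad (u 0) x0"
  define tail where "tail s = (LINT z|lborel. indicator {z. s \<le> norm z} z * (norm (dipole a z))\<^sup>2)" for s
  define X where "X \<epsilon> = (LINT x:D|lborel. (norm (err \<epsilon> x))\<^sup>2) / \<epsilon>\<^sup>2" for \<epsilon>
  have X: "(X \<longlongrightarrow> 0) (at_right 0)" unfolding X_def[abs_def] by (rule err_energy_tendsto)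
  have "filterlim (\<lambda>\<epsilon>. (inverse \<epsilon>) powr (1 - r)) at_top (at_right (0::real))"
  proof -
    have "((\<lambda>\<epsilon>. (inverse \<epsilon>) powr (r - 1)) \<longlongrightarrow> 0) (at_right (0::real))"
      by (rule tendsto_neg_powr[OF _ filterlim_inverse_at_top_right]) (use assms in simp)
    then have "filterlim (\<lambda>\<epsilon>. inverse ((inverse \<epsilon>) powr (r - 1))) at_top (at_right (0::real))"
      by (rule filterlim_inverse_at_top)
        (use eventually_at_right_less[of "0::real"] in \<open>auto elim!: eventually_mono\<close>)
    then show ?thesis by (simp flip: powr_minus)
  qed
  then have fl: "filterlim (\<lambda>\<epsilon>. \<alpha> * (inverse \<epsilon>) powr (1 - r)) at_top (at_right (0::real))"
    by (rule filterlim_tendsto_pos_mult_at_top[OF tendsto_const assms(1)])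
  have tail: "((\<lambda>\<epsilon>. tail (\<alpha> * (inverse \<epsilon>) powr (1 - r))) \<longlongrightarrow> 0) (at_right 0)"
    unfolding tail_def by (rule filterlim_compose[OF dipole_tail_tendsto_0 fl])
  have "((\<lambda>\<epsilon>. 2 * X \<epsilon> + 2 * tail (\<alpha> * (inverse \<epsilon>) powr (1 - r))) \<longlongrightarrow> 2 * 0 + 2 * 0) (at_right 0)"
    by (intro tendsto_intros X tail)
  then show "((\<lambda>\<epsilon>. 2 * X \<epsilon> + 2 * tail (\<alpha> * (inverse \<epsilon>) powr (1 - r))) \<longlongrightarrow> 0) (at_right 0)" by simp
  have "\<forall>\<^sub>F \<epsilon> in at_right (0::real). 1 \<le> \<alpha> * (inverse \<epsilon>) powr (1 - r)"
    using fl by (simp add: filterlim_at_top)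
  with eventually_at_right_less[of "0::real"]
  show "\<forall>\<^sub>F \<epsilon> in at_right 0. norm ((LINT x:(D - ball x0 (\<alpha> * \<epsilon> powr r))|lborel. (norm (wgrad D (\<lambda>x. u \<epsilon> x - u 0 x) x))\<^sup>2) / \<epsilon>\<^sup>2)
    \<le> 2 * X \<epsilon> + 2 * tail (\<alpha> * (inverse \<epsilon>) powr (1 - r))"
  proof eventually_elim
    case (elim \<epsilon>)
    define s where "s = \<alpha> * (inverse \<epsilon>) powr (1 - r)"
    define S where "S = D - ball x0 (\<alpha> * \<epsilon> powr r)"
    have "(inverse \<epsilon>) powr (1 - r) = \<epsilon> powr r / \<epsilon>"
    proof -
      have "(inverse \<epsilon>) powr (1 - r) = inverse (\<epsilon> powr (1 - r))" using elim(1) by (simp add: inverse_powr)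
      also have "\<epsilon> powr (1 - r) = \<epsilon> / \<epsilon> powr r" using elim(1) by (simp add: powr_diff)
      finally show ?thesis by simp
    qed
    then have se: "s * \<epsilon> = \<alpha> * \<epsilon> powr r" using elim(1) by (simp add: s_def)
    have s1: "1 \<le> s" using elim(2) by (simp add: s_def)
    have S: "S \<in> sets borel" "S \<subseteq> D" using D_borel by (auto simp: S_def)
    have far: "s \<le> norm (zoom x0 \<epsilon> x)" "core \<epsilon> x = 0" if "x \<in> S" for x
    proof -
      have "\<not> dist x0 x < s * \<epsilon>" using that by (simp add: S_def se)
      then show "s \<le> norm (zoom x0 \<epsilon> x)" using norm_zoom_less[OF elim(1), of x0 x s] by simp
      then show "core \<epsilon> x = 0" using norm_zoom_less[OF elim(1), of x0 x 1] s1 by (simp add: core_def)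
    qed
    have uu: "(\<lambda>x. u \<epsilon> x - u 0 x) \<in> H10 D" by (rule H10_diff[OF D(1) u_H10 u_H10]) (use elim in auto)
    have eL: "L2 S (err \<epsilon>)" by (rule L2_subset[OF err_L2[OF elim(1)] S])
    have lL: "L2 S (\<lambda>x. - layer \<epsilon> x)"
      using L2_scaleR[OF L2_subset[OF layer_L2[OF elim(1)] S], of "-1"] by simp
    have wL: "L2 S (wgrad D (\<lambda>x. u \<epsilon> x - u 0 x))" by (rule L2_subset[OF H1_D(2)[OF D(1) H10_H1[OF uu]] S])
    have "(LINT x:S|lborel. (norm (wgrad D (\<lambda>x. u \<epsilon> x - u 0 x) x))\<^sup>2) = (LINT x:S|lborel. (norm (err \<epsilon> x - - layer \<epsilon> x))\<^sup>2)"
    proof (rule set_integral_cong_AE')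
      show "AE x in lborel. x \<in> S \<longrightarrow> (norm (wgrad D (\<lambda>x. u \<epsilon> x - u 0 x) x))\<^sup>2 = (norm (err \<epsilon> x - - layer \<epsilon> x))\<^sup>2"
        using wgrad_diff_AE[OF D(1) H10_H1[OF u_H10] H10_H1[OF u_H10], of \<epsilon> 0, OF less_imp_le[OF elim(1)] order_refl]
        by eventually_elim (use S(2) far(2) in \<open>auto simp: err_def Du_def\<close>)
    qed (intro set_borel_measurable_norm_sq L2_measurable wL L2_diff eL lL)+
    also have "\<dots> \<le> 2 * (LINT x:S|lborel. (norm (err \<epsilon> x))\<^sup>2) + 2 * (LINT x:S|lborel. (norm (- layer \<epsilon> x))\<^sup>2)"
      by (rule set_integral_norm_diff_le[OF eL lL])
    also have "\<dots> \<le> 2 * (X \<epsilon> * \<epsilon>\<^sup>2) + 2 * (tail s * \<epsilon>\<^sup>2)"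
    proof (intro add_mono mult_left_mono)
      have "(LINT x:S|lborel. (norm (err \<epsilon> x))\<^sup>2) \<le> (LINT x:D|lborel. (norm (err \<epsilon> x))\<^sup>2)"
        by (rule set_integral_mono_set[OF L2_D2[OF err_L2[OF elim(1)]] S]) simp
      then show "(LINT x:S|lborel. (norm (err \<epsilon> x))\<^sup>2) \<le> X \<epsilon> * \<epsilon>\<^sup>2" using elim(1) by (simp add: X_def)
      have di: "integrable lborel (\<lambda>z. indicator {z. s \<le> norm z} z * (norm (dipole a z))\<^sup>2)"
        using integrable_mult_indicator[of "{z. s \<le> norm z}" lborel "\<lambda>z. (norm (dipole a z))\<^sup>2"] L2_dipole[of a]
        by (simp add: L2_UNIV_iff)
      have "(LINT x:S|lborel. (norm (- layer \<epsilon> x))\<^sup>2)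
        \<le> (LINT x|lborel. indicator {z. s \<le> norm z} (zoom x0 \<epsilon> x) * (norm (dipole a (zoom x0 \<epsilon> x)))\<^sup>2)"
        unfolding set_lebesgue_integral_def
      proof (rule integral_mono)
        show "integrable lborel (\<lambda>x. indicator {z. s \<le> norm z} (zoom x0 \<epsilon> x) * (norm (dipole a (zoom x0 \<epsilon> x)))\<^sup>2)"
          by (rule integrable_zoom[OF elim(1) di])
        show "integrable lborel (\<lambda>x. indicator S x *\<^sub>R (norm (- layer \<epsilon> x))\<^sup>2)"
          using L2_D2[OF lL] by (simp add: set_integrable_def)
        show "indicator S x *\<^sub>R (norm (- layer \<epsilon> x))\<^sup>2
          \<le> indicator {z. s \<le> norm z} (zoom x0 \<epsilon> x) * (norm (dipole a (zoom x0 \<epsilon> x)))\<^sup>2" for x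
          using far(1)[of x] by (auto simp: indicator_def layer_def a_def)
      qed
      also have "\<dots> = \<epsilon>\<^sup>2 * tail s"
        unfolding tail_def
        by (rule integral_zoom[OF elim(1), of "\<lambda>z. indicator {z. s \<le> norm z} z * (norm (dipole a z))\<^sup>2"]) measurable
      finally show "(LINT x:S|lborel. (norm (- layer \<epsilon> x))\<^sup>2) \<le> tail s * \<epsilon>\<^sup>2" by (simp add: mult.commute)
    qed auto
    finally have "(LINT x:S|lborel. (norm (wgrad D (\<lambda>x. u \<epsilon> x - u 0 x) x))\<^sup>2) / \<epsilon>\<^sup>2 \<le> 2 * X \<epsilon> + 2 * tail s"
      using elim(1) by (simp add: divide_le_eq algebra_simps)
    moreover have "0 \<le> (LINT x:S|lborel. (norm (wgrad D (\<lambda>x. u \<epsilon> x - u 0 x) x))\<^sup>2) / \<epsilon>\<^sup>2"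
      by (intro divide_nonneg_nonneg set_integral_nonneg') auto
    ultimately show ?case by (simp add: S_def s_def)
  qed
qed

lemma topological_derivative:
  assumes J: "cond_J D x0 J u G \<delta>J \<alpha> r" and p0: "solves_linear D nu0 (\<lambda>\<eta>. - G \<eta>) p0"
    and reg: "\<exists>\<beta>>0. C1_holder Omd \<beta> p0"
  shows "has_topological_derivative J u
    (measure lborel (ball (0::real^2) 1) * (gap b \<bullet> grad p0 x0) + \<delta>J)"
proof -
  let ?g = "measure lborel (ball (0::real^2) 1) * (gap b \<bullet> grad p0 x0)"
  let ?far = "\<lambda>\<epsilon>. LINT x:(D - ball x0 (\<alpha> * \<epsilon> powr r))|lborel. (norm (wgrad D (\<lambda>x. u \<epsilon> x - u 0 x) x))\<^sup>2"
  obtain R \<epsilon>0 where \<alpha>: "0 < \<alpha>" "r < 1" and e0: "\<epsilon>0 > 0"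
    and exp: "\<And>\<epsilon>. \<epsilon> \<in> {0..<\<epsilon>0} \<Longrightarrow> J (u \<epsilon>) = J (u 0) + G (\<lambda>x. u \<epsilon> x - u 0 x) + \<delta>J * \<epsilon>\<^sup>2 + R \<epsilon>"
    and R: "R \<in> O[at_right 0](?far)"
    using J unfolding cond_J_def by blast
  have nz: "\<forall>\<^sub>F \<epsilon> in at_right 0. \<epsilon>\<^sup>2 \<noteq> (0::real)"
    using eventually_at_right_less[of "0::real"] by eventually_elim simp
  have "?far \<in> o[at_right 0](\<lambda>\<epsilon>. \<epsilon>\<^sup>2)"
    by (rule smalloI_tendsto[OF far_energy_tendsto[OF \<alpha>] nz])
  with R have Ro: "R \<in> o[at_right 0](\<lambda>\<epsilon>. \<epsilon>\<^sup>2)" by (rule landau_o.big_small_trans)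
  have p: "p0 \<in> H10 D" using p0 by (simp add: solves_linear_def)
  let ?I = "\<lambda>\<epsilon>. LINT x:ball x0 \<epsilon>|lborel. gap (Du \<epsilon> x) \<bullet> wgrad D p0 x"
  have Io: "(\<lambda>\<epsilon>. ?I \<epsilon> - \<epsilon>\<^sup>2 * ?g) \<in> o[at_right 0](\<lambda>\<epsilon>. \<epsilon>\<^sup>2)"
  proof (rule smalloI_tendsto[OF _ nz])
    have "((\<lambda>\<epsilon>. ?I \<epsilon> / \<epsilon>\<^sup>2 - ?g) \<longlongrightarrow> ?g - ?g) (at_right 0)"
      by (intro tendsto_intros core_integral_tendsto[OF p reg])
    then have "((\<lambda>\<epsilon>. ?I \<epsilon> / \<epsilon>\<^sup>2 - ?g) \<longlongrightarrow> 0) (at_right 0)" by simp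
    then show "((\<lambda>\<epsilon>. (?I \<epsilon> - \<epsilon>\<^sup>2 * ?g) / \<epsilon>\<^sup>2) \<longlongrightarrow> 0) (at_right 0)"
    proof (rule Lim_transform_eventually)
      show "\<forall>\<^sub>F \<epsilon> in at_right 0. ?I \<epsilon> / \<epsilon>\<^sup>2 - ?g = (?I \<epsilon> - \<epsilon>\<^sup>2 * ?g) / \<epsilon>\<^sup>2"
        using nz by eventually_elim (simp add: diff_divide_distrib)
    qed
  qed
  have "(\<lambda>\<epsilon>. (?I \<epsilon> - \<epsilon>\<^sup>2 * ?g) + R \<epsilon>) \<in> o[at_right 0](\<lambda>\<epsilon>. \<epsilon>\<^sup>2)"
    by (rule sum_in_smallo(1)[OF Io Ro])
  moreover have "\<forall>\<^sub>F \<epsilon> in at_right 0. J (u \<epsilon>) - J (u 0) - \<epsilon>\<^sup>2 * (?g + \<delta>J) = (?I \<epsilon> - \<epsilon>\<^sup>2 * ?g) + R \<epsilon>"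
  proof -
    have "\<forall>\<^sub>F \<epsilon> in at_right 0. \<epsilon> < \<epsilon>0" using e0 by (auto simp: eventually_at_right_field)
    with eventually_at_right_less[of "0::real"] eventually_small_ball(1)[OF D(1) subsetD[OF Omd(2,3)]]
    show ?thesis
    proof eventually_elim
      case (elim \<epsilon>)
      then show ?case using exp[of \<epsilon>] adjoint_representation[OF elim(1,2) p0] by (simp add: algebra_simps)
    qed
  qed
  ultimately show ?thesis
    unfolding has_topological_derivative_def
    by (subst landau_o.small.in_cong) auto
qed

end

section \<open>The polarization matrix of the disc\<close>

lemma matrix_scaleR_vector_mult: "(c *\<^sub>R A) *v v = c *\<^sub>R (A *v v)" for A :: "real^2^2"
  by (simp add: vec_eq_iff forall_2 matrix_vector_mult_def sum_2 algebra_simps)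

context material
begin

lemma H_gradient_in_disc:
  assumes H: "solves_H nu0 nu (ball 0 1) U H" and b: "T_op nu b + nu0 *\<^sub>R b = (2 * nu0) *\<^sub>R U"
  shows "AE x in lborel. x \<in> ball 0 1 \<longrightarrow> qgrad H x = b - U"
proof (rule transmission_solution_in_disc[OF nu0_pos m_pos, where A = "\<lambda>v. T_op nu (U + v) - T_op nu U"
      and B = "(nu0 - nu (norm U)) *\<^sub>R U" and L = "2 * nu0"])
  show "norm ((T_op nu (U + v) - T_op nu U) - (T_op nu (U + w) - T_op nu U)) \<le> 2 * nu0 * norm (v - w)" for v w
    using T_Lipschitz[of "U + v" "U + w"] by simp
  show "m * (norm (v - w))\<^sup>2 \<le> ((T_op nu (U + v) - T_op nu U) - (T_op nu (U + w) - T_op nu U)) \<bullet> (v - w)" for v w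
    using T_strongly_monotone[of "U + v" "U + w"] by simp
  have "T_op nu b = nu0 *\<^sub>R U + nu0 *\<^sub>R U - nu0 *\<^sub>R b"
  proof -
    have "(2 * nu0) *\<^sub>R U = nu0 *\<^sub>R U + nu0 *\<^sub>R U" by (simp flip: scaleR_left_distrib)
    then show ?thesis using b by (simp add: eq_diff_eq)
  qed
  then show "(T_op nu (U + (b - U)) - T_op nu U) - (nu0 - nu (norm U)) *\<^sub>R U = - (nu0 *\<^sub>R (b - U))"
    by (simp add: T_op_def[of nu U] scaleR_diff_left scaleR_diff_right)
qed (use H in \<open>auto simp: solves_H_def\<close>)

lemma K_gradient_in_disc:
  assumes K: "solves_K nu0 nu (ball 0 1) U P K"
    and k: "DT_op nu U *v k + nu0 *\<^sub>R k = nu0 *\<^sub>R P - DT_op nu U *v P"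
  shows "AE x in lborel. x \<in> ball 0 1 \<longrightarrow> qgrad K x = k"
proof -
  obtain L where L: "\<And>v. norm (DT_op nu U *v v) \<le> L * norm v"
    using linear_bounded[OF matrix_vector_mul_linear[of "DT_op nu U"]] by (auto simp: mult.commute)
  show ?thesis
  proof (rule transmission_solution_in_disc[OF nu0_pos m_pos, where A = "\<lambda>v. DT_op nu U *v v"
        and B = "(nu0 *\<^sub>R mat 1 - DT_op nu U) *v P" and L = L])
    show "norm (DT_op nu U *v v - DT_op nu U *v w) \<le> L * norm (v - w)" for v w
      using L[of "v - w"] by (simp add: matrix_vector_mult_diff_distrib)
    show "m * (norm (v - w))\<^sup>2 \<le> (DT_op nu U *v v - DT_op nu U *v w) \<bullet> (v - w)" for v w
      using DT_coercive[of "v - w" U] by (simp add: matrix_vector_mult_diff_distrib)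
    have "(nu0 *\<^sub>R mat 1 - DT_op nu U) *v P = nu0 *\<^sub>R P - DT_op nu U *v P"
      by (simp add: matrix_vector_mult_diff_rdistrib matrix_scaleR_vector_mult)
    then show "DT_op nu U *v k - (nu0 *\<^sub>R mat 1 - DT_op nu U) *v P = - (nu0 *\<^sub>R k)"
      using k by (simp add: algebra_simps)
  qed (use K in \<open>auto simp: solves_K_def\<close>)
qed

lemma DT_symmetric: "(DT_op nu U *v v) \<bullet> w = v \<bullet> (DT_op nu U *v w)"
  by (simp add: DT_apply inner_add_left inner_add_right inner_commute[of v U])

text \<open>The columns of \<open>R\<close> are the direction of \<open>U\<close> and its normal, the eigenvectors of \<open>DT\<close>.\<close>

lemma DT_in_axes:
  assumes R: "orthogonal_matrix R" "U = norm U *\<^sub>R column 1 R"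
  shows "DT_op nu U *v v = ((nu (norm U) + deriv_hl nu (norm U) * norm U) * (column 1 R \<bullet> v)) *\<^sub>R column 1 R
    + (nu (norm U) * (column 2 R \<bullet> v)) *\<^sub>R column 2 R"
proof -
  define r where "r = norm U"
  define E1 E2 where "E1 = column 1 R" and "E2 = column 2 R"
  define d where "d = deriv_hl nu r"
  have U: "U = r *\<^sub>R E1" using R(2) by (simp add: r_def E1_def)
  have v: "v = (E1 \<bullet> v) *\<^sub>R E1 + (E2 \<bullet> v) *\<^sub>R E2"
    unfolding E1_def E2_def by (rule orthogonal_columns(4)[OF R(1)])
  have "(d / r * (U \<bullet> v)) *\<^sub>R U = (d * r * (E1 \<bullet> v)) *\<^sub>R E1"
    unfolding U by (cases "r = 0") auto
  then have "DT_op nu U *v v = nu r *\<^sub>R v + (d * r * (E1 \<bullet> v)) *\<^sub>R E1"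
    unfolding DT_apply r_def[symmetric] d_def[symmetric] by simp
  also have "nu r *\<^sub>R v = (nu r * (E1 \<bullet> v)) *\<^sub>R E1 + (nu r * (E2 \<bullet> v)) *\<^sub>R E2"
    by (subst v) (simp add: scaleR_add_right)
  finally show ?thesis unfolding r_def[symmetric] d_def[symmetric] E1_def[symmetric] E2_def[symmetric]
    by (simp add: scaleR_add_left distrib_right)
qed

lemma lambda_pos: "0 < nu (norm U) + nu0" "0 < nu (norm U) + deriv_hl nu (norm U) * norm U + nu0"
  using nu_bounds(1)[of "norm U"] lambda2_bounds[of U] m_pos nu0_pos by auto

text \<open>The vector \<open>w\<close> is \<open>2 \<nu>0 (DT + \<nu>0)^(-1) P\<close>, in the axes of \<open>DT\<close>.\<close>

lemma disc_response:
  fixes R :: "real^2^2" and U P :: "real^2"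
  assumes R: "orthogonal_matrix R" "U = norm U *\<^sub>R column 1 R"
  defines "w \<equiv> (2 * nu0 / (nu (norm U) + deriv_hl nu (norm U) * norm U + nu0) * (column 1 R \<bullet> P)) *\<^sub>R column 1 R
      + (2 * nu0 / (nu (norm U) + nu0) * (column 2 R \<bullet> P)) *\<^sub>R column 2 R"
  shows "DT_op nu U *v w + nu0 *\<^sub>R w = (2 * nu0) *\<^sub>R P"
proof -
  define l1 l2 where "l1 = nu (norm U)" and "l2 = nu (norm U) + deriv_hl nu (norm U) * norm U"
  define E1 E2 where "E1 = column 1 R" and "E2 = column 2 R"
  have pos: "l1 + nu0 \<noteq> 0" "l2 + nu0 \<noteq> 0" using lambda_pos[of U] by (auto simp: l1_def l2_def)
  have E: "E1 \<bullet> E1 = 1" "E2 \<bullet> E2 = 1" "E1 \<bullet> E2 = 0" "E2 \<bullet> E1 = 0"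
    using orthogonal_columns(1-3)[OF R(1)] by (auto simp: E1_def E2_def inner_commute)
  define c1 c2 where "c1 = 2 * nu0 / (l2 + nu0) * (E1 \<bullet> P)" and "c2 = 2 * nu0 / (l1 + nu0) * (E2 \<bullet> P)"
  have w: "w = c1 *\<^sub>R E1 + c2 *\<^sub>R E2" by (simp add: w_def c1_def c2_def l1_def l2_def E1_def E2_def)
  have wc: "E1 \<bullet> w = c1" "E2 \<bullet> w = c2" by (simp_all add: w inner_add_right E)
  have "DT_op nu U *v w = (l2 * c1) *\<^sub>R E1 + (l1 * c2) *\<^sub>R E2"
    using DT_in_axes[OF R, of w]
    unfolding l2_def[symmetric] unfolding l1_def[symmetric] E1_def[symmetric] E2_def[symmetric] wc .
  then have "DT_op nu U *v w + nu0 *\<^sub>R w = (c1 * (l2 + nu0)) *\<^sub>R E1 + (c2 * (l1 + nu0)) *\<^sub>R E2"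
    by (simp add: w algebra_simps)
  also have "\<dots> = (2 * nu0 * (E1 \<bullet> P)) *\<^sub>R E1 + (2 * nu0 * (E2 \<bullet> P)) *\<^sub>R E2"
    using pos by (simp add: c1_def c2_def)
  also have "\<dots> = (2 * nu0) *\<^sub>R ((E1 \<bullet> P) *\<^sub>R E1 + (E2 \<bullet> P) *\<^sub>R E2)"
    by (simp add: scaleR_add_right)
  also have "(E1 \<bullet> P) *\<^sub>R E1 + (E2 \<bullet> P) *\<^sub>R E2 = P"
    unfolding E1_def E2_def by (rule orthogonal_columns(4)[OF R(1), symmetric])
  finally show ?thesis .
qed

end

lemma set_integral_ball_const_AE:
  fixes f :: "real^2 \<Rightarrow> real^2"
  assumes "AE x in lborel. x \<in> ball c r \<longrightarrow> f x = k" "set_borel_measurable lborel (ball c r) f"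
  shows "(LINT x:ball c r|lborel. f x) = measure lborel (ball c r) *\<^sub>R k"
proof -
  have "(LINT x:ball c r|lborel. f x) = (LINT x:ball c r|lborel. k)"
    by (rule set_integral_cong_AE'[OF assms]) (rule borel_set_borel_measurable; simp)
  then show ?thesis by (simp add: set_integral_const_ball)
qed

lemma qgrad_measurable: "X \<in> Hq \<Longrightarrow> qgrad X \<in> borel_measurable borel"
  using qgrad_L2(1) by (simp add: L2_UNIV_iff)

theorem theorem5:
  fixes nu0 nulow :: real and nu :: "real \<Rightarrow> real"
    and D Omd \<omega> :: "(real^2) set"
    and F J G :: "(real^2 \<Rightarrow> real) \<Rightarrow> real"
    and x0 U0 P0 :: "real^2"
    and u :: "real \<Rightarrow> real^2 \<Rightarrow> real" and p0 :: "real^2 \<Rightarrow> real"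
    and \<delta>J \<alpha> r lambda1 lambda2 :: real
    and H :: "(real^2 \<Rightarrow> real) set" and K :: "real^2 \<Rightarrow> (real^2 \<Rightarrow> real) set"
    and M R :: "real^2^2"
  assumes omega: "\<omega> = ball 0 1"
    and nu0: "nu0 > 0" and nu_nonneg: "\<And>s. s \<ge> 0 \<Longrightarrow> nu s \<ge> 0"
    and N1: "cond_N1 nu0 nulow nu" and N2: "cond_N2 nu" and N3: "cond_N3 nu0 nulow nu"
    and D: "open D" "connected D" "bounded D"
    and F: "bounded_form_H10 D F" "compactly_in (dist_support D F) D"
    and Omd: "open Omd" "compactly_in Omd (D - dist_support D F)" "x0 \<in> Omd"
    and u0: "solves_linear D nu0 F (u 0)"
    and u_eps: "\<And>\<epsilon>. \<epsilon> > 0 \<Longrightarrow> solves_perturbed D nu0 nu F (scaled x0 \<omega> \<epsilon>) (u \<epsilon>)"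
    and J: "cond_J D x0 J u G \<delta>J \<alpha> r"
    and p0: "solves_linear D nu0 (\<lambda>\<eta>. - G \<eta>) p0"
    and u0_reg: "\<exists>\<beta>>0. C1_holder Omd \<beta> (u 0)"
    and p0_reg: "\<exists>\<beta>>0. C1_holder Omd \<beta> p0"
    and U0: "U0 = grad (u 0) x0" and P0: "P0 = grad p0 x0"
    and H: "solves_H nu0 nu \<omega> U0 H"
    and K: "\<And>P. solves_K nu0 nu \<omega> U0 P (K P)"
    and M: "M = matrix (M_map nu0 nu \<omega> U0 K)"
    and lam1: "lambda1 = nu (norm U0)"
    and lam2: "lambda2 = nu (norm U0) + deriv_hl nu (norm U0) * norm U0"
    and R: "rotation_matrix R" "U0 = R *v vector [norm U0, 0]"
  shows "linear (M_map nu0 nu \<omega> U0 K)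
    \<and> has_topological_derivative J u
        (U0 \<bullet> (M *v P0)
         + (LINT x:\<omega>|lborel. S_op nu U0 (qgrad H x) \<bullet> (P0 + qgrad (K P0) x))
         + \<delta>J)
    \<and> M = (2 * measure lborel \<omega> * nu0) *\<^sub>R
        (R ** vector [vector [(lambda1 - nu0) / (lambda2 + nu0), 0],
                      vector [0, (lambda1 - nu0) / (lambda1 + nu0)]] ** transpose R)"
proof -
  interpret material nu0 nulow nu by unfold_locales (rule N1)
  obtain b where bU: "T_op nu b + nu0 *\<^sub>R b = (2 * nu0) *\<^sub>R U0" using exists_interior_field by blast
  have OmdD: "Omd \<subseteq> D" using Omd(2) closure_subset[of Omd] by (auto simp: compactly_in_def)
  interpret inclusion nu0 nulow nu D Omd x0 b F u
    by unfold_locales (use D Omd(1,3) OmdD u0 u_eps u0_reg bU in \<open>simp_all add: omega U0\<close>)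
  have orth: "orthogonal_matrix R" using R(1) by (simp add: rotation_matrix_def)
  have U: "U0 = norm U0 *\<^sub>R column 1 R" using R(2) unfolding rotated_axis .
  define \<mu> where "\<mu> = measure lborel (ball (0::real^2) 1)"
  define Q where "Q = R ** vector [vector [(lambda1 - nu0) / (lambda2 + nu0), 0],
                      vector [0, (lambda1 - nu0) / (lambda1 + nu0)]] ** transpose R"
  \<comment> \<open>The constant value of \<open>P + qgrad (K P)\<close> in the disc.\<close>
  define w where "w P = (2 * nu0 / (lambda2 + nu0) * (column 1 R \<bullet> P)) *\<^sub>R column 1 R
      + (2 * nu0 / (lambda1 + nu0) * (column 2 R \<bullet> P)) *\<^sub>R column 2 R" for P
  have w: "DT_op nu U0 *v w P + nu0 *\<^sub>R w P = (2 * nu0) *\<^sub>R P" for P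
    using disc_response[OF orth U, of P] by (simp add: w_def lam1 lam2)
  have two: "(2 * nu0) *\<^sub>R v = nu0 *\<^sub>R v + nu0 *\<^sub>R v" for v :: "real^2"
    by (simp flip: scaleR_left_distrib)
  have K_AE: "AE x in lborel. x \<in> ball 0 1 \<longrightarrow> qgrad (K P) x = w P - P" for P
  proof (rule K_gradient_in_disc[OF K[unfolded omega]])
    show "DT_op nu U0 *v (w P - P) + nu0 *\<^sub>R (w P - P) = nu0 *\<^sub>R P - DT_op nu U0 *v P"
      using w[of P] unfolding two matrix_vector_mult_diff_distrib scaleR_diff_right by (simp add: algebra_simps)
  qed
  have H_AE: "AE x in lborel. x \<in> ball 0 1 \<longrightarrow> qgrad H x = b - U0"
    by (rule H_gradient_in_disc[OF H[unfolded omega] bU])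
  have KHq: "K P \<in> Hq" for P using K by (simp add: solves_K_def)
  have HHq: "H \<in> Hq" using H by (simp add: solves_H_def)
  have map: "M_map nu0 nu \<omega> U0 K P = (lambda1 - nu0) *\<^sub>R (\<mu> *\<^sub>R w P)" for P
  proof -
    have "(LINT x:ball 0 1|lborel. P + qgrad (K P) x) = \<mu> *\<^sub>R w P"
      unfolding \<mu>_def
    proof (rule set_integral_ball_const_AE)
      show "AE x in lborel. x \<in> ball 0 1 \<longrightarrow> P + qgrad (K P) x = w P"
        using K_AE[of P] by eventually_elim auto
      show "set_borel_measurable lborel (ball 0 1) (\<lambda>x. P + qgrad (K P) x)"
        by (rule borel_set_borel_measurable) (use qgrad_measurable[OF KHq] in auto)
    qed
    then show ?thesis by (simp add: M_map_def omega lam1)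
  qed
  have "M_map nu0 nu \<omega> U0 K P = ((2 * \<mu> * nu0) *\<^sub>R Q) *v P" for P
    unfolding map matrix_scaleR_vector_mult Q_def conjugated_diagonal_apply w_def
    by (simp add: scaleR_add_right field_simps)
  then have mm: "M_map nu0 nu \<omega> U0 K = (\<lambda>P. ((2 * \<mu> * nu0) *\<^sub>R Q) *v P)" by blast
  have lin: "linear (M_map nu0 nu \<omega> U0 K)" unfolding mm by (rule matrix_vector_mul_linear)
  have M_eq: "M = (2 * \<mu> * nu0) *\<^sub>R Q" unfolding M mm by (rule matrix_of_matrix_vector_mul)
  have MP: "M *v P0 = (lambda1 - nu0) *\<^sub>R (\<mu> *\<^sub>R w P0)" unfolding M_eq map[symmetric] mm ..
  have S_int: "(LINT x:\<omega>|lborel. S_op nu U0 (qgrad H x) \<bullet> (P0 + qgrad (K P0) x)) = \<mu> * (S_op nu U0 (b - U0) \<bullet> w P0)"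
  proof -
    have S_meas: "S_op nu U0 \<in> borel_measurable borel"
    proof (rule borel_measurable_continuous_onI)
      have "continuous_on UNIV (\<lambda>v. T_op nu (U0 + v))"
        by (rule continuous_of_Lipschitz[of _ "2 * nu0"]) (use T_Lipschitz[of "U0 + _" "U0 + _"] in simp)
      then show "continuous_on UNIV (S_op nu U0)"
        unfolding S_op_def[abs_def] by (intro continuous_intros matrix_vector_mult_linear_continuous_on)
    qed
    note qH = qgrad_measurable[OF HHq] and qK = qgrad_measurable[OF KHq]
    have "(LINT x:ball 0 1|lborel. S_op nu U0 (qgrad H x) \<bullet> (P0 + qgrad (K P0) x)) = (LINT x:ball (0::real^2) 1|lborel. S_op nu U0 (b - U0) \<bullet> w P0)"
    proof (rule set_integral_cong_AE')
      show "AE x in lborel. x \<in> ball 0 1 \<longrightarrow> S_op nu U0 (qgrad H x) \<bullet> (P0 + qgrad (K P0) x) = S_op nu U0 (b - U0) \<bullet> w P0"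
        using H_AE K_AE[of P0] by eventually_elim auto
      show "set_borel_measurable lborel (ball 0 1) (\<lambda>x. S_op nu U0 (qgrad H x) \<bullet> (P0 + qgrad (K P0) x))"
        by (rule borel_set_borel_measurable)
          (intro borel_measurable_inner measurable_compose[OF qH S_meas] borel_measurable_add borel_measurable_const qK, simp)
      show "set_borel_measurable lborel (ball (0::real^2) 1) (\<lambda>x. S_op nu U0 (b - U0) \<bullet> w P0)"
        by (rule borel_set_borel_measurable) auto
    qed
    then show ?thesis by (simp add: omega set_integral_const_ball \<mu>_def)
  qed
  have Tb: "T_op nu b = nu0 *\<^sub>R U0 + nu0 *\<^sub>R U0 - nu0 *\<^sub>R b"
    using bU unfolding two by (simp add: eq_diff_eq)
  have gap_b: "gap b = - ((2 * nu0) *\<^sub>R (b - U0))"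
    unfolding gap_def Tb two by (simp add: algebra_simps)
  have TU: "T_op nu U0 = lambda1 *\<^sub>R U0" by (simp add: T_op_def lam1)
  \<comment> \<open>The equation for \<open>b\<close> removes \<open>T\<close>; the symmetry of \<open>DT\<close> then moves \<open>DT + \<nu>0\<close> onto \<open>w P0\<close>.\<close>
  have "(lambda1 - nu0) * (U0 \<bullet> w P0) + S_op nu U0 (b - U0) \<bullet> w P0
      = ((lambda1 - nu0) *\<^sub>R U0 + S_op nu U0 (b - U0)) \<bullet> w P0"
    by (simp add: inner_add_left)
  also have "(lambda1 - nu0) *\<^sub>R U0 + S_op nu U0 (b - U0) = - (DT_op nu U0 *v (b - U0) + nu0 *\<^sub>R (b - U0))"
    by (simp add: S_op_def TU Tb algebra_simps)
  also have "\<dots> \<bullet> w P0 = - ((b - U0) \<bullet> (DT_op nu U0 *v w P0 + nu0 *\<^sub>R w P0))"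
    by (simp add: inner_add_left inner_add_right inner_diff_left DT_symmetric)
  also have "\<dots> = gap b \<bullet> P0" unfolding w gap_b by simp
  finally have alg: "(lambda1 - nu0) * (U0 \<bullet> w P0) + S_op nu U0 (b - U0) \<bullet> w P0 = gap b \<bullet> P0" .
  have "has_topological_derivative J u (\<mu> * (gap b \<bullet> P0) + \<delta>J)"
    using topological_derivative[OF J p0 p0_reg] by (simp add: \<mu>_def P0)
  also have "\<mu> * (gap b \<bullet> P0) = U0 \<bullet> (M *v P0)
         + (LINT x:\<omega>|lborel. S_op nu U0 (qgrad H x) \<bullet> (P0 + qgrad (K P0) x))"
    unfolding alg[symmetric] MP S_int by (simp add: algebra_simps)
  finally show ?thesis using lin M_eq unfolding Q_def \<mu>_def omega by blast
qed

end
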